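(* Let $f:\overline{\mathbb C}\to\overline{\mathbb C}$ be a rational map of degree at least $2$ that satisfies the Summable Shrinking of components condition. If the Julia set $J$ of $f$ is connected, then $J$ is locally connected.
   Context: $\overline{\mathbb C}$ is the Riemann sphere with the spherical metric; $\delta(\cdot,\cdot)$ is the spherical distance, and balls $B(z,r)$ and diameters are taken with respect to it. Summable Shrinking of components condition (SumShrink): a rational map $f$ with Julia set $J$ satisfies this condition if there are $r>0$ and a sequence $(\omega_n)_{n\ge 1}$ of positive numbers with $\sum_{n>0}\omega_n<\infty$ such that for all $z\in J$, all $n>0$ and every connected component $W$ of $f^{-n}(B(z,r))$ one has $\operatorname{diam} W<\omega_n$. Locally connected: a closed set $A\subseteq\overline{\mathbb C}$ is locally connected if for every $\tau>0$ there is $\theta>0$ such that for any two points $a,b\in A$ with $\delta(a,b)<\theta$ there is a continuum $B\subseteq A$ (a compact connected set with more than one point) with $a,b\in B$ and $\operatorname{diam} B<\tau$. *)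

theory Defs
  imports "HOL-Analysis.Analysis" "HOL-Computational_Algebra.Polynomial"
begin

section \<open>The Riemann sphere with the spherical metric\<close>

datatype csphere = Fin complex | Infty

text \<open>Inverse stereographic projection onto the unit sphere of \<open>complex \<times> real\<close>, i.e. of
  three-dimensional Euclidean space.\<close>

definition stereo :: "csphere \<Rightarrow> complex \<times> real" where
  "stereo x = (case x of
      Fin z \<Rightarrow> ((2 / (1 + (cmod z)\<^sup>2)) *\<^sub>R z, ((cmod z)\<^sup>2 - 1) / ((cmod z)\<^sup>2 + 1))
    | Infty \<Rightarrow> (0, 1))"

lemma norm_stereo [simp]: "norm (stereo x) = 1"
proof (cases x)
  case (Fin z)
  define t where "t = (cmod z)\<^sup>2"
  have t: "t \<ge> 0" by (simp add: t_def)
  have "(norm (stereo x))\<^sup>2 = (2 / (1 + t))\<^sup>2 * t + ((t - 1) / (t + 1))\<^sup>2"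
    by (simp add: Fin stereo_def norm_prod_def power_mult_distrib power_divide t_def)
  also have "\<dots> = (4 * t + (t - 1)\<^sup>2) / (t + 1)\<^sup>2"
    by (simp add: power_divide add_divide_distrib add.commute)
  also have "4 * t + (t - 1)\<^sup>2 = (t + 1)\<^sup>2"
    by (simp add: power2_eq_square algebra_simps)
  also have "(t + 1)\<^sup>2 / (t + 1)\<^sup>2 = 1"
    using t by simp
  finally have "(norm (stereo x))\<^sup>2 = 1\<^sup>2" by simp
  then show ?thesis
    by (simp only: power2_eq_iff_nonneg norm_ge_zero zero_le_one)
qed (simp add: stereo_def norm_prod_def)

lemma inj_stereo: "inj stereo"
proof (rule injI)
  fix x y assume eq: "stereo x = stereo y"
  have snd_ne: "((cmod z)\<^sup>2 - 1) / ((cmod z)\<^sup>2 + 1) \<noteq> 1" for z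
  proof -
    have "(cmod z)\<^sup>2 + 1 > 0" by (simp add: add_nonneg_pos)
    then show ?thesis by (simp add: divide_eq_eq)
  qed
  show "x = y"
  proof (cases x)
    case (Fin z)
    show ?thesis
    proof (cases y)
      case (Fin w)
      have pos: "(cmod z)\<^sup>2 + 1 > 0" "(cmod w)\<^sup>2 + 1 > 0" by (simp_all add: add_nonneg_pos)
      have "((cmod z)\<^sup>2 - 1) / ((cmod z)\<^sup>2 + 1) = ((cmod w)\<^sup>2 - 1) / ((cmod w)\<^sup>2 + 1)"
        and s: "(2 / (1 + (cmod z)\<^sup>2)) *\<^sub>R z = (2 / (1 + (cmod w)\<^sup>2)) *\<^sub>R w"
        using eq Fin \<open>x = Fin z\<close> by (simp_all add: stereo_def)
      then have "((cmod z)\<^sup>2 - 1) * ((cmod w)\<^sup>2 + 1) = ((cmod w)\<^sup>2 - 1) * ((cmod z)\<^sup>2 + 1)"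
        using pos by (simp add: frac_eq_eq)
      then have e: "(cmod z)\<^sup>2 = (cmod w)\<^sup>2" by (simp add: algebra_simps)
      from s have "(2 / (1 + (cmod w)\<^sup>2)) *\<^sub>R z = (2 / (1 + (cmod w)\<^sup>2)) *\<^sub>R w"
        by (simp only: e)
      then have "z = w" using pos(2) by (simp add: add.commute)
      then show ?thesis using Fin \<open>x = Fin z\<close> by simp
    next
      case Infty
      then show ?thesis using eq Fin snd_ne by (simp add: stereo_def)
    qed
  next
    case Infty
    then show ?thesis using eq snd_ne[symmetric] by (cases y) (simp_all add: stereo_def)
  qed
qed

lemma arccos_inner_triangle:
  fixes a b c :: "'a::real_inner"
  assumes n: "norm a = 1" "norm b = 1" "norm c = 1"
  shows "arccos (a \<bullet> c) \<le> arccos (a \<bullet> b) + arccos (b \<bullet> c)"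
proof (cases "arccos (a \<bullet> b) + arccos (b \<bullet> c) \<le> pi")
  case False
  have "\<bar>a \<bullet> c\<bar> \<le> 1" using Cauchy_Schwarz_ineq2[of a c] n by simp
  then have "arccos (a \<bullet> c) \<le> pi" by (intro arccos_ubound) auto
  then show ?thesis using False by simp
next
  case True
  have ab: "\<bar>a \<bullet> b\<bar> \<le> 1" and bc: "\<bar>b \<bullet> c\<bar> \<le> 1" and ac: "\<bar>a \<bullet> c\<bar> \<le> 1"
    using Cauchy_Schwarz_ineq2[of a b] Cauchy_Schwarz_ineq2[of b c] Cauchy_Schwarz_ineq2[of a c] n
    by simp_all
  define u where "u = a - (a \<bullet> b) *\<^sub>R b"
  define v where "v = c - (b \<bullet> c) *\<^sub>R b"
  have bb: "a \<bullet> a = 1" "b \<bullet> b = 1" "c \<bullet> c = 1" using n by (simp_all add: dot_square_norm)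
  have uv: "u \<bullet> v = a \<bullet> c - (a \<bullet> b) * (b \<bullet> c)"
    by (simp add: u_def v_def inner_diff_left inner_diff_right bb inner_commute)
  have "u \<bullet> u = 1 - (a \<bullet> b)\<^sup>2"
    by (simp add: u_def inner_diff_left inner_diff_right bb inner_commute power2_eq_square)
  then have nu: "norm u = sin (arccos (a \<bullet> b))"
    using ab by (simp add: norm_eq_sqrt_inner sin_arccos_abs)
  have "v \<bullet> v = 1 - (b \<bullet> c)\<^sup>2"
    by (simp add: v_def inner_diff_left inner_diff_right bb inner_commute power2_eq_square)
  then have nv: "norm v = sin (arccos (b \<bullet> c))"
    using bc by (simp add: norm_eq_sqrt_inner sin_arccos_abs)
  have "cos (arccos (a \<bullet> b) + arccos (b \<bullet> c)) = (a \<bullet> b) * (b \<bullet> c) - norm u * norm v"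
    using ab bc by (simp add: cos_add nu nv cos_arccos_abs)
  also have "\<dots> \<le> a \<bullet> c"
    using Cauchy_Schwarz_ineq2[of u v] uv by linarith
  finally have le: "cos (arccos (a \<bullet> b) + arccos (b \<bullet> c)) \<le> a \<bullet> c" .
  have "0 \<le> arccos (a \<bullet> b) + arccos (b \<bullet> c)"
    using ab bc by (intro add_nonneg_nonneg arccos_lbound) auto
  then have "arccos (a \<bullet> b) + arccos (b \<bullet> c) =
      arccos (cos (arccos (a \<bullet> b) + arccos (b \<bullet> c)))"
    using True by (simp add: arccos_cos)
  also have "\<dots> \<ge> arccos (a \<bullet> c)"
    using ac le by (intro arccos_le_arccos) auto
  finally show ?thesis .
qed

text \<open>The distance is the geodesic (great circle) distance, i.e. the one with line element
  \<open>2 |dz| / (1 + |z|\<^sup>2)\<close>.\<close>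

instantiation csphere :: metric_space
begin

definition dist_csphere :: "csphere \<Rightarrow> csphere \<Rightarrow> real" where
  "dist_csphere x y = arccos (stereo x \<bullet> stereo y)"

definition uniformity_csphere :: "(csphere \<times> csphere) filter" where
  "uniformity_csphere = (INF e\<in>{0 <..}. principal {(x, y). dist x y < e})"

definition open_csphere :: "csphere set \<Rightarrow> bool" where
  "open_csphere U \<longleftrightarrow> (\<forall>x\<in>U. \<forall>\<^sub>F (x', y) in uniformity. x' = x \<longrightarrow> y \<in> U)"

instance
proof
  fix x y z :: csphere
  show "dist x y = 0 \<longleftrightarrow> x = y"
  proof
    assume "dist x y = 0"
    moreover have "\<bar>stereo x \<bullet> stereo y\<bar> \<le> 1"
      using Cauchy_Schwarz_ineq2[of "stereo x" "stereo y"] by simp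
    ultimately have "stereo x \<bullet> stereo y = 1"
      unfolding dist_csphere_def by (metis cos_arccos_abs cos_zero)
    moreover have "(a - b) \<bullet> (a - b) = a \<bullet> a - 2 * (a \<bullet> b) + b \<bullet> b" for a b :: "complex \<times> real"
      by (simp add: inner_diff_left inner_diff_right inner_commute[of b a])
    ultimately have "(stereo x - stereo y) \<bullet> (stereo x - stereo y) = 0"
      using dot_square_norm[of "stereo x"] dot_square_norm[of "stereo y"]
      by (simp only: norm_stereo) simp
    then show "x = y" using inj_stereo by (simp add: inj_eq)
  qed (simp add: dist_csphere_def dot_square_norm)
  show "dist x y \<le> dist x z + dist y z"
    using arccos_inner_triangle[of "stereo x" "stereo z" "stereo y"]
    by (simp add: dist_csphere_def inner_commute)
qed (rule uniformity_csphere_def open_csphere_def)+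

end


section \<open>Rational maps and their Julia sets\<close>

text \<open>The self-map of the sphere given by \<open>p / q\<close> (for coprime \<open>p\<close>, \<open>q\<close> with \<open>q \<noteq> 0\<close>). The value
  at infinity is the limit of \<open>p z / q z\<close> as \<open>z\<close> tends to infinity; note that
  \<open>coeff p (degree q) = 0\<close> if \<open>degree p < degree q\<close>.\<close>

definition rat_map :: "complex poly \<Rightarrow> complex poly \<Rightarrow> csphere \<Rightarrow> csphere" where
  "rat_map p q x = (case x of
      Fin z \<Rightarrow> (if poly q z = 0 then Infty else Fin (poly p z / poly q z))
    | Infty \<Rightarrow> (if degree q < degree p then Infty else Fin (coeff p (degree q) / lead_coeff q)))"

definition rational_map_of_degree :: "(csphere \<Rightarrow> csphere) \<Rightarrow> nat \<Rightarrow> bool" where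
  "rational_map_of_degree f d \<longleftrightarrow>
     (\<exists>p q. q \<noteq> 0 \<and> coprime p q \<and> f = rat_map p q \<and> d = max (degree p) (degree q))"

definition normal_family_on :: "('a::metric_space \<Rightarrow> 'b::metric_space) set \<Rightarrow> 'a set \<Rightarrow> bool" where
  "normal_family_on F U \<longleftrightarrow>
     (\<forall>h :: nat \<Rightarrow> 'a \<Rightarrow> 'b. range h \<subseteq> F \<longrightarrow>
        (\<exists>s g. strict_mono s \<and>
           (\<forall>K. compact K \<and> K \<subseteq> U \<longrightarrow> uniform_limit K (h \<circ> s) g sequentially)))"

definition fatou_set :: "(csphere \<Rightarrow> csphere) \<Rightarrow> csphere set" where
  "fatou_set f = {z. \<exists>U. open U \<and> z \<in> U \<and> normal_family_on (range (\<lambda>n. f ^^ n)) U}"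

definition julia_set :: "(csphere \<Rightarrow> csphere) \<Rightarrow> csphere set" where
  "julia_set f = - fatou_set f"


section \<open>Summable shrinking of components and local connectedness\<close>

definition sum_shrink :: "(csphere \<Rightarrow> csphere) \<Rightarrow> bool" where
  "sum_shrink f \<longleftrightarrow>
     (\<exists>r>0. \<exists>\<omega> :: nat \<Rightarrow> real. (\<forall>n\<ge>1. \<omega> n > 0) \<and> summable (\<lambda>n. \<omega> (Suc n)) \<and>
        (\<forall>z\<in>julia_set f. \<forall>n>0. \<forall>W\<in>components ((f ^^ n) -` ball z r). diameter W < \<omega> n))"

definition continuum :: "'a::metric_space set \<Rightarrow> bool" where
  "continuum B \<longleftrightarrow> compact B \<and> connected B \<and> (\<exists>x\<in>B. \<exists>y\<in>B. x \<noteq> y)"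

text \<open>A metric notion of local connectedness for closed sets; since a continuum is nondegenerate,
  the case \<open>a = b\<close> excludes isolated points.\<close>

definition loc_connected :: "'a::metric_space set \<Rightarrow> bool" where
  "loc_connected A \<longleftrightarrow> closed A \<and>
     (\<forall>\<tau>>0. \<exists>\<theta>>0. \<forall>a\<in>A. \<forall>b\<in>A. dist a b < \<theta> \<longrightarrow>
        (\<exists>B. continuum B \<and> B \<subseteq> A \<and> a \<in> B \<and> b \<in> B \<and> diameter B < \<tau>))"

end

theory Submission
  imports
    Defs
    "HOL-Complex_Analysis.Riemann_Mapping"
    "HOL-Computational_Algebra.Fundamental_Theorem_Algebra"
begin

text \<open>
  Pullbacks of small balls centred at \<open>J\<close> meet \<open>J\<close>, so a Fatou point whose \<open>n\<close>-th image is close to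
  \<open>J\<close> is \<open>\<omega> n\<close>-close to \<open>J\<close>; hence every Fatou orbit eventually stays away from \<open>J\<close>, and every Fatou
  component has a finite forward orbit. A Fatou point of high escape level is joined to points of
  lower and lower escape level by lifting, at level \<open>n\<close>, boundedly many small connected sets, at a
  cost of \<open>O(\<omega> n)\<close>; summability bounds the total cost. Since \<open>J\<close> is connected, Fatou components are
  simply connected, so \<open>f\<close> is injective on all but finitely many of them and the escape argument shows
  that only finitely many components have diameter at least \<open>\<epsilon>\<close>. Consequently any two
  points of a Fatou component can be joined inside the Fatou set by a connected set that is uniformly
  far from \<open>J\<close> except within \<open>\<epsilon>\<close> of the two points.

  If \<open>J\<close> were not locally connected, there would be arbitrarily short segments \<open>I\<close> with end points
  in \<open>J\<close> that cross a simply connected Fatou component \<open>U\<close>, such that both sides of \<open>I\<close> in \<open>U\<close> reach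
  a definite distance from \<open>I\<close>. But \<open>I\<close> separates the two sides, so a connected set joining points of
  the two sides would have to come close to \<open>J\<close> near \<open>I\<close>, far from both points.
\<close>

section \<open>Topology of the sphere\<close>

text \<open>The depth \<open>r0\<close> in the escape estimate is a minimum over components, so the
  estimate exists only for a finite forward-invariant family, whereas there may be infinitely many
  Fatou components. The others need a different argument: off a finite family \<open>f\<close> is
  injective on each component, all points of a component are led to one common point, and the cost
  of getting there bounds the diameter. Injectivity holds because a component without critical
  points covers its simply connected image. The pullback condition controls only sets inside a ball
  centred at \<open>J\<close>, so links are guaranteed only at depth less than \<rho>. Chains
  therefore never have to cross the deep part of a component: it is enough that they reach depth
  \<open>r0\<close>. What happens in the deep part is left to compactness, after one fixed level
  \<open>N\<close> has been chosen. Connected sets take the place of paths throughout. Plane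
  topology is applied in a chart that omits a point of \<open>J\<close>, so that the whole Fatou set
  lies in the plane.\<close>

lemma dist_stereo_le: "dist (stereo x) (stereo y) \<le> dist x y"
proof -
  let ?a = "stereo x" and ?b = "stereo y"
  have ab: "\<bar>?a \<bullet> ?b\<bar> \<le> 1"
    using Cauchy_Schwarz_ineq2[of ?a ?b] by simp
  define t where "t = dist x y"
  have ct: "?a \<bullet> ?b = cos t"
    using ab by (simp add: t_def dist_csphere_def cos_arccos_abs)
  have "?a \<bullet> ?a = 1" "?b \<bullet> ?b = 1"
    by (simp_all add: dot_square_norm)
  then have "(dist ?a ?b)\<^sup>2 = 2 - 2 * cos t"
    by (simp add: dist_norm power2_norm_eq_inner inner_diff_left inner_diff_right inner_commute ct)
  also have "\<dots> = (2 * sin (t / 2))\<^sup>2"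
    using cos_double_sin[of "t / 2"] by (simp add: power_mult_distrib)
  also have "\<dots> \<le> t\<^sup>2"
  proof -
    have "\<bar>2 * sin (t / 2)\<bar> \<le> \<bar>t\<bar>"
      using abs_sin_x_le_abs_x[of "t / 2"] by simp
    then show ?thesis by (simp add: abs_le_square_iff)
  qed
  finally show ?thesis
    by (simp add: t_def power2_le_iff_abs_le)
qed

lemma continuous_on_stereo: "continuous_on A stereo"
  unfolding continuous_on_iff using dist_stereo_le le_less_trans by blast

text \<open>The geodesic metric induces the topology of the embedding in Euclidean space: a chord is
  no longer than its arc, and conversely \<open>arccos\<close> is continuous on [-1, 1]. Continuity
  of maps into the sphere can thus be checked after \<open>stereo\<close>.\<close>

lemma tendsto_csphereI:
  assumes "((\<lambda>n. stereo (g n)) \<longlongrightarrow> stereo x) F"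
  shows "(g \<longlongrightarrow> x) F"
proof -
  have i: "((\<lambda>n. stereo (g n) \<bullet> stereo x) \<longlongrightarrow> stereo x \<bullet> stereo x) F"
    by (intro tendsto_intros assms)
  have "stereo x \<bullet> stereo x = 1"
    by (simp add: dot_square_norm)
  moreover have "stereo (g n) \<bullet> stereo x \<in> {-1..1}" for n
  proof -
    have "\<bar>stereo (g n) \<bullet> stereo x\<bar> \<le> 1"
      using Cauchy_Schwarz_ineq2[of "stereo (g n)" "stereo x"] by simp
    then show ?thesis unfolding atLeastAtMost_iff by linarith
  qed
  ultimately have "((\<lambda>n. arccos (stereo (g n) \<bullet> stereo x)) \<longlongrightarrow> arccos 1) F"
    using i by (intro continuous_on_tendsto_compose[OF continuous_on_arccos']) auto
  then have "((\<lambda>n. dist (g n) x) \<longlongrightarrow> 0) F"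
    by (simp add: dist_csphere_def)
  then show ?thesis
    using tendsto_dist_iff by blast
qed

lemma stereo_Fin: "stereo (Fin z) = ((2 / (1 + (cmod z)\<^sup>2)) *\<^sub>R z, ((cmod z)\<^sup>2 - 1) / ((cmod z)\<^sup>2 + 1))"
  unfolding stereo_def by (simp only: csphere.case)

lemma one_add_norm_sq_pos [simp]: "1 + (cmod z)\<^sup>2 > 0" "1 + (cmod z)\<^sup>2 \<noteq> 0" "(cmod z)\<^sup>2 + 1 \<noteq> 0"
  by (smt (verit) zero_le_power2)+

lemma continuous_on_Fin: "continuous_on A Fin"
proof -
  have "continuous_on A (\<lambda>z. stereo (Fin z))"
    unfolding stereo_Fin by (intro continuous_intros) simp_all
  then have "((\<lambda>z. stereo (Fin z)) \<longlongrightarrow> stereo (Fin a)) (at a within A)" if "a \<in> A" for a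
    using that by (simp add: continuous_on_def)
  then show ?thesis by (simp add: continuous_on_def tendsto_csphereI)
qed

text \<open>Stereographic projection from the north pole. Written through \<open>stereo\<close>, it
  is visibly continuous off \<open>Infty\<close>, where the denominator vanishes.\<close>

definition fin_part :: "csphere \<Rightarrow> complex" where
  "fin_part x = (1 / (1 - snd (stereo x))) *\<^sub>R fst (stereo x)"

lemma snd_stereo_Fin: "1 - snd (stereo (Fin z)) = 2 / (1 + (cmod z)\<^sup>2)"
  by (simp add: stereo_Fin field_simps)

lemma fin_part_Fin [simp]: "fin_part (Fin z) = z"
proof -
  have "t > 0 \<Longrightarrow> (1 / (2 / t)) *\<^sub>R ((2 / t) *\<^sub>R z) = z" for t :: real
    by simp
  from this[OF one_add_norm_sq_pos(1)] show ?thesis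
    unfolding fin_part_def snd_stereo_Fin by (simp only: stereo_Fin fst_conv)
qed

lemma not_Infty_iff: "x \<noteq> Infty \<longleftrightarrow> (\<exists>z. x = Fin z)"
  by (cases x) auto

lemma Compl_Infty: "- {Infty} = range Fin"
  using not_Infty_iff by auto

lemma continuous_on_fin_part: "continuous_on (- {Infty}) fin_part"
proof -
  have "1 - snd (stereo x) \<noteq> 0" if "x \<in> - {Infty}" for x
  proof -
    obtain z where "x = Fin z" using \<open>x \<in> - {Infty}\<close> not_Infty_iff by auto
    then show ?thesis by (simp only: snd_stereo_Fin) simp
  qed
  then show ?thesis
    unfolding fin_part_def by (intro continuous_intros continuous_on_stereo) auto
qed

lemma open_image_Fin: assumes "open U" shows "open (Fin ` U)"
proof -
  have "open (fin_part -` U \<inter> - {Infty})"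
    using continuous_on_fin_part assms by (subst (asm) continuous_on_open_vimage) auto
  also have "fin_part -` U \<inter> - {Infty} = Fin ` U"
    by (auto simp: Compl_Infty)
  finally show ?thesis .
qed

lemma open_vimage_Fin: "open S \<Longrightarrow> open (Fin -` S)"
  by (rule open_vimage[OF _ continuous_on_Fin])

text \<open>The map 1/z. On the unit sphere it is the half-turn about the real axis, hence an
  isometry; it carries statements about finite points over to infinity.\<close>

definition inv_sphere :: "csphere \<Rightarrow> csphere" where
  "inv_sphere x = (case x of Fin z \<Rightarrow> if z = 0 then Infty else Fin (1 / z) | Infty \<Rightarrow> Fin 0)"

lemma inv_sphere_inv_sphere [simp]: "inv_sphere (inv_sphere x) = x"
  by (cases x) (auto simp: inv_sphere_def)

lemma stereo_inv_sphere: "stereo (inv_sphere x) = (cnj (fst (stereo x)), - snd (stereo x))"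
proof (cases x)
  case (Fin z)
  show ?thesis
  proof (cases "z = 0")
    case False
    define t where "t = (cmod z)\<^sup>2"
    have t: "t > 0" using False by (simp add: t_def)
    have "1 / z = cnj z / t"
      using False complex_norm_square[of z] by (simp add: t_def divide_simps mult.commute)
    moreover have "(2 / (1 + 1 / t)) *\<^sub>R (cnj z / t) = (2 / (1 + t)) *\<^sub>R cnj z"
    proof -
      have "(2 / (1 + 1 / t)) *\<^sub>R (cnj z / t) = ((2 / (1 + 1 / t)) / t) *\<^sub>R cnj z"
        by (simp add: scaleR_conv_of_real)
      also have "(2 / (1 + 1 / t)) / t = 2 / (1 + t)"
      proof -
        have "(2 / (1 + 1 / t)) / t = 2 / (t * (1 + 1 / t))" by simp
        also have "t * (1 + 1 / t) = 1 + t" using t by (simp add: distrib_left)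
        finally show ?thesis .
      qed
      finally show ?thesis .
    qed
    moreover have "(1 / t - 1) / (1 / t + 1) = - ((t - 1) / (t + 1))"
    proof -
      have "(1 / t - 1) / (1 / t + 1) = (t * (1 / t - 1)) / (t * (1 / t + 1))"
        using t by simp
      also have "\<dots> = (1 - t) / (1 + t)" using t by (simp add: distrib_left right_diff_distrib)
      finally show ?thesis by (simp add: minus_divide_left add.commute)
    qed
    moreover have "(cmod (1 / z))\<^sup>2 = 1 / t"
      by (simp add: norm_divide power_divide t_def)
    ultimately show ?thesis
      using False Fin by (simp add: inv_sphere_def stereo_Fin t_def[symmetric] complex_cnj_scaleR)
  qed (simp add: Fin inv_sphere_def stereo_def)
qed (simp add: inv_sphere_def stereo_def)

lemma dist_inv_sphere [simp]: "dist (inv_sphere x) (inv_sphere y) = dist x y"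
  by (simp add: dist_csphere_def stereo_inv_sphere inner_prod_def inner_complex_def)

lemma continuous_on_inv_sphere: "continuous_on A inv_sphere"
  unfolding continuous_on_iff dist_inv_sphere by blast

lemma open_image_inv_sphere: assumes "open U" shows "open (inv_sphere ` U)"
proof -
  have "inv_sphere ` U = inv_sphere -` U"
  proof (intro subset_antisym subsetI)
    fix x assume "x \<in> inv_sphere -` U"
    then have "inv_sphere (inv_sphere x) \<in> inv_sphere ` U" by blast
    then show "x \<in> inv_sphere ` U" by simp
  qed auto
  then show ?thesis
    using open_vimage[OF assms continuous_on_inv_sphere] by simp
qed

section \<open>Compactness, connectedness and local connectedness of the sphere\<close>

lemma range_Fin_Un: "(UNIV :: csphere set) = Fin ` cball 0 1 \<union> inv_sphere ` Fin ` cball 0 1"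
proof -
  have "x \<in> Fin ` cball 0 1 \<union> inv_sphere ` Fin ` cball 0 1" for x
  proof (cases x)
    case (Fin z)
    show ?thesis
    proof (cases "cmod z \<le> 1")
      case False
      then have "x = inv_sphere (Fin (1 / z))" "cmod (1 / z) \<le> 1"
        using Fin by (auto simp: inv_sphere_def norm_divide divide_le_eq)
      then show ?thesis by auto
    qed (use Fin in auto)
  next
    case Infty
    then have "x = inv_sphere (Fin 0)" by (simp add: inv_sphere_def)
    then show ?thesis by auto
  qed
  then show ?thesis by blast
qed

lemma compact_UNIV_csphere: "compact (UNIV :: csphere set)"
  by (subst range_Fin_Un)
     (intro compact_Un compact_continuous_image continuous_on_inv_sphere continuous_on_Fin compact_cball)

lemma compact_csphere_iff: "compact (S :: csphere set) \<longleftrightarrow> closed S"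
  using compact_Int_closed[OF compact_UNIV_csphere, of S] compact_imp_closed by auto

lemma connected_UNIV_csphere: "connected (UNIV :: csphere set)"
proof -
  have "connected (Fin ` cball 0 1 \<union> inv_sphere ` Fin ` cball 0 1)"
  proof (rule connected_Un)
    have "Fin 1 \<in> Fin ` cball 0 1" "inv_sphere (Fin 1) = Fin 1"
      by (auto simp: inv_sphere_def)
    then show "Fin ` cball 0 1 \<inter> inv_sphere ` Fin ` cball 0 1 \<noteq> {}"
      by (metis IntI empty_iff imageI)
  qed (intro connected_continuous_image continuous_on_inv_sphere continuous_on_Fin connected_cball)+
  then show ?thesis
    by (simp flip: range_Fin_Un)
qed

lemma csphere_connected_nbhd:
  fixes x :: csphere
  assumes "open S" "x \<in> S"
  obtains P where "open P" "connected P" "x \<in> P" "P \<subseteq> S"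
proof -
  have *: "\<exists>P. open P \<and> connected P \<and> Fin z \<in> P \<and> P \<subseteq> T" if T: "open T" "Fin z \<in> T" for z T
  proof -
    obtain e where e: "e > 0" "ball z e \<subseteq> Fin -` T"
      using open_vimage_Fin[OF T(1)] T(2) open_contains_ball by blast
    then show ?thesis
      by (intro exI[of _ "Fin ` ball z e"] conjI open_image_Fin connected_continuous_image
            continuous_on_Fin) auto
  qed
  show ?thesis
  proof (cases x)
    case (Fin z)
    then show ?thesis using * assms that by blast
  next
    case Infty
    have "open (inv_sphere ` S)" "Fin 0 \<in> inv_sphere ` S"
      using assms Infty imageI[of Infty S inv_sphere]
      by (simp_all only: open_image_inv_sphere) (simp add: inv_sphere_def)
    then obtain P where P: "open P" "connected P" "Fin 0 \<in> P" "P \<subseteq> inv_sphere ` S"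
      using * by blast
    show ?thesis
    proof
      show "open (inv_sphere ` P)" "connected (inv_sphere ` P)"
        using P by (auto intro: open_image_inv_sphere connected_continuous_image continuous_on_inv_sphere)
      show "x \<in> inv_sphere ` P" using imageI[OF P(3), of inv_sphere] Infty
        by (simp add: inv_sphere_def)
      show "inv_sphere ` P \<subseteq> S" using P(4) by auto
    qed
  qed
qed

lemma open_components_csphere:
  fixes S :: "csphere set"
  assumes "open S" "C \<in> components S"
  shows "open C"
proof (subst open_subopen, safe)
  fix x assume "x \<in> C"
  then have "x \<in> S" using assms(2) in_components_subset by blast
  then obtain P where P: "open P" "connected P" "x \<in> P" "P \<subseteq> S"
    using csphere_connected_nbhd assms(1) by blast
  then have "P \<subseteq> C"
    using components_maximal[OF assms(2) P(2,4)] \<open>x \<in> C\<close> by blast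
  then show "\<exists>T. open T \<and> x \<in> T \<and> T \<subseteq> C" using P by blast
qed

section \<open>Rational maps\<close>

text \<open>The quotient in a finite coordinate. Near infinity a rational map has the same form with
  reversed polynomials, so continuity and openness are proved once, for
  \<open>ratio\<close>.\<close>

definition ratio :: "complex poly \<Rightarrow> complex poly \<Rightarrow> complex \<Rightarrow> csphere" where
  "ratio p q z = (if poly q z = 0 then Infty else Fin (poly p z / poly q z))"

lemma inv_sphere_ratio: "poly p z \<noteq> 0 \<or> poly q z \<noteq> 0 \<Longrightarrow> inv_sphere (ratio q p z) = ratio p q z"
  by (auto simp: ratio_def inv_sphere_def)

lemma open_poly_nonzero: "open {z :: complex. poly q z \<noteq> 0}"
  by (intro open_Collect_neq continuous_intros)

lemma continuous_on_ratio:
  assumes "\<And>z. poly p z \<noteq> 0 \<or> poly q z \<noteq> 0"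
  shows "continuous_on A (ratio p q)"
proof -
  have *: "continuous_on {z. poly q z \<noteq> 0} (ratio p q)" for p q :: "complex poly"
  proof -
    have "continuous_on {z. poly q z \<noteq> 0} (\<lambda>z. Fin (poly p z / poly q z))"
      by (intro continuous_on_compose2[OF continuous_on_Fin[of UNIV]] continuous_intros) auto
    then show ?thesis
      by (rule continuous_on_eq) (auto simp: ratio_def)
  qed
  have "continuous_on {z. poly p z \<noteq> 0} (\<lambda>z. inv_sphere (ratio q p z))"
    by (intro continuous_on_compose2[OF continuous_on_inv_sphere[of UNIV]] *) auto
  then have "continuous_on {z. poly p z \<noteq> 0} (ratio p q)"
    by (rule continuous_on_eq) (auto simp: inv_sphere_ratio)
  then have "continuous_on ({z. poly p z \<noteq> 0} \<union> {z. poly q z \<noteq> 0}) (ratio p q)"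
    by (intro continuous_on_open_Un * open_poly_nonzero)
  also have "{z. poly p z \<noteq> 0} \<union> {z. poly q z \<noteq> 0} = UNIV"
    using assms by auto
  finally show ?thesis
    by (rule continuous_on_subset) simp
qed

lemma poly_nonroot: "p \<noteq> 0 \<Longrightarrow> \<exists>z. poly p z \<noteq> 0" for p :: "complex poly"
  using poly_all_0_iff_0 by blast

lemma connected_poly_nonzero: "q \<noteq> 0 \<Longrightarrow> connected {z :: complex. poly q z \<noteq> 0}"
proof -
  assume "q \<noteq> 0"
  then have "finite {z. poly q z = 0}" by (rule poly_roots_finite)
  then have "connected (UNIV - {z. poly q z = 0})"
    by (intro connected_open_delete_finite) auto
  also have "UNIV - {z. poly q z = 0} = {z. poly q z \<noteq> 0}" by auto
  finally show ?thesis .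
qed

text \<open>Off the poles this is the open mapping theorem; off the zeros the same argument is
  applied to the reciprocal and carried back by \<open>inv_sphere\<close>.\<close>

lemma open_image_ratio:
  assumes nz: "\<And>z. poly p z \<noteq> 0 \<or> poly q z \<noteq> 0" and nc: "\<And>c. p \<noteq> smult c q" and "q \<noteq> 0"
    and "open U"
  shows "open (ratio p q ` U)"
proof -
  have *: "open (ratio p q ` (U \<inter> {z. poly q z \<noteq> 0}))"
    if "q \<noteq> 0" and nc: "\<And>c. p \<noteq> smult c q" for p q :: "complex poly"
  proof -
    let ?S = "{z. poly q z \<noteq> 0}"
    have "open ((\<lambda>z. poly p z / poly q z) ` (U \<inter> ?S))"
    proof (rule open_mapping_thm[where S = ?S])
      show "(\<lambda>z. poly p z / poly q z) holomorphic_on ?S"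
        by (intro holomorphic_intros) auto
      show "\<not> (\<lambda>z. poly p z / poly q z) constant_on ?S"
      proof
        assume "(\<lambda>z. poly p z / poly q z) constant_on ?S"
        then obtain c where c: "\<And>z. poly q z \<noteq> 0 \<Longrightarrow> poly p z / poly q z = c"
          by (auto simp: constant_on_def)
        \<comment> \<open>The extra factor \<open>q\<close> makes the nonroot avoid the poles as
          well.\<close>
        have "(p - smult c q) * q \<noteq> 0"
          using nc[of c] \<open>q \<noteq> 0\<close> by auto
        then obtain z where "poly ((p - smult c q) * q) z \<noteq> 0"
          using poly_nonroot by blast
        then show False using c[of z] by auto
      qed
    qed (use \<open>q \<noteq> 0\<close> \<open>open U\<close> in \<open>auto intro: open_Int open_poly_nonzero connected_poly_nonzero\<close>)
    then have "open (Fin ` (\<lambda>z. poly p z / poly q z) ` (U \<inter> ?S))"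
      by (rule open_image_Fin)
    also have "Fin ` (\<lambda>z. poly p z / poly q z) ` (U \<inter> ?S) = ratio p q ` (U \<inter> ?S)"
      unfolding image_image by (intro image_cong) (auto simp: ratio_def)
    finally show ?thesis .
  qed
  have "p \<noteq> 0" using nc[of 0] by simp
  moreover have "q \<noteq> smult c p" for c
  proof
    assume c: "q = smult c p"
    then have "c \<noteq> 0" using \<open>q \<noteq> 0\<close> by auto
    then have "p = smult (1 / c) q" using c by simp
    then show False using nc by blast
  qed
  ultimately have "open (inv_sphere ` ratio q p ` (U \<inter> {z. poly p z \<noteq> 0}))"
    by (intro open_image_inv_sphere *) auto
  also have "inv_sphere ` ratio q p ` (U \<inter> {z. poly p z \<noteq> 0}) = ratio p q ` (U \<inter> {z. poly p z \<noteq> 0})"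
    unfolding image_image by (intro image_cong) (auto simp: inv_sphere_ratio)
  finally have "open (ratio p q ` (U \<inter> {z. poly p z \<noteq> 0}) \<union> ratio p q ` (U \<inter> {z. poly q z \<noteq> 0}))"
    using *[OF \<open>q \<noteq> 0\<close> nc] by blast
  also have "ratio p q ` (U \<inter> {z. poly p z \<noteq> 0}) \<union> ratio p q ` (U \<inter> {z. poly q z \<noteq> 0}) = ratio p q ` U"
    using nz by blast
  finally show ?thesis .
qed

section \<open>The two standard charts and the form of a rational map at infinity\<close>

lemma csphere_charts: "(UNIV :: csphere set) = - {Infty} \<union> inv_sphere -` (- {Infty})"
  by (auto simp: inv_sphere_def)

lemma continuous_on_csphereI:
  assumes "continuous_on UNIV (\<lambda>z. F (Fin z))" "continuous_on UNIV (\<lambda>z. F (inv_sphere (Fin z)))"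
  shows "continuous_on A F"
proof -
  have eq: "Fin (fin_part x) = x" if "x \<noteq> Infty" for x
    using that not_Infty_iff by auto
  have "continuous_on (- {Infty}) (\<lambda>x. F (Fin (fin_part x)))"
    by (intro continuous_on_compose2[OF assms(1)] continuous_on_fin_part) auto
  then have 1: "continuous_on (- {Infty}) F"
    by (rule continuous_on_eq) (auto simp: eq)
  have "continuous_on (inv_sphere -` (- {Infty})) (\<lambda>x. F (inv_sphere (Fin (fin_part (inv_sphere x)))))"
    by (intro continuous_on_compose2[OF assms(2)] continuous_on_compose2[OF continuous_on_fin_part]
          continuous_on_inv_sphere) auto
  then have 2: "continuous_on (inv_sphere -` (- {Infty})) F"
    by (rule continuous_on_eq) (auto simp: eq)
  have "open (inv_sphere -` (- {Infty}))"
    by (intro open_vimage continuous_on_inv_sphere) auto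
  then have "continuous_on UNIV F"
    by (subst csphere_charts) (intro continuous_on_open_Un 1 2, auto)
  then show ?thesis by (rule continuous_on_subset) simp
qed

lemma open_image_csphereI:
  assumes "\<And>V. open V \<Longrightarrow> open ((\<lambda>z. F (Fin z)) ` V)"
    and "\<And>V. open V \<Longrightarrow> open ((\<lambda>z. F (inv_sphere (Fin z))) ` V)" and "open U"
  shows "open (F ` U)"
proof -
  have "open ((\<lambda>z. F (Fin z)) ` (Fin -` U) \<union> (\<lambda>z. F (inv_sphere (Fin z))) ` (Fin -` inv_sphere -` U))"
    by (intro open_Un assms open_vimage_Fin open_vimage[OF _ continuous_on_inv_sphere])
  also have "(\<lambda>z. F (Fin z)) ` (Fin -` U) \<union> (\<lambda>z. F (inv_sphere (Fin z))) ` (Fin -` inv_sphere -` U) = F ` U"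
  proof (intro subset_antisym subsetI)
    fix y assume "y \<in> F ` U"
    then obtain x where x: "x \<in> U" "y = F x" by blast
    show "y \<in> (\<lambda>z. F (Fin z)) ` (Fin -` U) \<union> (\<lambda>z. F (inv_sphere (Fin z))) ` (Fin -` inv_sphere -` U)"
    proof (cases x)
      case Infty
      then have "x = inv_sphere (Fin 0)" by (simp add: inv_sphere_def)
      then show ?thesis using x by blast
    qed (use x in auto)
  qed auto
  finally show ?thesis .
qed

text \<open>For \<open>n\<close> at least the degree, this is \<open>z ^ n * p (1 / z)\<close>.
  \<open>reflect_poly\<close> reverses at the degree of \<open>p\<close> itself; the monomial pads,
  so that numerator and denominator can be reversed at a common degree.\<close>

definition reverse_poly :: "nat \<Rightarrow> complex poly \<Rightarrow> complex poly" where
  "reverse_poly n p = monom 1 (n - degree p) * reflect_poly p"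

lemma poly_reverse_poly:
  assumes "z \<noteq> 0" "degree p \<le> n"
  shows "poly (reverse_poly n p) z = z ^ n * poly p (1 / z)"
  using assms by (simp add: reverse_poly_def poly_monom poly_reflect_poly_nz inverse_eq_divide
      flip: power_add mult.assoc)

lemma poly_reverse_poly_0: "degree p \<le> n \<Longrightarrow> poly (reverse_poly n p) 0 = coeff p n"
  by (cases "degree p = n") (auto simp: reverse_poly_def poly_monom coeff_eq_0)

lemma rat_map_Fin: "rat_map p q (Fin z) = ratio p q z"
  by (simp add: rat_map_def ratio_def)

lemma rat_map_inv_sphere:
  fixes p q :: "complex poly"
  assumes "q \<noteq> 0"
  defines "n \<equiv> max (degree p) (degree q)"
  shows "rat_map p q (inv_sphere (Fin z)) = ratio (reverse_poly n p) (reverse_poly n q) z"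
proof -
  have le: "degree p \<le> n" "degree q \<le> n" by (auto simp: n_def)
  show ?thesis
  proof (cases "z = 0")
    case True
    show ?thesis
    proof (cases "degree q < degree p")
      case False
      then have "n = degree q" by (simp add: n_def)
      then show ?thesis using True False le \<open>q \<noteq> 0\<close>
        by (simp add: inv_sphere_def rat_map_def ratio_def poly_reverse_poly_0)
    next
      case less: True
      then have "coeff q n = 0" by (simp add: n_def coeff_eq_0)
      then show ?thesis using True less le
        by (simp add: inv_sphere_def rat_map_def ratio_def poly_reverse_poly_0)
    qed
  next
    case False
    then show ?thesis using le
      by (simp add: inv_sphere_def rat_map_def ratio_def poly_reverse_poly)
  qed
qed

lemma coprime_no_common_root:
  assumes "coprime p q"
  shows "poly p z \<noteq> 0 \<or> poly q z \<noteq> (0 :: complex)"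
proof (rule ccontr)
  assume "\<not> ?thesis"
  then have "[:- z, 1:] dvd p" "[:- z, 1:] dvd q"
    by (auto simp: poly_eq_0_iff_dvd)
  then have "is_unit [:- z, 1:]"
    using assms not_coprimeI by blast
  then show False by (simp add: is_unit_iff_degree)
qed

locale rational =
  fixes p q :: "complex poly" and f :: "csphere \<Rightarrow> csphere"
  assumes q0: "q \<noteq> 0" and cop: "coprime p q" and f_def: "f = rat_map p q"
    and deg: "max (degree p) (degree q) \<ge> 1"
begin

lemma no_common_root: "poly p z \<noteq> 0 \<or> poly q z \<noteq> 0"
  using cop by (rule coprime_no_common_root)

text \<open>Otherwise coprimality would make \<open>q\<close> a unit, and both degrees would be
  0.\<close>

lemma not_smult: "p \<noteq> smult c q"
proof
  assume *: "p = smult c q"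
  then have "q dvd p" by (metis dvd_refl dvd_smult)
  then have "is_unit q" using not_coprimeI[of q p q] cop by auto
  then have "degree q = 0" using is_unit_iff_degree[OF q0] by blast
  moreover have "degree p \<le> degree q" unfolding * by (rule degree_smult_le)
  ultimately show False using deg by linarith
qed

lemma f_Fin: "f (Fin z) = ratio p q z"
  by (simp add: f_def rat_map_Fin)

definition "dg = max (degree p) (degree q)"

lemma f_inv_sphere: "f (inv_sphere (Fin z)) = ratio (reverse_poly dg p) (reverse_poly dg q) z"
  unfolding f_def dg_def by (rule rat_map_inv_sphere[OF q0])

lemma reverse_no_common_root: "poly (reverse_poly dg p) z \<noteq> 0 \<or> poly (reverse_poly dg q) z \<noteq> 0"
proof (cases "z = 0")
  case True
  have "coeff p dg \<noteq> 0 \<or> coeff q dg \<noteq> 0"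
  proof (cases "degree q < degree p")
    case True
    then have "p \<noteq> 0" "dg = degree p" by (auto simp: dg_def)
    then show ?thesis by simp
  next
    case False
    then have "dg = degree q" by (simp add: dg_def)
    then show ?thesis using q0 by simp
  qed
  then show ?thesis using True poly_reverse_poly_0[of p dg] poly_reverse_poly_0[of q dg]
    by (simp add: dg_def)
next
  case False
  then have "z ^ dg \<noteq> 0" by simp
  then show ?thesis
    using no_common_root[of "1 / z"] poly_reverse_poly[OF False, of p dg] poly_reverse_poly[OF False, of q dg]
    unfolding dg_def by (metis max.cobounded1 max.cobounded2 mult_eq_0_iff)
qed

lemma reverse_not_smult: "reverse_poly dg p \<noteq> smult c (reverse_poly dg q)" and reverse_q0: "reverse_poly dg q \<noteq> 0"
proof -
  have *: "\<exists>z. z \<noteq> 0 \<and> poly r (1 / z) \<noteq> 0" if "r \<noteq> 0" for r :: "complex poly"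
  proof -
    \<comment> \<open>Multiplying by the variable makes the nonroot nonzero, hence
      invertible.\<close>
    have "r * [:0, 1:] \<noteq> 0" using that by auto
    then obtain w where "poly (r * [:0, 1:]) w \<noteq> 0" using poly_nonroot by blast
    then show ?thesis by (intro exI[of _ "1 / w"]) auto
  qed
  show "reverse_poly dg q \<noteq> 0"
  proof
    assume "reverse_poly dg q = 0"
    then have "z ^ dg * poly q (1 / z) = 0" if "z \<noteq> 0" for z
      using poly_reverse_poly[OF that, of q dg] by (simp add: dg_def)
    then show False using *[OF q0] by auto
  qed
  show "reverse_poly dg p \<noteq> smult c (reverse_poly dg q)"
  proof
    assume eq: "reverse_poly dg p = smult c (reverse_poly dg q)"
    obtain z where z: "z \<noteq> 0" "poly (p - smult c q) (1 / z) \<noteq> 0"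
      using *[of "p - smult c q"] not_smult[of c] by auto
    have "poly (reverse_poly dg p) z = c * poly (reverse_poly dg q) z"
      by (simp add: eq)
    then have "z ^ dg * poly p (1 / z) = c * (z ^ dg * poly q (1 / z))"
      using z(1) by (simp add: poly_reverse_poly dg_def)
    then show False using z by simp
  qed
qed

lemma continuous_f: "continuous_on A f"
  by (rule continuous_on_csphereI; unfold f_Fin f_inv_sphere; rule continuous_on_ratio)
     (rule no_common_root reverse_no_common_root)+

lemma open_image_f: "open U \<Longrightarrow> open (f ` U)"
proof (rule open_image_csphereI)
  show "open ((\<lambda>z. f (Fin z)) ` V)" if "open V" for V
    unfolding f_Fin by (rule open_image_ratio[OF no_common_root not_smult q0 that])
  show "open ((\<lambda>z. f (inv_sphere (Fin z))) ` V)" if "open V" for V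
    unfolding f_inv_sphere
    by (rule open_image_ratio[OF reverse_no_common_root reverse_not_smult reverse_q0 that])
qed

lemma finite_fibre: "finite (f -` {w})"
proof (cases w)
  case (Fin c)
  have "p - smult c q \<noteq> 0" using not_smult by auto
  then have "finite {z. poly (p - smult c q) z = 0}" by (rule poly_roots_finite)
  moreover have "f -` {w} \<subseteq> insert Infty (Fin ` {z. poly (p - smult c q) z = 0})"
  proof
    fix x assume "x \<in> f -` {w}"
    then show "x \<in> insert Infty (Fin ` {z. poly (p - smult c q) z = 0})"
      by (cases x) (auto simp: f_Fin ratio_def Fin split: if_splits)
  qed
  ultimately show ?thesis by (meson finite.insertI finite_imageI finite_subset)
next
  case Infty
  have "finite {z. poly q z = 0}" using q0 by (rule poly_roots_finite)
  moreover have "f -` {w} \<subseteq> insert Infty (Fin ` {z. poly q z = 0})"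
  proof
    fix x assume "x \<in> f -` {w}"
    then show "x \<in> insert Infty (Fin ` {z. poly q z = 0})"
      by (cases x) (auto simp: f_Fin ratio_def Infty split: if_splits)
  qed
  ultimately show ?thesis by (meson finite.insertI finite_imageI finite_subset)
qed

end

section \<open>Invariance of the Fatou set\<close>

lemma open_fatou_set: "open (fatou_set f)"
proof (subst open_subopen, safe)
  fix x assume "x \<in> fatou_set f"
  then obtain U where "open U" "x \<in> U" "normal_family_on (range (\<lambda>n. f ^^ n)) U"
    by (auto simp: fatou_set_def)
  then show "\<exists>T. open T \<and> x \<in> T \<and> T \<subseteq> fatou_set f"
    by (intro exI[of _ U]) (auto simp: fatou_set_def)
qed

lemma closed_julia_set: "closed (julia_set f)"
  unfolding julia_set_def using open_fatou_set by blast

text \<open>A sequence of iterates either contains the identity infinitely often, which gives a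
  constant subsequence, or is eventually of the form \<open>f ^^ (m - 1)\<close> after
  \<open>f\<close>, and limits on \<open>U\<close> are pulled back along \<open>f\<close>.\<close>

lemma normal_family_iterates_vimage:
  assumes f: "\<And>A. continuous_on A f" and nf: "normal_family_on (range (\<lambda>n. f ^^ n)) U"
  shows "normal_family_on (range (\<lambda>n. f ^^ n)) (f -` U)"
  unfolding normal_family_on_def
proof (intro allI impI)
  fix h :: "nat \<Rightarrow> 'a \<Rightarrow> 'a" assume "range h \<subseteq> range (\<lambda>n. f ^^ n)"
  then have "\<forall>k. \<exists>n. h k = f ^^ n" by blast
  then obtain m where m: "\<And>k. h k = f ^^ m k" by metis
  show "\<exists>s g. strict_mono s \<and>
           (\<forall>K. compact K \<and> K \<subseteq> f -` U \<longrightarrow> uniform_limit K (h \<circ> s) g sequentially)"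
  proof (cases "infinite {k. m k = 0}")
    case True
    define s where "s = enumerate {k. m k = 0}"
    have "strict_mono s" unfolding s_def using True by (rule strict_mono_enumerate)
    moreover have "m (s k) = 0" for k
      using enumerate_in_set[OF True, of k] by (simp add: s_def)
    then have "h \<circ> s = (\<lambda>_. id)" by (simp add: fun_eq_iff m)
    ultimately show ?thesis
      by (intro exI[of _ s] exI[of _ id]) (simp add: uniform_limit_const)
  next
    case False
    then obtain N where N: "\<And>k. k \<ge> N \<Longrightarrow> m k \<noteq> 0"
      by (metis (mono_tags, lifting) finite_nat_set_iff_bounded mem_Collect_eq not_less)
    define h' where "h' k = f ^^ (m (k + N) - 1)" for k
    have "range h' \<subseteq> range (\<lambda>n. f ^^ n)" by (auto simp: h'_def)
    from nf[unfolded normal_family_on_def, THEN spec, THEN mp, OF this] obtain s g where s: "strict_mono s"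
      and g: "\<And>K. compact K \<Longrightarrow> K \<subseteq> U \<Longrightarrow> uniform_limit K (h' \<circ> s) g sequentially"
      by auto
    have eq: "h (s k + N) x = h' (s k) (f x)" for k x
    proof -
      have "m (s k + N) \<noteq> 0" using N by simp
      then obtain j where "m (s k + N) = Suc j" using not0_implies_Suc by blast
      then show ?thesis by (simp add: m h'_def funpow_swap1)
    qed
    have "uniform_limit K (h \<circ> (\<lambda>k. s k + N)) (g \<circ> f) sequentially" if "compact K" "K \<subseteq> f -` U" for K
    proof -
      have "uniform_limit (f ` K) (h' \<circ> s) g sequentially"
        using that by (intro g compact_continuous_image f) auto
      then show ?thesis unfolding uniform_limit_iff by (simp add: eq)
    qed
    then show ?thesis using s
      by (intro exI[of _ "\<lambda>k. s k + N"] exI[of _ "g \<circ> f"]) (auto simp: strict_mono_def)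
  qed
qed

text \<open>On the compact set \<open>C\<close> the convergence is uniform, so it is transported to
  the image along an arbitrary section of \<open>f\<close>; the section may be
  discontinuous.\<close>

lemma normal_family_iterates_image:
  fixes f :: "'a::metric_space \<Rightarrow> 'a"
  assumes f: "\<And>A. continuous_on A f" and nf: "normal_family_on (range (\<lambda>n. f ^^ n)) U"
    and C: "compact C" "C \<subseteq> U"
  shows "normal_family_on (range (\<lambda>n. f ^^ n)) (f ` C)"
  unfolding normal_family_on_def
proof (intro allI impI)
  fix h :: "nat \<Rightarrow> 'a \<Rightarrow> 'a" assume "range h \<subseteq> range (\<lambda>n. f ^^ n)"
  then have "\<forall>k. \<exists>n. h k = f ^^ n" by blast
  then obtain m where m: "\<And>k. h k = f ^^ m k" by metis
  define h' where "h' k = f ^^ Suc (m k)" for k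
  have "range h' \<subseteq> range (\<lambda>n. f ^^ n)" unfolding h'_def by blast
  from nf[unfolded normal_family_on_def, THEN spec, THEN mp, OF this] obtain s g where s: "strict_mono s"
    and g: "\<And>K. compact K \<Longrightarrow> K \<subseteq> U \<Longrightarrow> uniform_limit K (h' \<circ> s) g sequentially"
    by auto
  define t where "t = inv_into C f"
  have t: "t y \<in> C \<and> f (t y) = y" if "y \<in> f ` C" for y
    unfolding t_def using that by (simp add: inv_into_into f_inv_into_f)
  have "uniform_limit K (h \<circ> s) (g \<circ> t) sequentially" if K: "compact K" "K \<subseteq> f ` C" for K
  proof -
    have "uniform_limit C (h' \<circ> s) g sequentially"
      using C by (rule g)
    moreover have "h (s k) y = h' (s k) (t y)" if "y \<in> K" for k y
    proof -
      have "f (t y) = y" using t K that by blast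
      then show ?thesis by (simp add: m h'_def funpow_swap1)
    qed
    moreover have "t y \<in> C" if "y \<in> K" for y using t K that by blast
    ultimately have "\<forall>\<^sub>F k in sequentially. \<forall>y\<in>K. dist ((h \<circ> s) k y) ((g \<circ> t) y) < e" if "e > 0" for e
      using uniform_limitD[OF \<open>uniform_limit C (h' \<circ> s) g sequentially\<close> that]
      by (auto elim!: eventually_mono)
    then show ?thesis unfolding uniform_limit_iff by blast
  qed
  then show "\<exists>s g. strict_mono s \<and>
           (\<forall>K. compact K \<and> K \<subseteq> f ` C \<longrightarrow> uniform_limit K (h \<circ> s) g sequentially)"
    using s by blast
qed

lemma fatou_set_invariant:
  assumes f: "\<And>A. continuous_on A f" and op: "\<And>U. open U \<Longrightarrow> open (f ` U)"
  shows "f x \<in> fatou_set f \<longleftrightarrow> x \<in> fatou_set f"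
proof
  assume "f x \<in> fatou_set f"
  then obtain U where U: "open U" "f x \<in> U" "normal_family_on (range (\<lambda>n. f ^^ n)) U"
    by (auto simp: fatou_set_def)
  then have "open (f -` U)" "x \<in> f -` U" by (auto intro: open_vimage f)
  then show "x \<in> fatou_set f"
    using normal_family_iterates_vimage[OF f U(3)] unfolding fatou_set_def by blast
next
  assume "x \<in> fatou_set f"
  then obtain U where U: "open U" "x \<in> U" "normal_family_on (range (\<lambda>n. f ^^ n)) U"
    by (auto simp: fatou_set_def)
  then obtain e where e: "e > 0" "cball x e \<subseteq> U" using open_contains_cball by blast
  have "normal_family_on (range (\<lambda>n. f ^^ n)) (f ` cball x e)"
    by (rule normal_family_iterates_image[OF f U(3) _ e(2)]) (simp add: compact_csphere_iff)
  then have "normal_family_on (range (\<lambda>n. f ^^ n)) (f ` ball x e)"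
    unfolding normal_family_on_def by (meson ball_subset_cball image_mono order_trans)
  moreover have "open (f ` ball x e)" "f x \<in> f ` ball x e" using op e by auto
  ultimately show "f x \<in> fatou_set f" unfolding fatou_set_def by blast
qed

section \<open>Shrinking pullbacks\<close>

lemma finite_uniform_pos:
  assumes "finite A" "\<And>a. a \<in> A \<Longrightarrow> \<exists>d>0. Q a d" "\<And>a d d'. Q a d \<Longrightarrow> 0 < d' \<Longrightarrow> d' \<le> d \<Longrightarrow> Q a d'"
  shows "\<exists>d>0 :: real. \<forall>a\<in>A. Q a d"
  using assms(1,2)
proof (induction A)
  case empty
  show ?case by (intro exI[of _ 1]) auto
next
  case (insert a A)
  obtain d where d: "d > 0" "\<forall>a\<in>A. Q a d" using insert.IH insert.prems by auto
  obtain d' where d': "d' > 0" "Q a d'" using insert.prems by auto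
  have "Q b (min d d')" if "b \<in> insert a A" for b
    using that d d' assms(3)[of b d "min d d'"] assms(3)[of b d' "min d d'"] by auto
  then show ?case using d(1) d'(1) by (intro exI[of _ "min d d'"]) auto
qed

lemma infdist_less_obtains:
  assumes "A \<noteq> {}" "infdist x A < e"
  obtains a where "a \<in> A" "dist x a < e"
proof -
  have "(INF a\<in>A. dist x a) < e" using assms by (simp add: infdist_notempty)
  then show ?thesis
    using cInf_lessD[of "dist x ` A" e] assms(1) that by auto
qed

lemma bounded_csphere: "bounded (S :: csphere set)"
  using compact_imp_bounded[OF compact_UNIV_csphere] bounded_subset by blast

lemma diameter_le_csphere:
  fixes S :: "csphere set"
  assumes "\<And>x y. x \<in> S \<Longrightarrow> y \<in> S \<Longrightarrow> dist x y \<le> d" "d \<ge> 0"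
  shows "diameter S \<le> d"
proof (cases "S = {}")
  case False
  then show ?thesis unfolding diameter_def using assms(1) by (auto intro!: cSUP_least)
qed (use assms(2) in simp)

lemma closed_infdist_ge: "closed {x. infdist x A \<ge> c}"
  by (intro closed_Collect_le continuous_intros)

lemma connected_subset_component_eq:
  assumes "connected C" "C \<subseteq> S" "x \<in> C" "y \<in> C" "U \<in> components S" "x \<in> U"
  shows "y \<in> U"
  using components_maximal[OF assms(5,1,2)] assms(3,4,6) by blast

lemma component_obtains:
  assumes "x \<in> S"
  obtains W where "W \<in> components S" "x \<in> W"
  using assms Union_components by blast

lemma components_eq_csphere:
  assumes "U \<in> components S" "V \<in> components S" "x \<in> U" "x \<in> V"
  shows "U = V"
  using components_nonoverlap[OF assms(1,2)] assms(3,4) by blast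

text \<open>Isolates the topological dynamics: a continuous, open, finite-to-one map with a closed
  completely invariant set whose small neighbourhoods have summably shrinking pullbacks.\<close>

locale shrinking =
  fixes f :: "csphere \<Rightarrow> csphere" and J :: "csphere set" and r :: real and \<omega> :: "nat \<Rightarrow> real"
  assumes cont: "\<And>A. continuous_on A f" and opn: "\<And>U. open U \<Longrightarrow> open (f ` U)"
    and finite_fibre: "\<And>w. finite (f -` {w})"
    and closed_J: "closed J" and inv_J: "\<And>x. f x \<in> J \<longleftrightarrow> x \<in> J" and J_ne: "J \<noteq> {}"
    and r_pos: "r > 0" and \<omega>_pos: "\<And>n. n > 0 \<Longrightarrow> \<omega> n > 0" and \<omega>_summable: "summable (\<lambda>n. \<omega> (Suc n))"
    and shrink: "\<And>z n W. z \<in> J \<Longrightarrow> n > 0 \<Longrightarrow> W \<in> components ((f ^^ n) -` ball z r) \<Longrightarrow> diameter W < \<omega> n"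
begin

section \<open>Iterates and components of preimages\<close>

definition depth :: "csphere \<Rightarrow> real" where "depth x = infdist x J"

lemma depth_nonneg: "depth x \<ge> 0"
  by (simp add: depth_def infdist_nonneg)

lemma depth_pos_iff: "depth x > 0 \<longleftrightarrow> x \<notin> J"
  using in_closed_iff_infdist_zero[OF closed_J J_ne, of x] depth_nonneg[of x]
  by (auto simp: depth_def less_le)

lemma cont_funpow: "continuous_on A (f ^^ n)"
proof (induction n arbitrary: A)
  case (Suc n)
  have "continuous_on A (f \<circ> (f ^^ n))" by (intro continuous_on_compose Suc cont)
  then show ?case by simp
qed (simp add: id_def)

lemma opn_funpow: "open U \<Longrightarrow> open ((f ^^ n) ` U)"
proof (induction n)
  case (Suc n)
  then have "open (f ` (f ^^ n) ` U)" by (intro opn) simp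
  then show ?case by (simp add: image_comp)
qed simp

lemma inv_J_funpow: "(f ^^ n) x \<in> J \<longleftrightarrow> x \<in> J"
  by (induction n) (simp_all add: inv_J)

lemma finite_fibre_funpow: "finite ((f ^^ n) -` {w})"
proof (induction n arbitrary: w)
  case (Suc n)
  have eq: "(f ^^ Suc n) -` {w} = (\<Union>v\<in>f -` {w}. (f ^^ n) -` {v})" by auto
  show ?case unfolding eq by (intro finite_UN_I finite_fibre Suc)
qed simp

lemma open_F: "open (- J)"
  using closed_J by blast

text \<open>The image is open in \<open>P\<close> because \<open>W\<close> is open, and closed in
  \<open>P\<close> because \<open>W\<close> is relatively closed in the preimage and its closure is
  compact. Connectedness of \<open>P\<close> does the rest.\<close>

lemma image_component_vimage:
  assumes "open P" "connected P" and W: "W \<in> components ((f ^^ n) -` P)"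
  shows "(f ^^ n) ` W = P"
proof -
  let ?g = "f ^^ n"
  have oV: "open (?g -` P)" by (rule open_vimage[OF assms(1) cont_funpow])
  have "open W" using open_components_csphere[OF oV W] .
  then have o: "open (?g ` W)" by (rule opn_funpow)
  have WP: "W \<subseteq> ?g -` P" using in_components_subset[OF W] .
  have "closedin (top_of_set (?g -` P)) W" using W by (rule closedin_component)
  then have cl: "closure W \<inter> ?g -` P \<subseteq> W"
  proof -
    obtain T where "closed T" "W = ?g -` P \<inter> T"
      using \<open>closedin (top_of_set (?g -` P)) W\<close> unfolding closedin_closed by blast
    then show ?thesis using closure_minimal[of W T] by blast
  qed
  have "?g ` W = P \<inter> ?g ` closure W"
    using cl WP closure_subset[of W] by blast
  moreover have "closed (?g ` closure W)"
    by (intro compact_imp_closed compact_continuous_image cont_funpow) (simp add: compact_csphere_iff)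
  ultimately have "closedin (top_of_set P) (?g ` W)"
    by (simp add: closedin_closed_Int)
  moreover have "openin (top_of_set P) (?g ` W)"
    using o WP by (intro open_subset) auto
  moreover have "?g ` W \<noteq> {}" using in_components_nonempty[OF W] by simp
  ultimately show ?thesis
    using \<open>connected P\<close> unfolding connected_clopen by blast
qed

lemma small_pullback:
  assumes "connected P" "z \<in> J" "P \<subseteq> ball z r" "n > 0" "W \<in> components ((f ^^ n) -` P)" "x \<in> W" "y \<in> W"
  shows "dist x y < \<omega> n"
proof -
  have W: "W \<subseteq> (f ^^ n) -` P" "connected W"
    using in_components_subset[OF assms(5)] in_components_connected[OF assms(5)] by auto
  then have "x \<in> (f ^^ n) -` ball z r" using assms(3,6) by auto
  then obtain W' where W': "W' \<in> components ((f ^^ n) -` ball z r)" "x \<in> W'"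
    by (rule component_obtains)
  have "W \<subseteq> (f ^^ n) -` ball z r" using W(1) assms(3) by blast
  then have "y \<in> W'" using connected_subset_component_eq[OF W(2) _ assms(6,7) W'] by blast
  then have "dist x y \<le> diameter W'"
    by (intro diameter_bounded_bound bounded_csphere W'(2))
  also have "\<dots> < \<omega> n" by (rule shrink[OF assms(2,4) W'(1)])
  finally show ?thesis .
qed

text \<open>\<rho> is a Lebesgue number for the cover of \<open>J\<close> by connected open sets
  inside balls of radius \<open>r\<close>. The Lebesgue ball is centred at a point of
  \<open>J\<close>, which is why \<open>P\<close> meets \<open>J\<close>.\<close>

lemma connected_scale:
  "\<exists>\<rho>>0. \<forall>x. depth x < \<rho> \<longrightarrow> (\<exists>P z. open P \<and> connected P \<and> x \<in> P \<and> P \<inter> J \<noteq> {} \<and> z \<in> J \<and> P \<subseteq> ball z r)"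
proof -
  define G where "G = {P. open P \<and> connected P \<and> (\<exists>z\<in>J. P \<subseteq> ball z r)}"
  have JG: "J \<subseteq> \<Union>G"
  proof
    fix z assume "z \<in> J"
    have "open (ball z r)" "z \<in> ball z r" using r_pos by simp_all
    then obtain P where "open P" "connected P" "z \<in> P" "P \<subseteq> ball z r"
      by (rule csphere_connected_nbhd)
    then show "z \<in> \<Union>G" using \<open>z \<in> J\<close> by (auto simp: G_def)
  qed
  have cJ: "compact J" using closed_J compact_csphere_iff by blast
  have oG: "open P" if "P \<in> G" for P using that by (simp add: G_def)
  obtain e where e: "e > 0" "\<And>z. z \<in> J \<Longrightarrow> \<exists>P\<in>G. ball z e \<subseteq> P"
    using Heine_Borel_lemma[OF cJ JG oG] by metis
  have "\<exists>P z. open P \<and> connected P \<and> x \<in> P \<and> P \<inter> J \<noteq> {} \<and> z \<in> J \<and> P \<subseteq> ball z r" if d: "depth x < e" for x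
  proof -
    obtain a where a: "a \<in> J" "dist x a < e"
      using infdist_less_obtains[OF J_ne d[unfolded depth_def]] by blast
    then obtain P where P: "P \<in> G" "ball a e \<subseteq> P" using e(2) by blast
    then have "x \<in> P" "a \<in> P" using a e(1) by (auto simp: dist_commute subset_iff)
    then show ?thesis using P(1) a(1) unfolding G_def by blast
  qed
  then show ?thesis using e(1) by blast
qed

text \<open>A scale at which the balls \<open>ball z r\<close> may be replaced by connected sets; this makes it
  unnecessary to know that spherical balls are connected.\<close>

definition "\<rho> = (SOME \<rho>. \<rho> > 0 \<and> (\<forall>x. depth x < \<rho> \<longrightarrow>
  (\<exists>P z. open P \<and> connected P \<and> x \<in> P \<and> P \<inter> J \<noteq> {} \<and> z \<in> J \<and> P \<subseteq> ball z r)))"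

lemma \<rho>_pos: "\<rho> > 0"
  and \<rho>_connected: "depth x < \<rho> \<Longrightarrow> \<exists>P z. open P \<and> connected P \<and> x \<in> P \<and> P \<inter> J \<noteq> {} \<and> z \<in> J \<and> P \<subseteq> ball z r"
  using someI_ex[OF connected_scale] unfolding \<rho>_def[symmetric] by blast+

lemma depth_less:
  assumes "n > 0" "depth ((f ^^ n) x) < \<rho>"
  shows "depth x < \<omega> n"
proof -
  obtain P z where P: "open P" "connected P" "(f ^^ n) x \<in> P" "P \<inter> J \<noteq> {}" "z \<in> J" "P \<subseteq> ball z r"
    using \<rho>_connected[OF assms(2)] by blast
  have "x \<in> (f ^^ n) -` P" using P(3) by simp
  then obtain W where W: "W \<in> components ((f ^^ n) -` P)" "x \<in> W" by (rule component_obtains)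
  have "(f ^^ n) ` W = P" by (rule image_component_vimage[OF P(1,2) W(1)])
  then obtain u where "u \<in> W" "(f ^^ n) u \<in> J" using P(4) by blast
  then have "u \<in> J" "dist x u < \<omega> n"
    using inv_J_funpow small_pullback[OF P(2,5,6) assms(1) W] by auto
  then show ?thesis
    unfolding depth_def using infdist_le[of u J x] by linarith
qed

lemma \<omega>_tendsto: "\<omega> \<longlonglongrightarrow> 0"
  using summable_LIMSEQ_zero[OF \<omega>_summable] by (simp add: filterlim_sequentially_Suc)

lemma eventually_deep:
  assumes "x \<notin> J"
  obtains N where "\<And>n. n \<ge> N \<Longrightarrow> depth ((f ^^ n) x) \<ge> \<rho>"
proof -
  have "depth x > 0" using assms depth_pos_iff by blast
  then have "\<forall>\<^sub>F n in sequentially. \<omega> n < depth x"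
    using order_tendstoD(2)[OF \<omega>_tendsto] by blast
  then obtain N where N: "\<And>n. n \<ge> N \<Longrightarrow> \<omega> n < depth x"
    unfolding eventually_sequentially by blast
  have "depth ((f ^^ n) x) \<ge> \<rho>" if "n \<ge> Suc N" for n
    using N[of n] depth_less[of n x] that by force
  then show ?thesis by (rule that)
qed

text \<open>A single step inside the Fatou set whose pullbacks under \<open>f ^^ n\<close> have diameter less than
  \<open>\<omega> n\<close>.\<close>

definition link :: "csphere \<Rightarrow> csphere \<Rightarrow> bool" where
  "link x y \<longleftrightarrow> (\<exists>P. open P \<and> connected P \<and> P \<subseteq> - J \<and> (\<exists>z\<in>J. P \<subseteq> ball z r) \<and> x \<in> P \<and> y \<in> P)"

section \<open>Chains of links and their lifts\<close>

lemma link_nbhd: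
  assumes "x \<notin> J" "depth x < \<rho>"
  obtains P where "open P" "connected P" "P \<subseteq> - J" "x \<in> P" "\<And>y y'. y \<in> P \<Longrightarrow> y' \<in> P \<Longrightarrow> link y y'"
proof -
  obtain Q z where Q: "open Q" "x \<in> Q" "z \<in> J" "Q \<subseteq> ball z r"
    using \<rho>_connected[OF assms(2)] by blast
  have "open (Q \<inter> - J)" "x \<in> Q \<inter> - J" using Q open_F assms(1) by auto
  then obtain P where P: "open P" "connected P" "x \<in> P" "P \<subseteq> Q \<inter> - J"
    using csphere_connected_nbhd by blast
  have "link y y'" if "y \<in> P" "y' \<in> P" for y y'
    unfolding link_def using that P Q by (intro exI[of _ P]) auto
  then show ?thesis using P that by blast
qed

lemma link_component:
  assumes "link\<^sup>*\<^sup>* x y" "U \<in> components (- J)" "x \<in> U"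
  shows "y \<in> U"
  using assms(1)
proof (induction rule: rtranclp_induct)
  case (step y z)
  then obtain P where "connected P" "P \<subseteq> - J" "y \<in> P" "z \<in> P" unfolding link_def by blast
  then show ?case using connected_subset_component_eq[OF _ _ _ _ assms(2) step.IH] by blast
qed (rule assms(3))

lemma link_pullback:
  assumes "link x y" "n > 0" "(f ^^ n) x' = x"
  shows "\<exists>C y'. connected C \<and> C \<subseteq> - J \<and> x' \<in> C \<and> y' \<in> C \<and> (f ^^ n) y' = y \<and>
    (\<forall>w\<in>C. dist x' w \<le> \<omega> n)"
proof -
  obtain P z where P: "open P" "connected P" "P \<subseteq> - J" "z \<in> J" "P \<subseteq> ball z r" "x \<in> P" "y \<in> P"
    using assms(1) unfolding link_def by blast
  have "x' \<in> (f ^^ n) -` P" using P(6) assms(3) by simp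
  then obtain W where W: "W \<in> components ((f ^^ n) -` P)" "x' \<in> W" by (rule component_obtains)
  have "(f ^^ n) ` W = P" by (rule image_component_vimage[OF P(1,2) W(1)])
  then obtain y' where y': "y' \<in> W" "(f ^^ n) y' = y" using P(7) by blast
  have "W \<subseteq> - J"
    using in_components_subset[OF W(1)] P(3) inv_J_funpow by blast
  moreover have "dist x' w \<le> \<omega> n" if "w \<in> W" for w
    using small_pullback[OF P(2,4,5) assms(2) W that] by simp
  ultimately show ?thesis
    using in_components_connected[OF W(1)] W(2) y' by blast
qed

lemma link_chain_pullback:
  assumes "(link ^^ m) x y" "n > 0" "(f ^^ n) x' = x" "x \<notin> J"
  shows "\<exists>C y'. connected C \<and> C \<subseteq> - J \<and> x' \<in> C \<and> y' \<in> C \<and> (f ^^ n) y' = y \<and>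
    (\<forall>w\<in>C. dist x' w \<le> real m * \<omega> n)"
  using assms(1)
proof (induction m arbitrary: y)
  case 0
  then show ?case using assms inv_J_funpow[of n x'] by (intro exI[of _ "{x'}"] exI[of _ x']) auto
next
  case (Suc m)
  then obtain v where v: "(link ^^ m) x v" "link v y" by auto
  obtain C v' where C: "connected C" "C \<subseteq> - J" "x' \<in> C" "v' \<in> C" "(f ^^ n) v' = v"
    "\<forall>w\<in>C. dist x' w \<le> real m * \<omega> n"
    using Suc.IH[OF v(1)] by blast
  obtain D y' where D: "connected D" "D \<subseteq> - J" "v' \<in> D" "y' \<in> D" "(f ^^ n) y' = y"
    "\<forall>w\<in>D. dist v' w \<le> \<omega> n"
    using link_pullback[OF v(2) assms(2) C(5)] by blast
  have "connected (C \<union> D)" using C(1,4) D(1,3) by (intro connected_Un) auto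
  moreover have "dist x' w \<le> real (Suc m) * \<omega> n" if "w \<in> C \<union> D" for w
  proof (cases "w \<in> C")
    case True
    then have "dist x' w \<le> real m * \<omega> n" using C(6) by blast
    then show ?thesis using \<omega>_pos[OF assms(2)] by (simp add: distrib_right)
  next
    case False
    then have "dist v' w \<le> \<omega> n" using that D(6) by blast
    moreover have "dist x' w \<le> dist x' v' + dist v' w" by (rule dist_triangle)
    moreover have "dist x' v' \<le> real m * \<omega> n" using C(4,6) by blast
    ultimately show ?thesis by (simp add: distrib_right)
  qed
  ultimately show ?case using C(2,3) D(2,4,5) by (intro exI[of _ "C \<union> D"] exI[of _ y']) simp
qed

text \<open>Makes the length of chains uniform, so that lifting one costs a fixed multiple of
  \<open>\<omega> n\<close>. Finitely many sets of mutually linked points cover \<open>K\<close>,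
  and a chain from one point of such a set serves them all.\<close>

lemma link_chain_bound:
  assumes "compact K" "K \<subseteq> - J" "\<And>x. x \<in> K \<Longrightarrow> depth x < \<rho>"
  shows "\<exists>M. \<forall>x\<in>K. (\<exists>t\<in>T. link\<^sup>*\<^sup>* x t) \<longrightarrow> (\<exists>m\<le>M. \<exists>t\<in>T. (link ^^ m) x t)"
proof -
  have "\<exists>P. open P \<and> x \<in> P \<and> (\<forall>y\<in>P. \<forall>y'\<in>P. link y y')" if "x \<in> K" for x
    using link_nbhd[of x] assms(2,3) that by (metis ComplD subsetD)
  then obtain P where P: "\<And>x. x \<in> K \<Longrightarrow> open (P x)" "\<And>x. x \<in> K \<Longrightarrow> x \<in> P x"
    "\<And>x y y'. x \<in> K \<Longrightarrow> y \<in> P x \<Longrightarrow> y' \<in> P x \<Longrightarrow> link y y'" by metis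
  have "K \<subseteq> (\<Union>x\<in>K. P x)" using P(2) by blast
  then obtain X where X: "X \<subseteq> K" "finite X" "K \<subseteq> (\<Union>x\<in>X. P x)"
    using compactE_image[OF assms(1), of K P] P(1) by metis
  have "\<exists>m. (\<exists>t\<in>T. link\<^sup>*\<^sup>* x t) \<longrightarrow> (\<exists>t\<in>T. (link ^^ m) x t)" for x
    by (meson rtranclp_imp_relpowp)
  then obtain m where m: "\<And>x. (\<exists>t\<in>T. link\<^sup>*\<^sup>* x t) \<Longrightarrow> (\<exists>t\<in>T. (link ^^ m x) x t)" by metis
  \<comment> \<open>The extra link leads from a point of \<open>K\<close> to the centre of its
    covering set.\<close>
  define M where "M = Suc (\<Sum>x\<in>X. m x)"
  have "\<exists>k\<le>M. \<exists>t\<in>T. (link ^^ k) y t" if y: "y \<in> K" "\<exists>t\<in>T. link\<^sup>*\<^sup>* y t" for y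
  proof -
    obtain x where x: "x \<in> X" "y \<in> P x" using X(3) y(1) by blast
    then have "x \<in> K" using X(1) by blast
    then have l: "link x y" "link y x" using P x by blast+
    then have "\<exists>t\<in>T. link\<^sup>*\<^sup>* x t" using y(2) by (meson converse_rtranclp_into_rtranclp)
    then obtain t where t: "t \<in> T" "(link ^^ m x) x t" using m by blast
    have "(link ^^ Suc (m x)) y t" using relpowp_Suc_I2[of link y x "m x" t] l(2) t(2) by blast
    moreover have "m x \<le> (\<Sum>x\<in>X. m x)" using X(2) x(1) by (simp add: member_le_sum)
    then have "Suc (m x) \<le> M" by (simp add: M_def)
    ultimately show ?thesis using t(1) by blast
  qed
  then show ?thesis by blast
qed

section \<open>Fatou components and their images\<close>

lemma finite_deep_components:
  assumes "c > 0"
  shows "finite {U \<in> components (- J). \<exists>x\<in>U. depth x \<ge> c}"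
proof -
  let ?K = "{x. depth x \<ge> c}"
  have K: "compact ?K" unfolding depth_def compact_csphere_iff by (rule closed_infdist_ge)
  have KJ: "?K \<subseteq> \<Union>(components (- J))"
  proof
    fix x assume "x \<in> ?K"
    then have "depth x > 0" using assms by simp
    then show "x \<in> \<Union>(components (- J))" by (simp add: depth_pos_iff)
  qed
  obtain D where D: "D \<subseteq> components (- J)" "finite D" "?K \<subseteq> \<Union>D"
    using compactE[OF K KJ open_components_csphere[OF open_F]] by metis
  have "{U \<in> components (- J). \<exists>x\<in>U. depth x \<ge> c} \<subseteq> D"
  proof safe
    fix U x assume U: "U \<in> components (- J)" "x \<in> U" "depth x \<ge> c"
    then obtain V where V: "V \<in> D" "x \<in> V" using D(3) by blast
    then have "U = V" using components_eq_csphere[OF U(1) _ U(2)] D(1) by blast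
    then show "U \<in> D" using V by simp
  qed
  then show ?thesis using D(2) finite_subset by blast
qed

text \<open>Complete invariance makes \<open>U\<close> a full component of the preimage of the Fatou
  component that contains its image, and such components map onto.\<close>

lemma image_component:
  assumes "U \<in> components (- J)"
  shows "(f ^^ n) ` U \<in> components (- J)"
proof -
  have U: "U \<subseteq> - J" "connected U" "U \<noteq> {}"
    using in_components_subset[OF assms] in_components_connected[OF assms] in_components_nonempty[OF assms]
    by blast+
  then obtain x where x: "x \<in> U" by blast
  have "(f ^^ n) x \<in> - J" using U x inv_J_funpow by blast
  then obtain V where V: "V \<in> components (- J)" "(f ^^ n) x \<in> V" by (rule component_obtains)
  have VJ: "open V" "connected V" "V \<subseteq> - J"
    using in_components_subset[OF V(1)] in_components_connected[OF V(1)] open_components_csphere[OF open_F V(1)]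
    by blast+
  have "connected ((f ^^ n) ` U)" by (intro connected_continuous_image cont_funpow U)
  moreover have "(f ^^ n) ` U \<subseteq> - J" using U inv_J_funpow by blast
  ultimately have sub: "(f ^^ n) ` U \<subseteq> V"
    using components_maximal[OF V(1)] V(2) x by blast
  have "U \<in> components ((f ^^ n) -` V)"
    unfolding in_components_maximal
  proof (intro conjI allI impI)
    show "U \<subseteq> (f ^^ n) -` V" using sub by blast
    fix D assume D: "D \<noteq> {} \<and> U \<subseteq> D \<and> D \<subseteq> (f ^^ n) -` V \<and> connected D"
    then have "D \<subseteq> - J" using VJ inv_J_funpow by blast
    then show "D = U" using D assms unfolding in_components_maximal by blast
  qed (use U in auto)
  then have "(f ^^ n) ` U = V" by (intro image_component_vimage VJ)
  then show ?thesis using V by simp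
qed

lemma same_component_image:
  assumes "connected C" "C \<subseteq> - J" "x \<in> C" "y \<in> C" "V \<in> components (- J)" "(f ^^ n) x \<in> V"
  shows "(f ^^ n) y \<in> V"
proof -
  have "connected ((f ^^ n) ` C)" by (intro connected_continuous_image cont_funpow assms)
  moreover have "(f ^^ n) ` C \<subseteq> - J" using assms(2) inv_J_funpow by blast
  ultimately show ?thesis
    using connected_subset_component_eq[of "(f ^^ n) ` C" "- J" "(f ^^ n) x" "(f ^^ n) y" V] assms(3-6)
    by blast
qed

section \<open>Tail sums and the escape estimate\<close>

definition tail :: "nat \<Rightarrow> real" where "tail n = (\<Sum>k. \<omega> (k + n))"

lemma summable_shift: "n > 0 \<Longrightarrow> summable (\<lambda>k. \<omega> (k + n))"
  using summable_ignore_initial_segment[OF \<omega>_summable, of "n - 1"] by simp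

text \<open>\<open>n > 0\<close> keeps \<open>\<omega> 0\<close>, whose sign is unknown, out of the
  sum.\<close>

lemma partial_le_tail: "n > 0 \<Longrightarrow> (\<Sum>k<j. \<omega> (k + n)) \<le> tail n"
  unfolding tail_def by (rule sum_le_suminf[OF summable_shift]) (auto intro!: less_imp_le \<omega>_pos)

lemma tail_nonneg: "n > 0 \<Longrightarrow> tail n \<ge> 0"
  using partial_le_tail[of n 0] by simp

lemma tail_tendsto: "tail \<longlonglongrightarrow> 0"
proof -
  have "(\<lambda>n. tail (Suc n)) \<longlonglongrightarrow> 0"
  proof (rule LIMSEQ_I)
    fix e :: real assume "e > 0"
    then obtain N where N: "\<And>n. n \<ge> N \<Longrightarrow> norm (\<Sum>i. \<omega> (Suc (i + n))) < e"
      using suminf_exist_split[OF _ \<omega>_summable] by blast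
    then show "\<exists>N. \<forall>n\<ge>N. norm (tail (Suc n) - 0) < e"
      by (intro exI[of _ N]) (simp add: tail_def)
  qed
  then show ?thesis by (rule LIMSEQ_imp_Suc)
qed

text \<open>The point is uniformity: \<open>r0\<close> and \<open>M\<close> do not depend on
  \<open>n\<close> or \<open>y\<close>, while the reach is proportional to the tail of a convergent
  series.\<close>

definition escape :: "csphere set set \<Rightarrow> real \<Rightarrow> nat \<Rightarrow> bool" where
  "escape D r0 M \<longleftrightarrow> (\<forall>n>0. \<forall>y. (f ^^ n) y \<in> \<Union>D \<longrightarrow>
    (\<exists>C u. connected C \<and> C \<subseteq> - J \<and> y \<in> C \<and> u \<in> C \<and> depth ((f ^^ n) u) \<ge> r0 \<and>
       (\<forall>w\<in>C. dist y w \<le> real M * tail n)))"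

lemma escapeD:
  assumes "escape D r0 M" "n > 0" "(f ^^ n) y \<in> \<Union>D"
  shows "\<exists>C u. connected C \<and> C \<subseteq> - J \<and> y \<in> C \<and> u \<in> C \<and> depth ((f ^^ n) u) \<ge> r0 \<and>
       (\<forall>w\<in>C. dist y w \<le> real M * tail n)"
  using assms unfolding escape_def by simp

text \<open>By downward induction on \<open>k \<ge> n\<close>, the point \<open>y\<close> is moved to a point whose \<open>k\<close>-th image has depth at
  least \<open>r0\<close>. If the image one level below is too shallow, it lies in a fixed compact subset of the
  Fatou set, so a bounded number of links joins it to a deep point; lifting them costs \<open>M * \<omega> k\<close>.\<close>

lemma descent:
  assumes "finite D" "D \<subseteq> components (- J)" "\<And>U. U \<in> D \<Longrightarrow> f ` U \<in> D"
  shows "\<exists>r0>0. r0 \<le> \<rho> / 2 \<and> (\<exists>M. escape D r0 M)"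
proof -
  have "\<exists>d>0. \<forall>U\<in>D. d \<le> \<rho> / 2 \<and> (\<exists>x\<in>U. depth x \<ge> d)"
  proof (rule finite_uniform_pos[OF assms(1)])
    fix U assume "U \<in> D"
    then have "U \<in> components (- J)" using assms(2) by blast
    then obtain x where x: "x \<in> U" "x \<notin> J"
      using in_components_nonempty in_components_subset by blast
    then have "depth x > 0" using depth_pos_iff by blast
    then show "\<exists>d>0. d \<le> \<rho> / 2 \<and> (\<exists>x\<in>U. depth x \<ge> d)"
      using x \<rho>_pos by (intro exI[of _ "min (\<rho> / 2) (depth x)"] conjI bexI[of _ x]) auto
  next
    fix U and d d' :: real
    assume "d \<le> \<rho> / 2 \<and> (\<exists>x\<in>U. depth x \<ge> d)" "0 < d'" "d' \<le> d"
    then show "d' \<le> \<rho> / 2 \<and> (\<exists>x\<in>U. depth x \<ge> d')" by force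
  qed
  then obtain d where d: "d > 0" "\<And>U. U \<in> D \<Longrightarrow> \<exists>x\<in>U. depth x \<ge> d" by blast
  \<comment> \<open>At most \<open>d\<close>, so that every component of the family has a point of
    this depth; at most \<open>\<rho> / 2\<close>, so that shallower points still have
    links.\<close>
  define r0 where "r0 = min d (\<rho> / 2)"
  have r0: "r0 > 0" "r0 \<le> \<rho> / 2" using d(1) \<rho>_pos by (auto simp: r0_def)
  have Dr0: "\<exists>x\<in>U. depth x \<ge> r0" if "U \<in> D" for U
    using d(2)[OF that] by (auto simp: r0_def min_le_iff_disj)
  \<comment> \<open>Points just before reaching depth \<open>r0\<close>. The bound on
    \<open>f x\<close> keeps this set off \<open>J\<close> by invariance; the bound on
    \<open>x\<close> provides links.\<close>
  define K where "K = {x. depth x \<le> \<rho> / 2} \<inter> f -` {x. depth x \<ge> r0}"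
  define T where "T = {x. depth x \<ge> r0}"
  have "closed {x. depth x \<le> \<rho> / 2}"
    unfolding depth_def by (intro closed_Collect_le continuous_intros)
  moreover have "closed (f -` {x. depth x \<ge> r0})"
    by (intro closed_vimage cont) (simp add: depth_def closed_infdist_ge)
  ultimately have K: "compact K" unfolding compact_csphere_iff K_def by (rule closed_Int)
  have KJ: "K \<subseteq> - J"
  proof
    fix x assume "x \<in> K"
    then have "depth (f x) > 0" using r0(1) by (simp add: K_def)
    then show "x \<in> - J" by (simp add: depth_pos_iff inv_J)
  qed
  have K\<rho>: "depth x < \<rho>" if "x \<in> K" for x
    using that \<rho>_pos by (simp add: K_def)
  obtain M where M: "\<And>x. x \<in> K \<Longrightarrow> \<exists>t\<in>T. link\<^sup>*\<^sup>* x t \<Longrightarrow> \<exists>m\<le>M. \<exists>t\<in>T. (link ^^ m) x t"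
    using link_chain_bound[OF K KJ K\<rho>, of T] by blast
  have linked: "\<exists>t\<in>T. link\<^sup>*\<^sup>* x t" if V: "V \<in> D" "x \<in> V" "depth x < r0" for x V
  proof (rule ccontr)
    assume contra: "\<not> (\<exists>t\<in>T. link\<^sup>*\<^sup>* x t)"
    have VJ: "V \<in> components (- J)" using V(1) assms(2) by blast
    then have Vc: "connected V" "V \<subseteq> - J" "open V"
      using in_components_connected in_components_subset open_components_csphere[OF open_F] by blast+
    obtain b where b: "b \<in> V" "depth b \<ge> r0" using Dr0[OF V(1)] by blast
    have "link\<^sup>*\<^sup>* x b"
    proof (rule connected_induction_simple[OF Vc(1) V(2) b(1)])
      fix v assume v: "v \<in> V"
      show "\<exists>O'. openin (top_of_set V) O' \<and> v \<in> O' \<and> (\<forall>y\<in>O'. \<forall>z\<in>O'. link\<^sup>*\<^sup>* x y \<longrightarrow> link\<^sup>*\<^sup>* x z)"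
      proof (cases "depth v < \<rho>")
        case True
        have "v \<notin> J" using v Vc(2) by blast
        then obtain P where P: "open P" "v \<in> P" "\<And>y y'. y \<in> P \<Longrightarrow> y' \<in> P \<Longrightarrow> link y y'"
          using link_nbhd[OF _ True] by metis
        have "link\<^sup>*\<^sup>* x z" if "y \<in> P" "z \<in> P" "link\<^sup>*\<^sup>* x y" for y z
          using P(3)[OF that(1,2)] that(3) by (rule rtranclp.rtrancl_into_rtrancl[rotated])
        then show ?thesis
          using P(1,2) v by (intro exI[of _ "V \<inter> P"]) (auto simp: openin_open_Int)
      next
        case False
        \<comment> \<open>The induction step is vacuous here: a reachable point deeper than
          \<open>\<rho> / 2\<close> would already lie in \<open>T\<close>.\<close>
        have "open {y. depth y > \<rho> / 2}"
          unfolding depth_def by (intro open_Collect_less continuous_intros)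
        moreover have "\<not> link\<^sup>*\<^sup>* x y" if "depth y > \<rho> / 2" for y
          using contra that r0(2) unfolding T_def by force
        ultimately show ?thesis
          using v False \<rho>_pos
          by (intro exI[of _ "V \<inter> {y. depth y > \<rho> / 2}"]) (auto simp: openin_open_Int)
      qed
    qed simp
    then show False using contra b(2) unfolding T_def by blast
  qed
  have main: "\<exists>C u. connected C \<and> C \<subseteq> - J \<and> y \<in> C \<and> u \<in> C \<and> depth ((f ^^ n) u) \<ge> r0 \<and>
       (\<forall>w\<in>C. dist y w \<le> real M * (\<Sum>k<j. \<omega> (k + n)))"
    if n: "n > 0" and "(f ^^ n) y \<in> \<Union>D" and "depth ((f ^^ (j + n)) y) \<ge> r0" for n j y
    using that(2,3)
  proof (induction j arbitrary: y)
    case 0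
    then have "depth ((f ^^ n) y) > 0" using r0(1) by simp
    then have "y \<in> - J" using depth_pos_iff inv_J_funpow by blast
    then show ?case using 0 by (intro exI[of _ "{y}"] exI[of _ y]) simp
  next
    case (Suc j)
    have mono: "real M * (\<Sum>k<j. \<omega> (k + n)) \<le> real M * (\<Sum>k<Suc j. \<omega> (k + n))"
      using \<omega>_pos[of "j + n"] n by (intro mult_left_mono) auto
    show ?case
    proof (cases "depth ((f ^^ (j + n)) y) \<ge> r0")
      case True
      then obtain C u where C: "connected C" "C \<subseteq> - J" "y \<in> C" "u \<in> C" "depth ((f ^^ n) u) \<ge> r0"
        "\<forall>w\<in>C. dist y w \<le> real M * (\<Sum>k<j. \<omega> (k + n))"
        using Suc.IH[OF Suc.prems(1)] by blast
      have "\<forall>w\<in>C. dist y w \<le> real M * (\<Sum>k<Suc j. \<omega> (k + n))"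
        using C(6) mono order_trans by blast
      then show ?thesis using C(1-5) by blast
    next
      case False
      define x where "x = (f ^^ (j + n)) y"
      have x: "depth x < r0" using False by (simp add: x_def)
      have fx: "depth (f x) \<ge> r0" using Suc.prems(2) by (simp add: x_def)
      have xK: "x \<in> K" using x fx r0(2) by (simp add: K_def)
      \<comment> \<open>Forward invariance of \<open>D\<close> keeps the orbit in \<open>D\<close>
        from time \<open>n\<close> on, so that \<open>linked\<close> applies at level
        \<open>j + n\<close>.\<close>
      have inD: "(f ^^ i) ((f ^^ n) y) \<in> \<Union>D" for i
      proof (induction i)
        case (Suc i)
        then obtain V where "V \<in> D" "(f ^^ i) ((f ^^ n) y) \<in> V" by blast
        then have "f ` V \<in> D" "(f ^^ Suc i) ((f ^^ n) y) \<in> f ` V" using assms(3) by auto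
        then show ?case by blast
      qed (use Suc.prems(1) in simp)
      have "x \<in> \<Union>D" using inD[of j] by (simp add: x_def funpow_add)
      then have "\<exists>t\<in>T. link\<^sup>*\<^sup>* x t" using linked x by blast
      then obtain m t where mt: "m \<le> M" "t \<in> T" "(link ^^ m) x t" using M[OF xK] by blast
      have jn: "j + n > 0" using n by simp
      have "x \<notin> J" using KJ xK by blast
      then obtain C v where C: "connected C" "C \<subseteq> - J" "y \<in> C" "v \<in> C" "(f ^^ (j + n)) v = t"
        "\<forall>w\<in>C. dist y w \<le> real m * \<omega> (j + n)"
        using link_chain_pullback[OF mt(3) jn x_def[symmetric]] by blast
      have Cb: "dist y w \<le> real M * \<omega> (j + n)" if "w \<in> C" for w
      proof -
        have "dist y w \<le> real m * \<omega> (j + n)" using C(6) that by blast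
        also have "\<dots> \<le> real M * \<omega> (j + n)"
          using mt(1) \<omega>_pos[OF jn] by (intro mult_right_mono) auto
        finally show ?thesis .
      qed
      obtain V where V: "V \<in> D" "(f ^^ n) y \<in> V" using Suc.prems(1) by blast
      have "V \<in> components (- J)" using V(1) assms(2) by blast
      then have "(f ^^ n) v \<in> V" using same_component_image[OF C(1-4)] V(2) by blast
      then have "(f ^^ n) v \<in> \<Union>D" using V(1) by blast
      moreover have "depth ((f ^^ (j + n)) v) \<ge> r0" using C(5) mt(2) by (simp add: T_def)
      ultimately obtain E u where E: "connected E" "E \<subseteq> - J" "v \<in> E" "u \<in> E" "depth ((f ^^ n) u) \<ge> r0"
        "\<forall>w\<in>E. dist v w \<le> real M * (\<Sum>k<j. \<omega> (k + n))"
        using Suc.IH by blast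
      have "connected (C \<union> E)" using C(1,4) E(1,3) by (intro connected_Un) auto
      moreover have "dist y w \<le> real M * (\<Sum>k<Suc j. \<omega> (k + n))" if "w \<in> C \<union> E" for w
      proof (cases "w \<in> C")
        case True
        have "real M * \<omega> (j + n) \<le> real M * (\<Sum>k<Suc j. \<omega> (k + n))"
          using n by (intro mult_left_mono) (auto intro!: sum_nonneg less_imp_le[OF \<omega>_pos])
        then show ?thesis using Cb[OF True] by linarith
      next
        case False
        then have "dist v w \<le> real M * (\<Sum>k<j. \<omega> (k + n))" using that E(6) by blast
        moreover have "dist y w \<le> dist y v + dist v w" by (rule dist_triangle)
        ultimately show ?thesis using Cb[OF C(4)] by (simp add: distrib_left)
      qed
      ultimately show ?thesis using C(2,3) E(2,4,5) by (intro exI[of _ "C \<union> E"] exI[of _ u]) simp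
    qed
  qed
  have "\<exists>C u. connected C \<and> C \<subseteq> - J \<and> y \<in> C \<and> u \<in> C \<and> depth ((f ^^ n) u) \<ge> r0 \<and>
       (\<forall>w\<in>C. dist y w \<le> real M * tail n)" if n: "n > 0" and y: "(f ^^ n) y \<in> \<Union>D" for n y
  proof -
    have "y \<notin> J"
    proof -
      obtain V where "V \<in> D" "(f ^^ n) y \<in> V" using y by blast
      then have "(f ^^ n) y \<notin> J" using assms(2) in_components_subset by blast
      then show ?thesis using inv_J_funpow by blast
    qed
    then obtain N where N: "\<And>n. n \<ge> N \<Longrightarrow> depth ((f ^^ n) y) \<ge> \<rho>"
      using eventually_deep by blast
    have "depth ((f ^^ (N + n)) y) \<ge> r0" using N[of "N + n"] r0 \<rho>_pos by simp
    then obtain C u where C: "connected C" "C \<subseteq> - J" "y \<in> C" "u \<in> C" "depth ((f ^^ n) u) \<ge> r0"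
       "\<forall>w\<in>C. dist y w \<le> real M * (\<Sum>k<N. \<omega> (k + n))"
      using main[OF n y] by blast
    have "real M * (\<Sum>k<N. \<omega> (k + n)) \<le> real M * tail n"
      by (intro mult_left_mono partial_le_tail n) simp
    then have "\<forall>w\<in>C. dist y w \<le> real M * tail n" using C(6) order_trans by blast
    then show ?thesis using C(1-5) by blast
  qed
  then have "escape D r0 M" unfolding escape_def by simp
  then show ?thesis using r0 by blast
qed

text \<open>Reachability at some positive depth spreads locally: around \<open>v\<close> a connected
  neighbourhood of at least half the depth of \<open>v\<close> can be adjoined.\<close>

lemma deep_connection:
  assumes "U \<in> components (- J)" "x \<in> U" "y \<in> U"
  shows "\<exists>d>0. \<exists>C. connected C \<and> C \<subseteq> - J \<and> x \<in> C \<and> y \<in> C \<and> (\<forall>w\<in>C. depth w \<ge> d)"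
proof -
  let ?R = "\<lambda>y. \<exists>d>0. \<exists>C. connected C \<and> C \<subseteq> - J \<and> x \<in> C \<and> y \<in> C \<and> (\<forall>w\<in>C. depth w \<ge> d)"
  have U: "connected U" "U \<subseteq> - J"
    using assms(1) in_components_connected in_components_subset by blast+
  have "?R y"
  proof (rule connected_induction_simple[OF U(1) assms(2,3), where P = ?R])
    have "depth x > 0" using U(2) assms(2) depth_pos_iff by blast
    then show "?R x" using U(2) assms(2) by (intro exI[of _ "depth x"] conjI exI[of _ "{x}"]) auto
    fix v assume v: "v \<in> U"
    then have dv: "depth v > 0" using U(2) depth_pos_iff by blast
    have "open {y. depth y > depth v / 2}"
      unfolding depth_def by (intro open_Collect_less continuous_intros)
    moreover have "v \<in> {y. depth y > depth v / 2}" using dv by simp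
    ultimately obtain P where P: "open P" "connected P" "v \<in> P" "P \<subseteq> {y. depth y > depth v / 2}"
      by (rule csphere_connected_nbhd)
    have PJ: "P \<subseteq> - J"
    proof
      fix w assume "w \<in> P"
      then have "depth w > 0" using P(4) dv by force
      then show "w \<in> - J" using depth_pos_iff by blast
    qed
    have "?R b" if ab: "a \<in> P" "b \<in> P" "?R a" for a b
    proof -
      obtain d C where C: "d > 0" "connected C" "C \<subseteq> - J" "x \<in> C" "a \<in> C" "\<forall>w\<in>C. depth w \<ge> d"
        using ab(3) by blast
      have "connected (C \<union> P)" using C(2,5) P(2) ab(1) by (intro connected_Un) auto
      moreover have "depth w \<ge> min d (depth v / 2)" if "w \<in> C \<union> P" for w
        using that C(6) P(4) by force
      ultimately show ?thesis
        using C PJ ab(2) dv by (intro exI[of _ "min d (depth v / 2)"] conjI exI[of _ "C \<union> P"]) auto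
    qed
    then have "\<forall>a\<in>U \<inter> P. \<forall>b\<in>U \<inter> P. ?R a \<longrightarrow> ?R b" by blast
    then show "\<exists>T. openin (top_of_set U) T \<and> v \<in> T \<and> (\<forall>x\<in>T. \<forall>y\<in>T. ?R x \<longrightarrow> ?R y)"
      using openin_open_Int[OF P(1), of U] P(3) v by blast
  qed
  then show ?thesis .
qed

text \<open>A finite cover of \<open>K\<close> by such neighbourhoods reduces the claim to finitely
  many pairs of centres, for which the minimum of the depths is positive.\<close>

lemma uniform_deep_connection:
  assumes "compact K" "K \<subseteq> - J"
  shows "\<exists>d>0. \<forall>U\<in>components (- J). \<forall>x\<in>K \<inter> U. \<forall>y\<in>K \<inter> U.
    \<exists>C. connected C \<and> C \<subseteq> - J \<and> x \<in> C \<and> y \<in> C \<and> (\<forall>w\<in>C. depth w \<ge> d)"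
proof -
  have "\<exists>P. open P \<and> connected P \<and> x \<in> P \<and> (\<forall>y\<in>P. depth y \<ge> depth x / 2)" if "x \<in> K" for x
  proof -
    have "depth x > 0" using that assms(2) depth_pos_iff by blast
    then have x: "x \<in> {y. depth y > depth x / 2}" by simp
    have "open {y. depth y > depth x / 2}"
      unfolding depth_def by (intro open_Collect_less continuous_intros)
    then obtain P where "open P" "connected P" "x \<in> P" "P \<subseteq> {y. depth y > depth x / 2}"
      using x by (rule csphere_connected_nbhd)
    then show ?thesis by (intro exI[of _ P]) auto
  qed
  then obtain P where P: "\<And>x. x \<in> K \<Longrightarrow> open (P x)" "\<And>x. x \<in> K \<Longrightarrow> connected (P x)"
    "\<And>x. x \<in> K \<Longrightarrow> x \<in> P x" "\<And>x y. x \<in> K \<Longrightarrow> y \<in> P x \<Longrightarrow> depth y \<ge> depth x / 2" by metis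
  have "K \<subseteq> (\<Union>x\<in>K. P x)" using P(3) by blast
  then obtain X where X: "X \<subseteq> K" "finite X" "K \<subseteq> (\<Union>x\<in>X. P x)"
    using compactE_image[OF assms(1), of K P] P(1) by metis
  have PJ: "P x \<subseteq> - J" if "x \<in> X" for x
  proof
    fix w assume "w \<in> P x"
    moreover have "x \<in> K" using that X(1) by blast
    moreover have "depth x > 0" using \<open>x \<in> K\<close> assms(2) depth_pos_iff by blast
    ultimately have "depth w > 0" using P(4)[of x w] by linarith
    then show "w \<in> - J" using depth_pos_iff by blast
  qed
  \<comment> \<open>The first two bounds account for the neighbourhoods that are adjoined at both
    ends of \<open>C\<close>.\<close>
  define Q where "Q = (\<lambda>(a, b) d. d \<le> depth a / 2 \<and> d \<le> depth b / 2 \<and> (\<forall>U\<in>components (- J). a \<in> U \<longrightarrow> b \<in> U \<longrightarrow>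
      (\<exists>C. connected C \<and> C \<subseteq> - J \<and> a \<in> C \<and> b \<in> C \<and> (\<forall>w\<in>C. depth w \<ge> d))))"
  have "\<exists>d>0. \<forall>ab\<in>X \<times> X. Q ab d"
  proof (rule finite_uniform_pos)
    show "finite (X \<times> X)" using X(2) by simp
  next
    fix ab assume ab: "ab \<in> X \<times> X"
    obtain a b where [simp]: "ab = (a, b)" by (cases ab)
    have pos: "depth a > 0" "depth b > 0" using ab X(1) assms(2) depth_pos_iff by auto
    show "\<exists>d>0. Q ab d"
    proof (cases "\<exists>U\<in>components (- J). a \<in> U \<and> b \<in> U")
      case True
      then obtain d C where d: "d > 0" "connected C" "C \<subseteq> - J" "a \<in> C" "b \<in> C" "\<forall>w\<in>C. depth w \<ge> d"
        using deep_connection by blast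
      have "Q ab (min d (min (depth a / 2) (depth b / 2)))"
        unfolding Q_def using d(2-6) by (auto simp: min_le_iff_disj)
      then show ?thesis using d(1) pos by (intro exI[of _ "min d (min (depth a / 2) (depth b / 2))"]) auto
    next
      case False
      then have no: "U \<in> components (- J) \<Longrightarrow> a \<in> U \<Longrightarrow> b \<notin> U" for U by blast
      have "min s t \<le> s" "min s t \<le> t" for s t :: real by simp_all
      then have "Q ab (min (depth a / 2) (depth b / 2))"
        unfolding Q_def \<open>ab = (a, b)\<close> case_prod_conv using no by blast
      then show ?thesis using pos by (intro exI[of _ "min (depth a / 2) (depth b / 2)"]) auto
    qed
  next
    fix ab and d d' :: real
    assume Q: "Q ab d" and d': "0 < d'" "d' \<le> d"
    obtain a b where [simp]: "ab = (a, b)" by (cases ab)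
    have "d \<le> depth a / 2" "d \<le> depth b / 2" using Q by (simp_all add: Q_def)
    moreover have "\<exists>C. connected C \<and> C \<subseteq> - J \<and> a \<in> C \<and> b \<in> C \<and> (\<forall>w\<in>C. depth w \<ge> d')"
      if U: "U \<in> components (- J)" "a \<in> U" "b \<in> U" for U
    proof -
      obtain C where "connected C" "C \<subseteq> - J" "a \<in> C" "b \<in> C" "\<forall>w\<in>C. depth w \<ge> d"
        using Q U unfolding Q_def by (simp) blast
      then show ?thesis using order_trans[OF d'(2)] by blast
    qed
    ultimately show "Q ab d'" using d'(2) unfolding Q_def by simp
  qed
  then obtain d where d: "d > 0" "\<And>a b. a \<in> X \<Longrightarrow> b \<in> X \<Longrightarrow> Q (a, b) d" by blast
  have "\<exists>C. connected C \<and> C \<subseteq> - J \<and> x \<in> C \<and> y \<in> C \<and> (\<forall>w\<in>C. depth w \<ge> d)"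
    if U: "U \<in> components (- J)" and xy: "x \<in> K \<inter> U" "y \<in> K \<inter> U" for U x y
  proof -
    obtain a where a: "a \<in> X" "x \<in> P a" using X(3) xy(1) by blast
    obtain b where b: "b \<in> X" "y \<in> P b" using X(3) xy(2) by blast
    have K: "a \<in> K" "b \<in> K" using a b X(1) by auto
    have "a \<in> U" using connected_subset_component_eq[OF P(2)[OF K(1)] PJ[OF a(1)] a(2) P(3)[OF K(1)] U] xy(1) by blast
    moreover have "b \<in> U" using connected_subset_component_eq[OF P(2)[OF K(2)] PJ[OF b(1)] b(2) P(3)[OF K(2)] U] xy(2) by blast
    moreover have q: "Q (a, b) d" using d(2) a(1) b(1) by blast
    ultimately obtain C where C: "connected C" "C \<subseteq> - J" "a \<in> C" "b \<in> C" "\<forall>w\<in>C. depth w \<ge> d"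
      using U unfolding Q_def by simp blast
    have ab: "d \<le> depth a / 2" "d \<le> depth b / 2" using q unfolding Q_def by simp_all
    have "connected (P a \<union> C)" using C(1,3) P(2,3)[OF K(1)] by (intro connected_Un) auto
    then have "connected ((P a \<union> C) \<union> P b)"
      using C(4) P(2,3)[OF K(2)] by (intro connected_Un[of "P a \<union> C" "P b"]) auto
    moreover have "depth w \<ge> d" if w: "w \<in> P a \<union> C \<union> P b" for w
    proof -
      consider "w \<in> P a" | "w \<in> C" | "w \<in> P b" using w by blast
      then show ?thesis
      proof cases
        case 1
        then show ?thesis using P(4)[OF K(1), of w] ab by linarith
      next
        case 2
        then show ?thesis using C(5) by blast
      next
        case 3
        then show ?thesis using P(4)[OF K(2), of w] ab by linarith
      qed
    qed
    ultimately show ?thesis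
      using a(2) b(2) PJ[OF a(1)] PJ[OF b(1)] C(2) by (intro exI[of _ "P a \<union> C \<union> P b"]) simp
  qed
  then show ?thesis using d(1) by blast
qed

section \<open>Finiteness of families of Fatou components\<close>

lemma finite_orbit:
  assumes "U \<in> components (- J)"
  shows "finite (range (\<lambda>n. (f ^^ n) ` U))"
proof -
  obtain y where y: "y \<in> U" "y \<notin> J"
    using in_components_nonempty[OF assms] in_components_subset[OF assms] by blast
  obtain N where N: "\<And>n. n \<ge> N \<Longrightarrow> depth ((f ^^ n) y) \<ge> \<rho>" using eventually_deep[OF y(2)] by blast
  have "range (\<lambda>n. (f ^^ n) ` U) \<subseteq>
      {V \<in> components (- J). \<exists>x\<in>V. depth x \<ge> \<rho>} \<union> (\<lambda>n. (f ^^ n) ` U) ` {..<N}"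
  proof (rule image_subsetI)
    fix n
    show "(f ^^ n) ` U \<in> {V \<in> components (- J). \<exists>x\<in>V. depth x \<ge> \<rho>} \<union> (\<lambda>n. (f ^^ n) ` U) ` {..<N}"
    proof (cases "n < N")
      case False
      then have "\<exists>x\<in>(f ^^ n) ` U. depth x \<ge> \<rho>" using N[of n] y(1) by auto
      then show ?thesis using image_component[OF assms] by blast
    qed blast
  qed
  then show ?thesis
    by (rule finite_subset) (use finite_deep_components[OF \<rho>_pos] in simp)
qed

lemma forward_closure:
  assumes "finite A" "A \<subseteq> components (- J)"
  shows "\<exists>D. finite D \<and> D \<subseteq> components (- J) \<and> A \<subseteq> D \<and> (\<forall>U\<in>D. f ` U \<in> D)"
proof (intro exI conjI ballI)
  let ?D = "\<Union>U\<in>A. range (\<lambda>n. (f ^^ n) ` U)"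
  show "finite ?D" using assms finite_orbit by blast
  show "?D \<subseteq> components (- J)" using assms(2) image_component by blast
  show "A \<subseteq> ?D"
  proof
    fix U assume "U \<in> A"
    moreover have "U = (f ^^ 0) ` U" by simp
    ultimately show "U \<in> ?D" by blast
  qed
  fix U assume "U \<in> ?D"
  then obtain V n where V: "V \<in> A" "U = (f ^^ n) ` V" by blast
  then have "f ` U = (f ^^ Suc n) ` V" by (simp add: image_comp)
  then show "f ` U \<in> ?D" using V(1) by blast
qed

text \<open>Each such component contains a preimage of a base point chosen in its image, and fibres
  of iterates are finite.\<close>

lemma finite_preimage_components:
  assumes "finite D" "D \<subseteq> components (- J)"
  shows "finite {U \<in> components (- J). (f ^^ n) ` U \<in> D}"
proof -
  have "\<forall>V. \<exists>w. V \<in> D \<longrightarrow> w \<in> V" using assms(2) in_components_nonempty by blast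
  then obtain w where w: "\<And>V. V \<in> D \<Longrightarrow> w V \<in> V" by metis
  have "{U \<in> components (- J). (f ^^ n) ` U \<in> D} \<subseteq>
      connected_component_set (- J) ` (\<Union>V\<in>D. (f ^^ n) -` {w V})"
  proof
    fix U assume "U \<in> {U \<in> components (- J). (f ^^ n) ` U \<in> D}"
    then have U: "U \<in> components (- J)" "(f ^^ n) ` U \<in> D" by blast+
    then obtain x where x: "x \<in> U" "(f ^^ n) x = w ((f ^^ n) ` U)" using w by (metis imageE)
    then have "x \<in> (\<Union>V\<in>D. (f ^^ n) -` {w V})" using U(2) by blast
    moreover have "U = connected_component_set (- J) x"
      using U(1) x(1) by (metis components_iff connected_component_eq)
    ultimately show "U \<in> connected_component_set (- J) ` (\<Union>V\<in>D. (f ^^ n) -` {w V})" by blast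
  qed
  moreover have "finite (\<Union>V\<in>D. (f ^^ n) -` {w V})"
    using assms(1) finite_fibre_funpow by blast
  ultimately show ?thesis by (meson finite_imageI finite_subset)
qed

text \<open>A component \<open>U\<close> whose orbit first enters \<open>D\<close> at time \<open>n\<close> is mapped injectively by
  \<open>f ^^ (n - 1)\<close>, so all its points descend to the same preimage of a base point. This makes the
  diameter of \<open>U\<close> small when \<open>n\<close> is large, and finitely many components have small \<open>n\<close>.\<close>

lemma finite_large_components:
  assumes inj: "finite {U \<in> components (- J). \<not> inj_on f U}" and "\<epsilon> > 0"
  shows "finite {U \<in> components (- J). diameter U \<ge> \<epsilon>}"
proof -
  have r2: "\<rho> / 2 > 0" using \<rho>_pos by simp
  have fin: "finite ({U \<in> components (- J). \<exists>x\<in>U. depth x \<ge> \<rho> / 2} \<union> {U \<in> components (- J). \<not> inj_on f U})"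
    using inj finite_deep_components[OF r2] by simp
  have sub: "{U \<in> components (- J). \<exists>x\<in>U. depth x \<ge> \<rho> / 2} \<union> {U \<in> components (- J). \<not> inj_on f U} \<subseteq> components (- J)"
    by blast
  \<comment> \<open>Outside this forward-invariant family \<open>f\<close> is injective on
    components, and components are so shallow that links connect all their points.\<close>
  obtain D where D: "finite D" "D \<subseteq> components (- J)"
    "{U \<in> components (- J). \<exists>x\<in>U. depth x \<ge> \<rho> / 2} \<union> {U \<in> components (- J). \<not> inj_on f U} \<subseteq> D"
    "\<forall>U\<in>D. f ` U \<in> D"
    using forward_closure[OF fin sub] by blast
  have shallow: "depth x < \<rho> / 2" if "V \<in> components (- J)" "V \<notin> D" "x \<in> V" for V x
    using D(3) that by fastforce
  obtain r0 M where r0: "r0 > 0" "r0 \<le> \<rho> / 2" and M: "escape D r0 M"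
    using descent[OF D(1,2) bspec[OF D(4)]] by blast
  have "\<forall>V. \<exists>w. V \<in> components (- J) \<longrightarrow> w \<in> V" using in_components_nonempty by blast
  then obtain w where w: "\<And>V. V \<in> components (- J) \<Longrightarrow> w V \<in> V" by metis
  define K where "K = {x. depth x \<le> \<rho> / 2} \<inter> f -` {x. depth x \<ge> r0}"
  \<comment> \<open>One base point per component. Links stay inside a component, so a chain that
    starts in \<open>V\<close> and reaches \<open>T\<close> ends at \<open>w V\<close>.\<close>
  define T where "T = w ` components (- J)"
  have "closed {x. depth x \<le> \<rho> / 2}"
    unfolding depth_def by (intro closed_Collect_le continuous_intros)
  moreover have "closed (f -` {x. depth x \<ge> r0})"
    by (intro closed_vimage cont) (simp add: depth_def closed_infdist_ge)
  ultimately have K: "compact K" unfolding compact_csphere_iff K_def by (rule closed_Int)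
  have KJ: "K \<subseteq> - J"
  proof
    fix x assume "x \<in> K"
    then have "depth (f x) > 0" using r0(1) by (simp add: K_def)
    then show "x \<in> - J" by (simp add: depth_pos_iff inv_J)
  qed
  have K\<rho>: "depth x < \<rho>" if "x \<in> K" for x
    using that \<rho>_pos by (simp add: K_def)
  obtain M' where M': "\<And>x. x \<in> K \<Longrightarrow> \<exists>t\<in>T. link\<^sup>*\<^sup>* x t \<Longrightarrow> \<exists>m\<le>M'. \<exists>t\<in>T. (link ^^ m) x t"
    using link_chain_bound[OF K KJ K\<rho>, of T] by blast
  have linked: "link\<^sup>*\<^sup>* x y" if V: "V \<in> components (- J)" "V \<notin> D" "x \<in> V" "y \<in> V" for V x y
  proof (rule connected_induction_simple[OF in_components_connected[OF V(1)] V(3,4)])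
    fix v assume v: "v \<in> V"
    have "depth v < \<rho>" using shallow[OF V(1,2) v] \<rho>_pos by simp
    moreover have "v \<notin> J" using v in_components_subset[OF V(1)] by blast
    ultimately obtain P where P: "open P" "v \<in> P" "\<And>y y'. y \<in> P \<Longrightarrow> y' \<in> P \<Longrightarrow> link y y'"
      using link_nbhd by metis
    have "link\<^sup>*\<^sup>* x z" if "y \<in> P" "z \<in> P" "link\<^sup>*\<^sup>* x y" for y z
      using P(3)[OF that(1,2)] that(3) by (rule rtranclp.rtrancl_into_rtrancl[rotated])
    then show "\<exists>O'. openin (top_of_set V) O' \<and> v \<in> O' \<and> (\<forall>y\<in>O'. \<forall>z\<in>O'. link\<^sup>*\<^sup>* x y \<longrightarrow> link\<^sup>*\<^sup>* x z)"
      using P(1,2) v by (intro exI[of _ "V \<inter> P"]) (auto simp: openin_open_Int)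
  qed simp
  \<comment> \<open>Escape from level \<open>n\<close> costs \<open>M * tail n\<close>, and the
    chain to the base point one level below costs \<open>M' * \<omega> (n - 1)\<close>. The factor 2
    is for two points with a common destination.\<close>
  define b where "b n = 2 * (real M * tail n + real M' * \<omega> (n - 1))" for n
  have small: "diameter U \<le> b n"
    if U: "U \<in> components (- J)" "n \<ge> 2" "(f ^^ n) ` U \<in> D" "\<And>i. i < n \<Longrightarrow> (f ^^ i) ` U \<notin> D" for U n
  proof -
    have injU: "inj_on (f ^^ i) U" if "i \<le> n" for i
      using that
    proof (induction i)
      case (Suc i)
      have "(f ^^ i) ` U \<notin> D" using U(4) Suc.prems by simp
      then have "inj_on f ((f ^^ i) ` U)" using D(3) image_component[OF U(1)] by blast
      then have "inj_on (f \<circ> (f ^^ i)) U" using Suc by (intro comp_inj_on) auto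
      then show ?case by (simp only: funpow.simps(2))
    qed simp
    define V where "V = (f ^^ (n - 1)) ` U"
    have V: "V \<in> components (- J)" "V \<notin> D"
      unfolding V_def using image_component[OF U(1)] U(2,4) by auto
    have n1: "n - 1 > 0" "Suc (n - 1) = n" using U(2) by auto
    have centre: "\<exists>u\<in>U. (f ^^ (n - 1)) u = w V \<and> dist y u \<le> real M * tail n + real M' * \<omega> (n - 1)"
      if y: "y \<in> U" for y
    proof -
      have "(f ^^ n) y \<in> \<Union>D" using U(3) y by blast
      moreover have "n > 0" using U(2) by simp
      ultimately obtain C u where C: "connected C" "C \<subseteq> - J" "y \<in> C" "u \<in> C" "depth ((f ^^ n) u) \<ge> r0"
        "\<forall>w\<in>C. dist y w \<le> real M * tail n" using escapeD[OF M] by blast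
      have uU: "u \<in> U" using connected_subset_component_eq[OF C(1-4) U(1) y] .
      define x where "x = (f ^^ (n - 1)) u"
      have "f x = (f ^^ Suc (n - 1)) u" unfolding x_def by (simp only: funpow.simps(2) o_apply)
      then have fx: "f x = (f ^^ n) u" by (simp only: n1(2))
      have xV: "x \<in> V" using uU by (simp add: x_def V_def)
      have "depth x < \<rho> / 2" using shallow[OF V xV] .
      then have xK: "x \<in> K" using C(5) fx by (simp add: K_def)
      have "\<exists>t\<in>T. link\<^sup>*\<^sup>* x t" using linked[OF V xV w[OF V(1)]] V(1) T_def by blast
      then obtain m t where mt: "m \<le> M'" "t \<in> T" "(link ^^ m) x t" using M'[OF xK] by blast
      obtain V' where V': "V' \<in> components (- J)" "t = w V'" using mt(2) T_def by blast
      have "t \<in> V" using link_component[OF relpowp_imp_rtranclp[OF mt(3)] V(1) xV] .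
      then have "V' = V" using components_eq_csphere[OF V'(1) V(1)] V' w by blast
      have "x \<notin> J" using KJ xK by blast
      then obtain E u' where E: "connected E" "E \<subseteq> - J" "u \<in> E" "u' \<in> E" "(f ^^ (n - 1)) u' = t"
        "\<forall>w\<in>E. dist u w \<le> real m * \<omega> (n - 1)"
        using link_chain_pullback[OF mt(3) n1(1) x_def[symmetric]] by blast
      have "u' \<in> U" using connected_subset_component_eq[OF E(1-4) U(1) uU] .
      moreover have "(f ^^ (n - 1)) u' = w V" using E(5) V'(2) \<open>V' = V\<close> by simp
      moreover have "dist y u' \<le> real M * tail n + real M' * \<omega> (n - 1)"
      proof -
        have "dist u u' \<le> real m * \<omega> (n - 1)" using E(4,6) by blast
        also have "\<dots> \<le> real M' * \<omega> (n - 1)"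
          using mt(1) \<omega>_pos[OF n1(1)] by (intro mult_right_mono) auto
        finally show ?thesis
          using bspec[OF C(6) C(4)] dist_triangle[of y u' u] by linarith
      qed
      ultimately show ?thesis by blast
    qed
    show ?thesis
    proof (rule diameter_le_csphere)
      fix x y assume xy: "x \<in> U" "y \<in> U"
      obtain u where u: "u \<in> U" "(f ^^ (n - 1)) u = w V" "dist x u \<le> real M * tail n + real M' * \<omega> (n - 1)"
        using centre[OF xy(1)] by blast
      obtain v where v: "v \<in> U" "(f ^^ (n - 1)) v = w V" "dist y v \<le> real M * tail n + real M' * \<omega> (n - 1)"
        using centre[OF xy(2)] by blast
      have "inj_on (f ^^ (n - 1)) U" by (rule injU) simp
      then have "u = v" using u(1,2) v(1,2) by (metis inj_onD)
      then show "dist x y \<le> b n"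
        using u(3) v(3) dist_triangle2[of x y u] by (simp add: b_def)
    next
      show "b n \<ge> 0" unfolding b_def
        using tail_nonneg[of n] \<omega>_pos[OF n1(1)] U(2) by simp
    qed
  qed
  have "b \<longlonglongrightarrow> 2 * (real M * 0 + real M' * 0)"
    unfolding b_def
    by (intro tendsto_intros tail_tendsto filterlim_compose[OF \<omega>_tendsto])
       (rule filterlim_minus_const_nat_at_top)
  then have "\<forall>\<^sub>F n in sequentially. b n < \<epsilon>"
    using order_tendstoD(2)[of b 0] \<open>\<epsilon> > 0\<close> by simp
  then obtain N where N: "\<And>n. n \<ge> N \<Longrightarrow> b n < \<epsilon>" unfolding eventually_sequentially by blast
  \<comment> \<open>Entry times 0 and 1 join the finitely many exceptions, since
    \<open>small\<close> lifts at level \<open>n - 1\<close>, which must be positive.\<close>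
  have "{U \<in> components (- J). diameter U \<ge> \<epsilon>} \<subseteq> (\<Union>n<max N 2. {U \<in> components (- J). (f ^^ n) ` U \<in> D})"
  proof
    fix U assume "U \<in> {U \<in> components (- J). diameter U \<ge> \<epsilon>}"
    then have U: "U \<in> components (- J)" "diameter U \<ge> \<epsilon>" by blast+
    obtain y where y: "y \<in> U" "y \<notin> J"
      using in_components_nonempty[OF U(1)] in_components_subset[OF U(1)] by blast
    obtain k where k: "\<And>n. n \<ge> k \<Longrightarrow> depth ((f ^^ n) y) \<ge> \<rho>" using eventually_deep[OF y(2)] by blast
    have "\<exists>x\<in>(f ^^ k) ` U. depth x \<ge> \<rho> / 2" using k[of k] y(1) \<rho>_pos by (intro bexI[of _ "(f ^^ k) y"]) auto
    then have ex: "\<exists>n. (f ^^ n) ` U \<in> D" using D(3) image_component[OF U(1)] by blast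
    define n where "n = (LEAST n. (f ^^ n) ` U \<in> D)"
    have n: "(f ^^ n) ` U \<in> D" "\<And>i. i < n \<Longrightarrow> (f ^^ i) ` U \<notin> D"
      unfolding n_def using LeastI_ex[OF ex] not_less_Least by blast+
    have "n < max N 2"
    proof (rule ccontr)
      assume "\<not> n < max N 2"
      then have "n \<ge> 2" "n \<ge> N" by auto
      then show False using small[OF U(1) _ n] N[of n] U(2) by fastforce
    qed
    then show "U \<in> (\<Union>n<max N 2. {U \<in> components (- J). (f ^^ n) ` U \<in> D})" using n(1) U(1) by blast
  qed
  moreover have "finite (\<Union>n<max N 2. {U \<in> components (- J). (f ^^ n) ` U \<in> D})"
    using finite_preimage_components[OF D(1,2)] by blast
  ultimately show ?thesis by (rule finite_subset)
qed

text \<open>A small component is itself the connecting set. For the finitely many large ones, a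
  single level \<open>N\<close> with \<open>M * tail N < \<epsilon>\<close> moves both points into
  one compact subset of the Fatou set, on which the depth of connections is uniform.\<close>

lemma deep_or_near_connection:
  assumes inj: "finite {U \<in> components (- J). \<not> inj_on f U}" and "\<epsilon> > 0"
  shows "\<exists>\<delta>>0. \<forall>U\<in>components (- J). \<forall>x\<in>U. \<forall>y\<in>U. \<exists>C. connected C \<and> C \<subseteq> - J \<and> x \<in> C \<and> y \<in> C \<and>
    (\<forall>w\<in>C. depth w \<ge> \<delta> \<or> dist x w < \<epsilon> \<or> dist y w < \<epsilon>)"
proof -
  have fin: "finite {U \<in> components (- J). diameter U \<ge> \<epsilon>}"
    using assms by (rule finite_large_components)
  have sub: "{U \<in> components (- J). diameter U \<ge> \<epsilon>} \<subseteq> components (- J)" by blast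
  obtain D where D: "finite D" "D \<subseteq> components (- J)" "{U \<in> components (- J). diameter U \<ge> \<epsilon>} \<subseteq> D"
    "\<forall>U\<in>D. f ` U \<in> D"
    using forward_closure[OF fin sub] by blast
  obtain r0 M where r0: "r0 > 0" and M: "escape D r0 M"
    using descent[OF D(1,2) bspec[OF D(4)]] by blast
  have "(\<lambda>n. real M * tail n) \<longlonglongrightarrow> real M * 0" by (intro tendsto_intros tail_tendsto)
  then have "\<forall>\<^sub>F n in sequentially. real M * tail n < \<epsilon>"
    using order_tendstoD(2) \<open>\<epsilon> > 0\<close> by fastforce
  then obtain N0 where N0: "\<And>n. n \<ge> N0 \<Longrightarrow> real M * tail n < \<epsilon>" unfolding eventually_sequentially by blast
  \<comment> \<open>The successor ensures a positive level.\<close>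
  define N where "N = Suc N0"
  have N: "N > 0" "real M * tail N < \<epsilon>" using N0[of N] by (auto simp: N_def)
  define K where "K = (f ^^ N) -` {x. depth x \<ge> r0}"
  have cK: "compact K" unfolding K_def compact_csphere_iff
    by (intro closed_vimage cont_funpow) (simp add: depth_def closed_infdist_ge)
  have KJ: "K \<subseteq> - J"
  proof
    fix x assume "x \<in> K"
    then have "depth ((f ^^ N) x) > 0" using r0 by (simp add: K_def)
    then show "x \<in> - J" by (simp add: depth_pos_iff inv_J_funpow)
  qed
  from uniform_deep_connection[OF cK KJ] obtain \<delta> where \<delta>: "\<delta> > 0"
    "\<forall>U\<in>components (- J). \<forall>x\<in>K \<inter> U. \<forall>y\<in>K \<inter> U.
      \<exists>C. connected C \<and> C \<subseteq> - J \<and> x \<in> C \<and> y \<in> C \<and> (\<forall>w\<in>C. depth w \<ge> \<delta>)"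
    by (elim exE conjE) (rule that)
  have "\<exists>C. connected C \<and> C \<subseteq> - J \<and> x \<in> C \<and> y \<in> C \<and> (\<forall>w\<in>C. depth w \<ge> \<delta> \<or> dist x w < \<epsilon> \<or> dist y w < \<epsilon>)"
    if U: "U \<in> components (- J)" and xy: "x \<in> U" "y \<in> U" for U x y
  proof (cases "diameter U \<ge> \<epsilon>")
    case False
    have "dist x w < \<epsilon>" if "w \<in> U" for w
      using diameter_bounded_bound[OF bounded_csphere xy(1) that] False by linarith
    then show ?thesis using xy in_components_connected[OF U] in_components_subset[OF U] by blast
  next
    case True
    then have "U \<in> D" using U D(3) by blast
    have "\<exists>V\<in>D. (f ^^ N) ` U = V"
    proof -
      have "(f ^^ n) ` U \<in> D" for n
      proof (induction n)
        case (Suc n)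
        have "(f ^^ Suc n) ` U = f ` (f ^^ n) ` U" by (simp add: image_comp)
        then show ?case using D(4) Suc by simp
      qed (use \<open>U \<in> D\<close> in simp)
      then show ?thesis by blast
    qed
    then have "(f ^^ N) x \<in> \<Union>D" "(f ^^ N) y \<in> \<Union>D" using xy by blast+
    then obtain A u where A: "connected A" "A \<subseteq> - J" "x \<in> A" "u \<in> A" "depth ((f ^^ N) u) \<ge> r0"
       "\<forall>w\<in>A. dist x w \<le> real M * tail N"
      using escapeD[OF M N(1)] by blast
    obtain B v where B: "connected B" "B \<subseteq> - J" "y \<in> B" "v \<in> B" "depth ((f ^^ N) v) \<ge> r0"
       "\<forall>w\<in>B. dist y w \<le> real M * tail N"
      using escapeD[OF M N(1) \<open>(f ^^ N) y \<in> \<Union>D\<close>] by blast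
    have uK: "u \<in> K \<inter> U" using connected_subset_component_eq[OF A(1-4) U xy(1)] A(5) by (simp add: K_def)
    have vK: "v \<in> K \<inter> U" using connected_subset_component_eq[OF B(1-4) U xy(2)] B(5) by (simp add: K_def)
    obtain C where C: "connected C" "C \<subseteq> - J" "u \<in> C" "v \<in> C" "\<forall>w\<in>C. depth w \<ge> \<delta>"
      using \<delta>(2)[rule_format, OF U uK vK] by blast
    have "connected (A \<union> C)" using A(1,4) C(1,3) by (intro connected_Un) auto
    then have "connected ((A \<union> C) \<union> B)" using B(1,4) C(4) by (intro connected_Un[of "A \<union> C" B]) auto
    moreover have "depth w \<ge> \<delta> \<or> dist x w < \<epsilon> \<or> dist y w < \<epsilon>" if w: "w \<in> (A \<union> C) \<union> B" for w
    proof -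
      consider "w \<in> A" | "w \<in> C" | "w \<in> B" using w by blast
      then show ?thesis
      proof cases
        case 1
        then have "dist x w \<le> real M * tail N" using A(6) by blast
        then show ?thesis using N(2) by linarith
      next
        case 2
        then show ?thesis using C(5) by blast
      next
        case 3
        then have "dist y w \<le> real M * tail N" using B(6) by blast
        then show ?thesis using N(2) by linarith
      qed
    qed
    ultimately show ?thesis using A(2,3) B(2,3) C(2) by (intro exI[of _ "(A \<union> C) \<union> B"]) simp
  qed
  then show ?thesis using \<delta>(1) by blast
qed

end

section \<open>Separation in the plane\<close>

text \<open>A holomorphic logarithm \<open>g\<close> of \<open>(x - a) / (x - b)\<close> exists on \<open>U\<close>, while the principal branch jumps
  by \<open>2 * pi * \<i>\<close> across the segment. If the complement of the segment were connected, the two would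
  differ there by a constant, contradicting continuity of \<open>g\<close> at the midpoint.\<close>

lemma segment_disconnects:
  fixes a b :: complex
  assumes U: "open U" "simply_connected U" and ab: "a \<noteq> b" "a \<notin> U" "b \<notin> U" "open_segment a b \<subseteq> U"
  shows "\<not> connected (U - closed_segment a b)"
proof
  assume con: "connected (U - closed_segment a b)"
  define h where "h x = (x - a) / (x - b)" for x
  have "h holomorphic_on U" unfolding h_def using ab(3) by (intro holomorphic_intros) auto
  moreover have "\<forall>x\<in>U. h x \<noteq> 0" using ab by (auto simp: h_def)
  ultimately obtain g where g: "g holomorphic_on U" "\<And>x. x \<in> U \<Longrightarrow> h x = exp (g x)"
    using U(2) unfolding simply_connected_eq_holomorphic_log[OF U(1)] by blast
  let ?W = "U - closed_segment a b"
  have slit: "h x \<notin> \<real>\<^sub>\<le>\<^sub>0" if x: "x \<in> ?W" for x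
  proof
    assume "h x \<in> \<real>\<^sub>\<le>\<^sub>0"
    then obtain s where s: "h x = complex_of_real s" "s \<le> 0" by (auto elim: nonpos_Reals_cases)
    have "x \<noteq> b" using x ab(3) by blast
    then have "x - a = s * (x - b)" using s(1) by (simp add: h_def divide_eq_eq)
    then have e: "(1 - s) * x = a + (- s) * b" by (simp add: algebra_simps)
    \<comment> \<open>The affine parameter of \<open>x\<close> on the line through \<open>a\<close>
      and \<open>b\<close>, obtained by solving \<open>h x = s\<close>.\<close>
    define u where "u = - s / (1 - s)"
    have u: "0 \<le> u" "u \<le> 1" using s(2) by (auto simp: u_def divide_simps)
    have s1: "1 - complex_of_real s \<noteq> 0" using s(2) by (metis cancel_comm_monoid_add_class.diff_cancel of_real_1 of_real_eq_iff right_minus_eq not_one_le_zero)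
    have "1 - u = 1 / (1 - s)" using s(2) by (simp add: u_def field_simps)
    then have "(1 - u) *\<^sub>R a + u *\<^sub>R b = (a + (- s) * b) / (1 - s)"
      by (simp add: u_def scaleR_conv_of_real add_divide_distrib diff_divide_distrib)
    also have "\<dots> = x" using e s1 by (simp add: divide_eq_eq mult.commute flip: e)
    finally have "x \<in> closed_segment a b" using u unfolding closed_segment_def by force
    then show False using x by blast
  qed
  define k where "k x = g x - Ln (h x)" for x
  \<comment> \<open>Two logarithms of the same function differ by multiples of 2 pi i, so
    \<open>k\<close> is continuous with discrete range.\<close>
  have "k constant_on ?W"
  proof (rule continuous_discrete_range_constant[OF con])
    have "continuous_on U h" unfolding h_def using ab(3) by (intro continuous_intros) auto
    then have "continuous_on ?W h" by (rule continuous_on_subset) blast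
    moreover have "continuous_on ?W g"
      using holomorphic_on_imp_continuous_on[OF g(1)] continuous_on_subset by blast
    ultimately show "continuous_on ?W k" unfolding k_def
      using slit by (intro continuous_intros) auto
    fix x assume x: "x \<in> ?W"
    have ek: "exp (k y) = 1" if "y \<in> ?W" for y
    proof -
      have "h y \<noteq> 0" using slit[OF that] by auto
      then show ?thesis using g(2)[of y] that by (simp add: k_def exp_diff)
    qed
    have "2 * pi \<le> norm (k y - k x)" if y: "y \<in> ?W" "k y \<noteq> k x" for y
    proof -
      have "exp (k y) = exp (k x)" using ek x y(1) by simp
      then obtain n where n: "k y = k x + (of_int (2 * n) * pi) * \<i>" unfolding exp_eq by blast
      then have "n \<noteq> 0" using y(2) by auto
      then have "1 \<le> \<bar>real_of_int n\<bar>" by linarith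
      have "norm (k y - k x) = norm ((of_int (2 * n) * complex_of_real pi) * \<i>)" using n by simp
      also have "\<dots> = 2 * \<bar>real_of_int n\<bar> * pi" by (simp add: norm_mult)
      also have "\<dots> \<ge> 2 * 1 * pi" using \<open>1 \<le> \<bar>real_of_int n\<bar>\<close> by (intro mult_right_mono) auto
      finally show ?thesis by simp
    qed
    then show "\<exists>e>0. \<forall>y. y \<in> ?W \<and> k y \<noteq> k x \<longrightarrow> e \<le> norm (k y - k x)"
      by (intro exI[of _ "2 * pi"]) auto
  qed
  then obtain c where c: "\<And>x. x \<in> ?W \<Longrightarrow> k x = c" unfolding constant_on_def by blast
  define m where "m = midpoint a b"
  \<comment> \<open>The perpendicular bisector of the segment. At the midpoint \<open>- h\<close>
    equals 1, so \<open>Ln (- h x)\<close> is continuous there; it differs from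
    \<open>Ln (h x)\<close> by i pi, with opposite signs on the two sides.\<close>
  define u where "u t = m + (\<i> * of_real t) * (b - a)" for t :: real
  have mU: "m \<in> U" using ab(1,4) by (auto simp: m_def)
  have hu: "- h (u t) = Complex ((1 - 4 * t\<^sup>2) / (1 + 4 * t\<^sup>2)) (4 * t / (1 + 4 * t\<^sup>2))" for t
  proof -
    let ?z = "- 1 + 2 * \<i> * of_real t"
    have nz: "?z \<noteq> 0" by (auto simp: complex_eq_iff)
    have ba: "b - a \<noteq> 0" using ab(1) by simp
    have e: "u t - a = (b - a) / 2 * (1 + 2 * \<i> * of_real t)" "u t - b = (b - a) / 2 * ?z"
      by (simp_all add: u_def m_def midpoint_def scaleR_conv_of_real field_simps)
    have "(b - a) / 2 \<noteq> 0" using ba by simp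
    then have hz: "h (u t) = (1 + 2 * \<i> * of_real t) / ?z"
      unfolding h_def e by (rule nonzero_mult_divide_mult_cancel_left)
    have p: "1 + 4 * t\<^sup>2 > 0" by (simp add: add_pos_nonneg)
    have Y: "Complex ((1 - 4 * t\<^sup>2) / (1 + 4 * t\<^sup>2)) (4 * t / (1 + 4 * t\<^sup>2)) * ?z = - (1 + 2 * \<i> * of_real t)"
      using p by (simp add: complex_eq_iff divide_simps) (simp add: power2_eq_square algebra_simps)
    show ?thesis
      unfolding hz minus_divide_left Y[symmetric] using nz by (rule nonzero_mult_div_cancel_right)
  qed
  have ut: "(u \<longlongrightarrow> m) (at 0)"
  proof -
    have "(u \<longlongrightarrow> m + (\<i> * of_real 0) * (b - a)) (at 0)" unfolding u_def by (intro tendsto_intros)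
    then show ?thesis by simp
  qed
  define G where "G x = g x - Ln (- h x)" for x
  have "isCont g m"
    using holomorphic_on_imp_continuous_on[OF g(1)] U(1) mU continuous_on_eq_continuous_at by blast
  moreover have "isCont h m" unfolding h_def using mU ab(3) by (intro continuous_intros) auto
  moreover have "- h m = 1" using hu[of 0] by (simp add: u_def one_complex.code)
  ultimately have "isCont G m" unfolding G_def by (intro continuous_intros) auto
  then have lim: "((\<lambda>t. G (u t)) \<longlongrightarrow> G m) (at 0)"
    using ut by (rule isCont_tendsto_compose)
  have evU: "\<forall>\<^sub>F t in at 0. u t \<in> U"
    using topological_tendstoD[OF ut U(1) mU] .
  have val: "G (u t) = c - (if t > 0 then \<i> * pi else - (\<i> * pi))" if t: "u t \<in> U" "t \<noteq> 0" for t
  proof -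
    have p: "1 + 4 * t\<^sup>2 > 0" by (simp add: add_pos_nonneg)
    have im: "Im (- h (u t)) = 4 * t / (1 + 4 * t\<^sup>2)" unfolding hu by simp
    have ne: "- h (u t) \<noteq> 0" using im t(2) p by (metis divide_eq_0_iff less_numeral_extra(3) mult_eq_0_iff zero_complex.simps(2) zero_neq_numeral)
    have "u t \<notin> closed_segment a b"
    proof
      assume "u t \<in> closed_segment a b"
      moreover have "u t \<noteq> a" "u t \<noteq> b" using t(1) ab by auto
      ultimately have "u t \<in> open_segment a b" by (simp add: open_segment_def)
      then obtain s where s: "0 < s" "s < 1" "u t = (1 - s) *\<^sub>R a + s *\<^sub>R b"
        unfolding in_segment by blast
      have "u t - a = s * (b - a)" "u t - b = (s - 1) * (b - a)"
        using s(3) by (simp_all add: scaleR_conv_of_real algebra_simps)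
      then have "h (u t) = of_real (s / (s - 1))" using ab(1) by (simp add: h_def)
      then have "Im (- h (u t)) = 0" by simp
      then show False using im t(2) p by simp
    qed
    then have "k (u t) = c" using c t(1) by blast
    moreover have "Ln (h (u t)) = (if t > 0 then Ln (- h (u t)) - \<i> * pi else Ln (- h (u t)) + \<i> * pi)"
    proof -
      have "Im (- h (u t)) \<le> 0 \<longleftrightarrow> \<not> t > 0" "Im (- h (u t)) \<noteq> 0"
        unfolding im using p t(2) by (auto simp: divide_le_0_iff)
      then show ?thesis using Ln_minus[OF ne] by simp
    qed
    ultimately show ?thesis by (auto simp: k_def G_def)
  qed
  have "((\<lambda>t. G (u t)) \<longlongrightarrow> c - \<i> * pi) (at_right 0)"
  proof (rule tendsto_eventually)
    have "\<forall>\<^sub>F t in at_right 0. u t \<in> U" using evU by (rule filter_leD[rotated]) (simp add: at_le)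
    moreover have "\<forall>\<^sub>F t :: real in at_right 0. t > 0" by (simp add: eventually_at_right_less)
    ultimately show "\<forall>\<^sub>F t in at_right 0. G (u t) = c - \<i> * pi"
      by eventually_elim (simp add: val)
  qed
  moreover have "((\<lambda>t. G (u t)) \<longlongrightarrow> G m) (at_right 0)" using lim filterlim_at_split by blast
  ultimately have 1: "G m = c - \<i> * pi" using tendsto_unique trivial_limit_at_right_real by blast
  have "((\<lambda>t. G (u t)) \<longlongrightarrow> c + \<i> * pi) (at_left 0)"
  proof (rule tendsto_eventually)
    have "\<forall>\<^sub>F t in at_left 0. u t \<in> U" using evU by (rule filter_leD[rotated]) (simp add: at_le)
    moreover have "\<forall>\<^sub>F t :: real in at_left 0. t < 0" by (simp add: eventually_at_left_field) (meson lt_ex)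
    ultimately show "\<forall>\<^sub>F t in at_left 0. G (u t) = c + \<i> * pi"
      by eventually_elim (simp add: val)
  qed
  moreover have "((\<lambda>t. G (u t)) \<longlongrightarrow> G m) (at_left 0)" using lim filterlim_at_split by blast
  ultimately have "G m = c + \<i> * pi" using tendsto_unique trivial_limit_at_left_real by blast
  then show False using 1 by (simp add: complex_eq_iff)
qed

section \<open>Splitting compact plane sets along a segment\<close>

lemma compact_separation:
  fixes X :: "complex set"
  assumes "compact X" "a \<in> X" "b \<in> X" "\<not> connected_component X a b"
  obtains A B where "compact A" "compact B" "A \<inter> B = {}" "A \<union> B = X" "a \<in> A" "b \<in> B"
proof -
  let ?C = "connected_component_set X a"
  have "?C \<in> components X" using assms(2) by (rule componentsI)
  \<comment> \<open>In a compact set a component is the intersection of the relatively clopen sets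
    containing it.\<close>
  then have "?C = \<Inter>{T. ?C \<subseteq> T \<and> openin (top_of_set X) T \<and> closedin (top_of_set X) T}"
    by (rule Sura_Bura_compact[OF assms(1)])
  moreover have "b \<notin> ?C" using assms(4) by simp
  ultimately obtain T where T: "?C \<subseteq> T" "openin (top_of_set X) T" "closedin (top_of_set X) T" "b \<notin> T"
    by blast
  have "closedin (top_of_set X) (X - T)" using T(2) by (simp add: openin_closedin_eq)
  then have "compact (X - T)" using assms(1) closedin_compact by blast
  moreover have "compact T" using T(3) assms(1) closedin_compact by blast
  moreover have "a \<in> T" using T(1) assms(2) by auto
  moreover have "T \<subseteq> X" using T(3) closedin_subset by fastforce
  ultimately show ?thesis using assms(3) T(4) by (intro that[of T "X - T"]) auto
qed

text \<open>Take a closest pair on the segment; a further point of \<open>A\<close> or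
  \<open>B\<close> between the two would be closer to one of them.\<close>

lemma gap_segment:
  fixes A B :: "complex set"
  assumes "compact A" "compact B" "A \<inter> B = {}" "a \<in> A" "b \<in> B"
  obtains a' b' where "a' \<in> A" "b' \<in> B" "closed_segment a' b' \<subseteq> closed_segment a b"
    "open_segment a' b' \<inter> (A \<union> B) = {}"
proof -
  let ?I = "closed_segment a b"
  have c: "compact ((A \<inter> ?I) \<times> (B \<inter> ?I))"
    using assms by (intro compact_Times compact_Int compact_segment)
  have ne: "(A \<inter> ?I) \<times> (B \<inter> ?I) \<noteq> {}" using assms by auto
  have "continuous_on ((A \<inter> ?I) \<times> (B \<inter> ?I)) (\<lambda>p. dist (fst p) (snd p))"
    by (intro continuous_intros)
  from continuous_attains_inf[OF c ne this] obtain a' b' where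
    ab: "a' \<in> A" "a' \<in> ?I" "b' \<in> B" "b' \<in> ?I"
    and m: "\<And>x y. x \<in> A \<Longrightarrow> x \<in> ?I \<Longrightarrow> y \<in> B \<Longrightarrow> y \<in> ?I \<Longrightarrow> dist a' b' \<le> dist x y"
    by auto
  have sub: "closed_segment a' b' \<subseteq> ?I" using ab by (simp add: subset_closed_segment)
  have "x \<notin> A \<union> B" if x: "x \<in> open_segment a' b'" for x
  proof
    assume "x \<in> A \<union> B"
    moreover have "x \<in> ?I" using x sub open_closed_segment by blast
    ultimately show False
      using dist_in_open_segment[OF x] m[of x b'] m[of a' x] ab by (auto simp: dist_commute)
  qed
  then show ?thesis using ab sub by (intro that[of a' b']) auto
qed

text \<open>The omitted point \<open>c\<close> is arbitrary so that it can be taken in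
  \<open>J\<close>; Fatou components then correspond to components in the plane.\<close>

locale sphere_chart =
  fixes \<phi> :: "complex \<Rightarrow> csphere" and c :: csphere
  assumes contp: "\<And>A. continuous_on A \<phi>" and openp: "\<And>U. open U \<Longrightarrow> open (\<phi> ` U)"
    and injp: "inj \<phi>" and rangep: "range \<phi> = - {c}"
begin

section \<open>Fatou components seen in a chart\<close>

lemma connected_vimage:
  assumes "connected C" "C \<subseteq> - {c}"
  shows "connected (\<phi> -` C)"
proof -
  have "continuous_on (range \<phi>) (inv \<phi>)"
  proof (rule continuous_on_inverse_open_map[OF contp refl])
    show "inv \<phi> (\<phi> x) = x" for x using injp by simp
    show "openin (top_of_set (range \<phi>)) (\<phi> ` U)" if "openin (top_of_set UNIV) U" for U
      using openp[of U] that by (intro open_subset) auto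
  qed
  then have "continuous_on C (inv \<phi>)" using assms(2) rangep continuous_on_subset by blast
  then have "connected (inv \<phi> ` C)" using assms(1) by (rule connected_continuous_image)
  moreover have "inv \<phi> ` C = \<phi> -` C"
  proof (intro subset_antisym subsetI)
    fix x assume "x \<in> inv \<phi> ` C"
    then obtain y where y: "y \<in> C" "x = inv \<phi> y" by blast
    then have "y \<in> range \<phi>" using assms(2) rangep by blast
    then show "x \<in> \<phi> -` C" using y by (simp add: f_inv_into_f)
  next
    fix x assume "x \<in> \<phi> -` C"
    then have "inv \<phi> (\<phi> x) \<in> inv \<phi> ` C" by blast
    then show "x \<in> inv \<phi> ` C" using injp by simp
  qed
  ultimately show ?thesis by simp
qed

text \<open>The winding number is locally constant off the curve and vanishes outside a large disc,
  that is near \<open>c\<close>. Connectedness of the complement on the sphere spreads the value 0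
  from \<open>c\<close>, where \<open>P\<close> holds vacuously.\<close>

lemma simply_connected_chart:
  assumes V: "open V" "connected V" "connected (- \<phi> ` V)"
  shows "simply_connected V"
  unfolding simply_connected_eq_winding_number_zero[OF V(1)]
proof (intro conjI allI impI V(2))
  fix g z assume g: "path g \<and> path_image g \<subseteq> V \<and> pathfinish g = pathstart g \<and> z \<notin> V"
  define P where "P x \<longleftrightarrow> (\<forall>w. x = \<phi> w \<longrightarrow> winding_number g w = 0)" for x
  have c: "c \<notin> range \<phi>" using rangep by auto
  have cS: "c \<in> - \<phi> ` V" using c by blast
  have zS: "\<phi> z \<in> - \<phi> ` V" using g injp by (auto dest: injD)
  have "P (\<phi> z)"
  proof (rule connected_induction_simple[OF V(3) cS zS])
    show "P c" using c unfolding P_def by blast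
    fix x assume x: "x \<in> - \<phi> ` V"
    show "\<exists>T. openin (top_of_set (- \<phi> ` V)) T \<and> x \<in> T \<and> (\<forall>x\<in>T. \<forall>y\<in>T. P x \<longrightarrow> P y)"
    proof (cases "x = c")
      case True
      have "bounded (path_image g)" using g bounded_path_image by blast
      then obtain B where B: "path_image g \<subseteq> cball 0 B"
        using bounded_subset_ballD[of "path_image g" 0] ball_subset_cball by blast
      let ?O = "- \<phi> ` cball 0 B"
      have "closed (\<phi> ` cball 0 B)" by (intro compact_imp_closed compact_continuous_image contp compact_cball)
      then have "open ?O" by blast
      moreover have "P y" if "y \<in> ?O" for y unfolding P_def
      proof (intro allI impI)
        fix w assume "y = \<phi> w"
        then have "w \<notin> cball 0 B" using that by blast
        then show "winding_number g w = 0"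
          using g B winding_number_zero_outside[of g "cball 0 B" w] by auto
      qed
      ultimately show ?thesis using x c True by (intro exI[of _ "- \<phi> ` V \<inter> ?O"]) (auto simp: openin_open_Int)
    next
      case False
      then obtain w where w: "x = \<phi> w" using rangep by blast
      then have "w \<notin> path_image g" using x g by blast
      moreover have "closed (path_image g)" using g closed_path_image by blast
      ultimately obtain e where e: "e > 0" "ball w e \<subseteq> - path_image g"
        by (metis ComplI closed_def openE)
      have "P y" if vy: "v \<in> \<phi> ` ball w e" "y \<in> \<phi> ` ball w e" "P v" for v y unfolding P_def
      proof (intro allI impI)
        fix y' assume "y = \<phi> y'"
        then have y': "y' \<in> ball w e" using vy(2) injp by (auto dest: injD)
        obtain v' where v': "v' \<in> ball w e" "v = \<phi> v'" using vy(1) by blast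
        then have "winding_number g v' = 0" using vy(3) unfolding P_def by blast
        moreover have "winding_number g y' = winding_number g v'"
          by (rule winding_number_eq[where S = "ball w e"]) (use g y' v' e in auto)
        ultimately show "winding_number g y' = 0" by simp
      qed
      then have "\<forall>v\<in>- \<phi> ` V \<inter> \<phi> ` ball w e. \<forall>y\<in>- \<phi> ` V \<inter> \<phi> ` ball w e. P v \<longrightarrow> P y" by blast
      moreover have "openin (top_of_set (- \<phi> ` V)) (- \<phi> ` V \<inter> \<phi> ` ball w e)"
        using openp[of "ball w e"] by (simp add: openin_open_Int)
      moreover have "x \<in> - \<phi> ` V \<inter> \<phi> ` ball w e" using x w e(1) by auto
      ultimately show ?thesis by blast
    qed
  qed
  then show "winding_number g z = 0" unfolding P_def by blast
qed

lemma image_component_chart: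
  assumes "c \<in> J" "U \<in> components (- \<phi> -` J)"
  shows "\<phi> ` U \<in> components (- J)"
proof -
  have U: "U \<noteq> {}" "connected U" "U \<subseteq> - \<phi> -` J"
    "\<And>D. D \<noteq> {} \<Longrightarrow> U \<subseteq> D \<Longrightarrow> D \<subseteq> - \<phi> -` J \<Longrightarrow> connected D \<Longrightarrow> D = U"
    using assms(2) unfolding in_components_maximal by auto
  show ?thesis unfolding in_components_maximal
  proof (intro conjI allI impI)
    show "connected (\<phi> ` U)" by (intro connected_continuous_image contp U)
    fix D assume D: "D \<noteq> {} \<and> \<phi> ` U \<subseteq> D \<and> D \<subseteq> - J \<and> connected D"
    then have "D \<subseteq> - {c}" using assms(1) by blast
    then have "connected (\<phi> -` D)" using D by (intro connected_vimage) auto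
    then have "\<phi> -` D = U" using D U(1) by (intro U(4)) auto
    moreover have "D \<subseteq> range \<phi>" using \<open>D \<subseteq> - {c}\<close> rangep by simp
    ultimately show "D = \<phi> ` U" by blast
  qed (use U in auto)
qed

text \<open>Otherwise \<open>A\<close>, \<open>B\<close> and the segment separate \<open>p\<close> from a point outside \<open>D\<close>. By Janiszewski's
  theorem \<open>A\<close> or \<open>B\<close> alone does, and the component of its complement around the segment then cuts a
  nonempty relatively clopen proper subset out of \<open>J\<close>.\<close>

lemma side_reaches_out:
  fixes \<alpha> :: complex
  assumes J: "connected J" "c \<in> J" and G: "G = \<phi> -` J" "closed G"
    and D: "D = cball \<alpha> \<rho>" "\<rho> > 0" and AB: "compact A" "compact B" "A \<inter> B = {}" "A \<union> B = G \<inter> D"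
    and ab: "a \<in> A" "b \<in> B" "closed_segment a b \<subseteq> ball \<alpha> \<rho>" "open_segment a b \<inter> G = {}"
    and U: "U \<in> components (- G)" "open_segment a b \<subseteq> U" and p: "p \<in> U" "p \<notin> closed_segment a b"
  shows "\<exists>y. y \<notin> ball \<alpha> (\<rho> / 2) \<and> connected_component (- (G \<union> closed_segment a b)) p y"
proof (rule ccontr)
  let ?I = "closed_segment a b"
  assume contra: "\<not> ?thesis"
  define P where "P = connected_component_set (- (G \<union> ?I)) p"
  have P_ball: "P \<subseteq> ball \<alpha> (\<rho> / 2)" using contra unfolding P_def by blast
  have AG: "A \<subseteq> G" "B \<subseteq> G" "A \<subseteq> D" "B \<subseteq> D" using AB(4) by blast+
  have UG: "U \<subseteq> - G" "connected U" using in_components_subset[OF U(1)] in_components_connected[OF U(1)] by auto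
  have clI: "closed ?I" "compact ?I" "connected ?I" by auto
  have pG: "p \<in> - (G \<union> ?I)" using p UG by blast
  have oP: "open P" unfolding P_def by (intro open_connected_component open_Compl closed_Un G(2) clI)
  have pP: "p \<in> P" unfolding P_def using pG by simp
  define out where "out = \<alpha> + 2 * of_real \<rho>"
  have out: "out \<notin> D" using D by (simp add: out_def dist_norm norm_mult)
  \<comment> \<open>\<open>P\<close> stays in the ball of radius \<open>\<rho> / 2\<close>, inside
    \<open>D\<close>, where \<open>A\<close> and \<open>B\<close> make up all of \<open>G\<close>.
    It is therefore clopen in every connected set that avoids \<open>A\<close>, \<open>B\<close> and
    the segment.\<close>
  have nab: "\<not> connected_component (- ((A \<union> ?I) \<union> (B \<union> ?I))) p out"
  proof
    assume "connected_component (- ((A \<union> ?I) \<union> (B \<union> ?I))) p out"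
    then obtain T where T: "connected T" "T \<subseteq> - ((A \<union> ?I) \<union> (B \<union> ?I))" "p \<in> T" "out \<in> T"
      unfolding connected_component_def by blast
    have "closedin (top_of_set (- (G \<union> ?I))) P" unfolding P_def by (rule closedin_connected_component)
    then obtain S where S: "closed S" "P = - (G \<union> ?I) \<inter> S" unfolding closedin_closed by blast
    have "T \<inter> P = T \<inter> (S \<inter> cball \<alpha> (\<rho> / 2))"
    proof (intro subset_antisym subsetI)
      fix x assume "x \<in> T \<inter> P"
      then show "x \<in> T \<inter> (S \<inter> cball \<alpha> (\<rho> / 2))" using S(2) P_ball ball_subset_cball by blast
    next
      fix x assume x: "x \<in> T \<inter> (S \<inter> cball \<alpha> (\<rho> / 2))"
      have "x \<in> D" using x D by auto
      then have "x \<notin> G" using x T(2) AB(4) by blast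
      then show "x \<in> T \<inter> P" using x T(2) S(2) by blast
    qed
    then have "closedin (top_of_set T) (T \<inter> P)"
      using S(1) by (simp add: closedin_closed_Int closed_Int)
    moreover have "openin (top_of_set T) (T \<inter> P)" using oP by (rule openin_open_Int)
    ultimately have "T \<inter> P = {} \<or> T \<inter> P = T" using T(1) unfolding connected_clopen by blast
    then have "out \<in> P" using T(3,4) pP by blast
    then show False using P_ball out D by (auto simp: out_def)
  qed
  have oI: "connected_component (- ?I) p out"
  proof -
    have "connected (- ?I)"
      by (intro connected_complement_bounded_convex compact_imp_bounded clI(2) convex_closed_segment) simp
    moreover have "out \<notin> ?I" using out ab(3) D ball_subset_cball by blast
    ultimately show ?thesis
      unfolding connected_component_def using p(2) by blast
  qed
  \<comment> \<open>Stated for both orders of \<open>A\<close> and \<open>B\<close>, since either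
    may be the one that separates.\<close>
  have key: False
    if E: "compact E" "compact E'" "E \<inter> E' = {}" "E \<union> E' = G \<inter> D" "e \<in> E" "e' \<in> E'"
      and I: "?I = open_segment a b \<union> {e, e'}" and ncc: "\<not> connected_component (- E) p out"
    for E E' e e'
  proof -
    define H where "H = connected_component_set (- E) p"
    have EG: "E \<subseteq> G" "E \<subseteq> D" using E(4) by blast+
    have UE: "U \<subseteq> - E" using UG EG by blast
    have UH: "U \<subseteq> H" unfolding H_def by (rule connected_component_maximal[OF p(1) UG(2) UE])
    have oH: "open H" unfolding H_def using E(1) by (intro open_connected_component) (auto intro: compact_imp_closed)
    have ab_ne: "open_segment a b \<noteq> {}" using ab(1,2) AB(3) by auto
    have "e' \<in> H"
    proof -
      have "connected (insert e' (open_segment a b))"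
      proof (rule connected_intermediate_closure[of "open_segment a b"])
        have "closure (open_segment a b) = ?I" using ab(1,2) AB(3) by auto
        then show "insert e' (open_segment a b) \<subseteq> closure (open_segment a b)" using I by blast
      qed (auto intro: convex_connected convex_open_segment)
      moreover have "insert e' (open_segment a b) \<subseteq> - E"
        using E(3,6) ab(4) EG by blast
      moreover obtain q where "q \<in> open_segment a b" using ab_ne by blast
      moreover have "q \<in> H" using UH U(2) \<open>q \<in> open_segment a b\<close> by blast
      ultimately have "insert e' (open_segment a b) \<subseteq> connected_component_set (- E) q"
        by (intro connected_component_maximal) auto
      also have "\<dots> = H" using \<open>q \<in> H\<close> unfolding H_def by (metis connected_component_eq)
      finally show ?thesis by blast
    qed
    have HD: "H \<subseteq> D"
    proof (rule ccontr)
      assume "\<not> H \<subseteq> D"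
      then obtain x where x: "x \<in> H" "x \<notin> D" by blast
      have "connected (- D)" unfolding D
        by (intro connected_complement_bounded_convex bounded_cball convex_cball) simp
      then have "connected_component (- E) x out"
        unfolding connected_component_def using EG(2) x(2) out by blast
      then have "connected_component (- E) p out"
        using x(1) unfolding H_def by (auto intro: connected_component_trans)
      then show False using ncc by blast
    qed
    have HE: "H \<inter> E = {}" unfolding H_def using connected_component_subset by blast
    have HG: "H \<inter> G = H \<inter> E'" using HD HE E(4) by blast
    have "closedin (top_of_set (- E)) H" unfolding H_def by (rule closedin_connected_component)
    then obtain S where S: "closed S" "H = - E \<inter> S" unfolding closedin_closed by blast
    have "H \<inter> E' = E' \<inter> S" using S(2) E(3) by blast
    then have "compact (H \<inter> G)" using HG E(2) S(1) by (simp add: compact_Int_closed)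
    then have "closed (\<phi> ` (H \<inter> G))" by (intro compact_imp_closed compact_continuous_image contp)
    moreover have eq: "\<phi> ` (H \<inter> G) = J \<inter> \<phi> ` H" using G(1) by auto
    ultimately have "closedin (top_of_set J) (J \<inter> \<phi> ` H)"
      by (metis closed_subset inf_le1)
    moreover have "openin (top_of_set J) (J \<inter> \<phi> ` H)" using openp[OF oH] by (rule openin_open_Int)
    ultimately have "J \<inter> \<phi> ` H = {} \<or> J \<inter> \<phi> ` H = J" using J(1) unfolding connected_clopen by blast
    moreover have "\<phi> e' \<in> J \<inter> \<phi> ` H" using \<open>e' \<in> H\<close> E(4,6) G(1) by blast
    ultimately have "J \<subseteq> \<phi> ` H" by blast
    moreover have "\<phi> e \<in> J" using E(5) EG G(1) by blast
    ultimately obtain x where "x \<in> H" "\<phi> e = \<phi> x" by blast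
    then have "e \<in> H" using injp by (auto dest: injD)
    then show False using HE E(5) by blast
  qed
  have abI: "?I = open_segment a b \<union> {a, b}" using closed_segment_eq_open by blast
  \<comment> \<open>Janiszewski is used twice: first to pass to one of \<open>A\<close> and
    \<open>B\<close> together with the segment, then to drop the segment, which meets the chosen set
    in one end point.\<close>
  have "(A \<union> ?I) \<inter> (B \<union> ?I) = ?I" using AB(3) by blast
  then have c: "connected ((A \<union> ?I) \<inter> (B \<union> ?I))" by simp
  have "compact (A \<union> ?I)" "closed (B \<union> ?I)"
    using AB(1,2) clI by (auto intro!: compact_Un closed_Un compact_imp_closed)
  from Janiszewski[OF this c] have "\<not> connected_component (- (A \<union> ?I)) p out \<or> \<not> connected_component (- (B \<union> ?I)) p out"
    using nab by blast
  then show False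
  proof
    assume n: "\<not> connected_component (- (A \<union> ?I)) p out"
    have "A \<inter> ?I = {a}" using ab(1,2,4) AB(3) AG(1) abI by blast
    then have "connected (A \<inter> ?I)" by simp
    then have "\<not> connected_component (- A) p out"
      using Janiszewski[OF AB(1) clI(1)] n oI by blast
    then show False using key[OF AB(1,2,3,4) ab(1,2) abI] by blast
  next
    assume n: "\<not> connected_component (- (B \<union> ?I)) p out"
    have "B \<inter> ?I = {b}" using ab(1,2,4) AB(3) AG(2) abI by blast
    then have "connected (B \<inter> ?I)" by simp
    then have "\<not> connected_component (- B) p out"
      using Janiszewski[OF AB(2) clI(1)] n oI by blast
    moreover have "B \<inter> A = {}" "B \<union> A = G \<inter> D" "?I = open_segment a b \<union> {b, a}"
      using AB(3,4) abI by blast+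
    ultimately show False using key[OF AB(2,1)] ab(1,2) by blast
  qed
qed

lemma locally_connected_in_chart:
  assumes J: "closed J" "connected J" "c \<in> J"
    and near: "\<And>\<epsilon>. \<epsilon> > 0 \<Longrightarrow> \<exists>\<delta>>0. \<forall>U\<in>components (- J). \<forall>x\<in>U. \<forall>y\<in>U. \<exists>C. connected C \<and> C \<subseteq> - J \<and> x \<in> C \<and> y \<in> C \<and>
      (\<forall>w\<in>C. infdist w J \<ge> \<delta> \<or> dist x w < \<epsilon> \<or> dist y w < \<epsilon>)"
    and \<alpha>: "\<phi> \<alpha> \<in> J" and \<rho>: "\<rho> > 0"
  shows "\<exists>\<delta>>0. \<forall>a\<in>ball \<alpha> \<delta>. \<forall>b\<in>ball \<alpha> \<delta>. \<phi> a \<in> J \<longrightarrow> \<phi> b \<in> J \<longrightarrow>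
    connected_component (\<phi> -` J \<inter> cball \<alpha> \<rho>) a b"
proof -
  define G where "G = \<phi> -` J"
  define D where "D = cball \<alpha> \<rho>"
  have cG: "closed G" unfolding G_def by (intro closed_vimage J(1) contp)
  \<comment> \<open>The chart is not an isometry. \<epsilon> is a spherical gap between the image of
    the disc of radius \<open>\<rho> / 4\<close> and everything outside the image of the ball of
    radius \<open>\<rho> / 2\<close>.\<close>
  have "compact (\<phi> ` cball \<alpha> (\<rho> / 4))" by (intro compact_continuous_image contp compact_cball)
  moreover have "\<phi> ` cball \<alpha> (\<rho> / 4) \<subseteq> \<Union>{\<phi> ` ball \<alpha> (\<rho> / 2)}" using \<rho> by auto
  moreover have "open B" if "B \<in> {\<phi> ` ball \<alpha> (\<rho> / 2)}" for B using that openp by simp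
  ultimately obtain \<epsilon> where \<epsilon>: "\<epsilon> > 0" "\<And>x. x \<in> \<phi> ` cball \<alpha> (\<rho> / 4) \<Longrightarrow> ball x \<epsilon> \<subseteq> \<phi> ` ball \<alpha> (\<rho> / 2)"
    using Heine_Borel_lemma[of "\<phi> ` cball \<alpha> (\<rho> / 4)" "{\<phi> ` ball \<alpha> (\<rho> / 2)}"] by (metis singletonD)
  obtain \<delta>0 where \<delta>0: "\<delta>0 > 0" "\<forall>U\<in>components (- J). \<forall>x\<in>U. \<forall>y\<in>U. \<exists>C. connected C \<and> C \<subseteq> - J \<and> x \<in> C \<and> y \<in> C \<and>
      (\<forall>w\<in>C. infdist w J \<ge> \<delta>0 \<or> dist x w < \<epsilon> \<or> dist y w < \<epsilon>)"
    using near[OF \<epsilon>(1)] by (elim exE conjE) (rule that)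
  have "open (\<phi> -` ball (\<phi> \<alpha>) \<delta>0)" by (intro open_vimage contp) auto
  moreover have "\<alpha> \<in> \<phi> -` ball (\<phi> \<alpha>) \<delta>0" using \<delta>0(1) by simp
  ultimately obtain \<delta>1 where \<delta>1: "\<delta>1 > 0" "ball \<alpha> \<delta>1 \<subseteq> \<phi> -` ball (\<phi> \<alpha>) \<delta>0" by (rule openE)
  \<comment> \<open>Points of the segment thus have depth below \<open>\<delta>0\<close> and are at
    least \<epsilon> away from the points reached outside the larger ball, so the set
    \<open>C\<close> joining those points cannot meet the segment.\<close>
  define \<delta> where "\<delta> = min \<delta>1 (\<rho> / 4)"
  have \<delta>: "\<delta> > 0" "\<delta> \<le> \<delta>1" "\<delta> \<le> \<rho> / 4" using \<delta>1(1) \<rho> by (auto simp: \<delta>_def)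
  have "connected_component (G \<inter> D) a b" if ab: "a \<in> ball \<alpha> \<delta>" "b \<in> ball \<alpha> \<delta>" "a \<in> G" "b \<in> G" for a b
  proof (rule ccontr)
    assume ncc: "\<not> connected_component (G \<inter> D) a b"
    have "compact (G \<inter> D)" unfolding D_def using cG by (simp add: closed_Int_compact)
    moreover have "a \<in> G \<inter> D" "b \<in> G \<inter> D" using ab \<delta>(3) \<rho> by (auto simp: D_def)
    ultimately obtain A B where AB: "compact A" "compact B" "A \<inter> B = {}" "A \<union> B = G \<inter> D" "a \<in> A" "b \<in> B"
      using ncc by (rule compact_separation)
    obtain a' b' where ab': "a' \<in> A" "b' \<in> B" "closed_segment a' b' \<subseteq> closed_segment a b"
      "open_segment a' b' \<inter> (A \<union> B) = {}"
      using gap_segment[OF AB(1,2,3,5,6)] by blast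
    let ?I = "closed_segment a' b'"
    have "closed_segment a b \<subseteq> ball \<alpha> \<delta>" using ab(1,2) by (simp add: closed_segment_subset)
    then have I\<delta>: "?I \<subseteq> ball \<alpha> \<delta>" using ab'(3) by blast
    then have I\<rho>: "?I \<subseteq> ball \<alpha> \<rho>" using \<delta>(3) \<rho> by auto
    have "open_segment a' b' \<subseteq> D"
      using I\<rho> open_closed_segment ball_subset_cball unfolding D_def by blast
    then have oG: "open_segment a' b' \<inter> G = {}" using ab'(4) AB(4) by blast
    have abne: "a' \<noteq> b'" using ab'(1,2) AB(3) by blast
    then obtain m where m: "m \<in> open_segment a' b'" by (metis ex_in_conv open_segment_eq_empty)
    define U where "U = connected_component_set (- G) m"
    have mG: "m \<in> - G" using m oG by blast
    have UC: "U \<in> components (- G)" unfolding U_def using mG by (rule componentsI)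
    have oU: "open U" unfolding U_def using cG by (intro open_connected_component) auto
    have cU: "connected U" "U \<subseteq> - G" using in_components_connected[OF UC] in_components_subset[OF UC] by auto
    have segU: "open_segment a' b' \<subseteq> U" unfolding U_def
      using m oG by (intro connected_component_maximal convex_connected convex_open_segment) auto
    have VC: "\<phi> ` U \<in> components (- J)"
      using UC unfolding G_def by (rule image_component_chart[OF J(3)])
    have "connected (UNIV - \<phi> ` U)"
      using component_diff_connected[OF J(2) connected_UNIV_csphere] VC by (simp add: Compl_eq_Diff_UNIV)
    then have "simply_connected U"
      by (intro simply_connected_chart oU cU) (simp add: Compl_eq_Diff_UNIV)
    moreover have abG: "a' \<in> G" "b' \<in> G" using ab'(1,2) AB(4) by blast+
    ultimately have "\<not> connected (U - ?I)"
      using cU(2) abne by (intro segment_disconnects oU segU) auto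
    then obtain p1 p2 where p: "p1 \<in> U - ?I" "p2 \<in> U - ?I" "\<not> connected_component (U - ?I) p1 p2"
      unfolding connected_iff_connected_component by blast
    have reach: "\<exists>y. y \<notin> ball \<alpha> (\<rho> / 2) \<and> connected_component (- (G \<union> ?I)) p y" if "p \<in> U - ?I" for p
      using side_reaches_out[OF J(2,3) G_def cG D_def \<rho> AB(1-4) ab'(1,2) I\<rho> oG UC segU] that by blast
    obtain y1 where y1: "y1 \<notin> ball \<alpha> (\<rho> / 2)" "connected_component (- (G \<union> ?I)) p1 y1"
      using reach[OF p(1)] by blast
    obtain y2 where y2: "y2 \<notin> ball \<alpha> (\<rho> / 2)" "connected_component (- (G \<union> ?I)) p2 y2"
      using reach[OF p(2)] by blast
    have inU: "T \<subseteq> U - ?I" if "connected T" "T \<subseteq> - (G \<union> ?I)" "T \<inter> U \<noteq> {}" for T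
    proof -
      have "T \<subseteq> U" using components_maximal[OF UC that(1)] that(2,3) by blast
      then show ?thesis using that(2) by blast
    qed
    have yU: "y \<in> U" if py: "p \<in> U - ?I" "connected_component (- (G \<union> ?I)) p y" for p y
    proof -
      obtain T where T: "connected T" "T \<subseteq> - (G \<union> ?I)" "p \<in> T" "y \<in> T"
        using py(2) unfolding connected_component_def by blast
      then show ?thesis using inU[OF T(1,2)] py(1) by blast
    qed
    have "y1 \<in> U" "y2 \<in> U" using yU p(1,2) y1(2) y2(2) by blast+
    then have yV: "\<phi> y1 \<in> \<phi> ` U" "\<phi> y2 \<in> \<phi> ` U" by blast+
    obtain C where C: "connected C" "C \<subseteq> - J" "\<phi> y1 \<in> C" "\<phi> y2 \<in> C"
      "\<forall>w\<in>C. infdist w J \<ge> \<delta>0 \<or> dist (\<phi> y1) w < \<epsilon> \<or> dist (\<phi> y2) w < \<epsilon>"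
      using bspec[OF bspec[OF bspec[OF \<delta>0(2) VC] yV(1)] yV(2)] by (elim exE conjE) (rule that)
    have far: "\<not> dist (\<phi> y) (\<phi> x) < \<epsilon>" if x: "x \<in> ?I" and y: "y \<notin> ball \<alpha> (\<rho> / 2)" for x y
    proof
      assume "dist (\<phi> y) (\<phi> x) < \<epsilon>"
      moreover have "x \<in> cball \<alpha> (\<rho> / 4)" using x I\<delta> \<delta>(3) by force
      ultimately have "\<phi> y \<in> \<phi> ` ball \<alpha> (\<rho> / 2)" using \<epsilon>(2)[of "\<phi> x"] by (auto simp: dist_commute)
      then show False using y injp by (auto dest: injD)
    qed
    have CI: "\<phi> x \<notin> C" if x: "x \<in> ?I" for x
    proof
      assume "\<phi> x \<in> C"
      then have "infdist (\<phi> x) J \<ge> \<delta>0" using C(5) far[OF x y1(1)] far[OF x y2(1)] by blast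
      moreover have "x \<in> ball \<alpha> \<delta>1" using x I\<delta> \<delta>(2) by force
      then have "dist (\<phi> x) (\<phi> \<alpha>) < \<delta>0" using \<delta>1(2) by (auto simp: dist_commute)
      moreover have "infdist (\<phi> x) J \<le> dist (\<phi> x) (\<phi> \<alpha>)" using \<alpha> by (rule infdist_le)
      ultimately show False by linarith
    qed
    have "connected (\<phi> -` C)" using C(1,2) J(3) by (intro connected_vimage) auto
    moreover have "\<phi> -` C \<subseteq> - (G \<union> ?I)" using C(2) CI unfolding G_def by blast
    ultimately have "connected_component (- (G \<union> ?I)) y1 y2"
      unfolding connected_component_def using C(3,4) by blast
    then have "connected_component (- (G \<union> ?I)) p1 p2"
      using y1(2) y2(2) by (meson connected_component_sym connected_component_trans)
    then obtain T where T: "connected T" "T \<subseteq> - (G \<union> ?I)" "p1 \<in> T" "p2 \<in> T"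
      unfolding connected_component_def by blast
    then have "T \<subseteq> U - ?I" using inU[OF T(1,2)] p(1) by blast
    then show False using p(3) T unfolding connected_component_def by blast
  qed
  then show ?thesis using \<delta>(1) unfolding G_def D_def by (intro exI[of _ \<delta>]) auto
qed

end

section \<open>Injectivity on Fatou components\<close>

text \<open>Take disjoint balls of injectivity about the finitely many preimages of
  \<open>w\<close>. By properness the rest of the preimage of a closed disc is compact, so a smaller
  disc about \<open>w\<close> avoids its image and is evenly covered.\<close>

lemma covering_space_proper_local_homeomorphism:
  fixes F :: "complex \<Rightarrow> complex"
  assumes V: "open V" and cF: "continuous_on V F" and oF: "\<And>U. open U \<Longrightarrow> U \<subseteq> V \<Longrightarrow> open (F ` U)"
    and li: "\<And>z. z \<in> V \<Longrightarrow> \<exists>s>0. ball z s \<subseteq> V \<and> inj_on F (ball z s)"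
    and fib: "\<And>w. finite (V \<inter> F -` {w})"
    and proper: "\<And>K. compact K \<Longrightarrow> K \<subseteq> F ` V \<Longrightarrow> compact (V \<inter> F -` K)"
  shows "covering_space V F (F ` V)"
proof
  fix w assume w: "w \<in> F ` V"
  define \<Phi> where "\<Phi> = V \<inter> F -` {w}"
  have fin: "finite \<Phi>" unfolding \<Phi>_def by (rule fib)
  \<comment> \<open>The factor 2 makes the balls about different preimages disjoint.\<close>
  have "\<exists>s>0. \<forall>z\<in>\<Phi>. (ball z s \<subseteq> V \<and> inj_on F (ball z s)) \<and> (\<forall>z'\<in>\<Phi>. z' \<noteq> z \<longrightarrow> 2 * s \<le> dist z z')"
  proof (rule finite_uniform_pos[OF fin])
    fix z assume z: "z \<in> \<Phi>"
    then obtain s where s: "s > 0" "ball z s \<subseteq> V" "inj_on F (ball z s)" using li unfolding \<Phi>_def by blast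
    have "\<exists>t>0. \<forall>z'\<in>\<Phi>. z' \<noteq> z \<longrightarrow> 2 * t \<le> dist z z'"
    proof (rule finite_uniform_pos[OF fin])
      fix z' assume "z' \<in> \<Phi>"
      show "\<exists>t>0. z' \<noteq> z \<longrightarrow> 2 * t \<le> dist z z'"
        by (cases "z' = z") (auto intro: exI[of _ 1] exI[of _ "dist z z' / 2"])
    qed auto
    then obtain t where t: "t > 0" "\<forall>z'\<in>\<Phi>. z' \<noteq> z \<longrightarrow> 2 * t \<le> dist z z'" by blast
    have b: "ball z (min s t) \<subseteq> ball z s" by auto
    then have "inj_on F (ball z (min s t))" using s(3) inj_on_subset by blast
    moreover have "\<forall>z'\<in>\<Phi>. z' \<noteq> z \<longrightarrow> 2 * min s t \<le> dist z z'" using t(2) by fastforce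
    ultimately show "\<exists>s>0. (ball z s \<subseteq> V \<and> inj_on F (ball z s)) \<and> (\<forall>z'\<in>\<Phi>. z' \<noteq> z \<longrightarrow> 2 * s \<le> dist z z')"
      using s(1,2) t(1) b by (intro exI[of _ "min s t"]) auto
  next
    fix z and s s' :: real
    assume a: "(ball z s \<subseteq> V \<and> inj_on F (ball z s)) \<and> (\<forall>z'\<in>\<Phi>. z' \<noteq> z \<longrightarrow> 2 * s \<le> dist z z')" "0 < s'" "s' \<le> s"
    have b: "ball z s' \<subseteq> ball z s" using a(3) by auto
    then have "inj_on F (ball z s')" using a(1) inj_on_subset by blast
    then show "(ball z s' \<subseteq> V \<and> inj_on F (ball z s')) \<and> (\<forall>z'\<in>\<Phi>. z' \<noteq> z \<longrightarrow> 2 * s' \<le> dist z z')"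
      using a b by fastforce
  qed
  then obtain s where s: "s > 0" "\<And>z. z \<in> \<Phi> \<Longrightarrow> ball z s \<subseteq> V" "\<And>z. z \<in> \<Phi> \<Longrightarrow> inj_on F (ball z s)"
    "\<And>z z'. z \<in> \<Phi> \<Longrightarrow> z' \<in> \<Phi> \<Longrightarrow> z' \<noteq> z \<Longrightarrow> 2 * s \<le> dist z z'" by blast
  define N where "N = (\<Union>z\<in>\<Phi>. ball z s)"
  have oN: "open N" unfolding N_def by blast
  have "open (F ` V)" using oF[OF V] by blast
  then obtain e where e: "e > 0" "cball w e \<subseteq> F ` V" using w open_contains_cball by blast
  define K where "K = V \<inter> F -` cball w e - N"
  have "compact (V \<inter> F -` cball w e)" by (rule proper[OF compact_cball e(2)])
  then have cK: "compact K" unfolding K_def using oN by (rule compact_diff)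
  have "K \<subseteq> V" unfolding K_def by blast
  then have "compact (F ` K)" using cK cF continuous_on_subset compact_continuous_image by blast
  then have "open (- F ` K)" by (simp add: compact_imp_closed open_Compl)
  moreover have "open (\<Inter>z\<in>\<Phi>. F ` ball z s)" using fin s(2) oF by (intro open_INT) auto
  ultimately have "open (ball w e \<inter> (- F ` K) \<inter> (\<Inter>z\<in>\<Phi>. F ` ball z s))" (is "open ?O")
    by (intro open_Int) auto
  moreover have "w \<in> ?O"
  proof -
    have "w \<notin> F ` K"
    proof
      assume "w \<in> F ` K"
      then obtain z where z: "z \<in> K" "F z = w" by blast
      then have "z \<in> \<Phi>" unfolding K_def \<Phi>_def by blast
      then have "z \<in> N" unfolding N_def using s(1) by force
      then show False using z(1) unfolding K_def by blast
    qed
    moreover have "w \<in> F ` ball z s" if "z \<in> \<Phi>" for z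
      using that s(1) unfolding \<Phi>_def by force
    ultimately show ?thesis using e(1) by simp
  qed
  ultimately obtain t where t: "t > 0" "ball w t \<subseteq> ball w e \<inter> (- F ` K) \<inter> (\<Inter>z\<in>\<Phi>. F ` ball z s)"
    by (rule openE)
  define T where "T = ball w t"
  define S where "S z = ball z s \<inter> F -` T" for z
  have oS: "open (S z)" if "z \<in> \<Phi>" for z
  proof -
    have "continuous_on (ball z s) F" using cF s(2)[OF that] continuous_on_subset by blast
    then have "open (F -` T \<inter> ball z s)" unfolding T_def by (subst (asm) continuous_on_open_vimage) auto
    then show ?thesis unfolding S_def by (simp add: Int_commute)
  qed
  have union: "\<Union>(S ` \<Phi>) = V \<inter> F -` T"
  proof (intro subset_antisym subsetI)
    fix x assume "x \<in> \<Union>(S ` \<Phi>)"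
    then show "x \<in> V \<inter> F -` T" unfolding S_def using s(2) by blast
  next
    fix x assume x: "x \<in> V \<inter> F -` T"
    then have "F x \<in> ball w e" "F x \<notin> F ` K" using t(2) unfolding T_def by blast+
    then have "x \<in> N" using x unfolding K_def by auto
    then show "x \<in> \<Union>(S ` \<Phi>)" using x unfolding N_def S_def by blast
  qed
  have disj: "pairwise disjnt (S ` \<Phi>)"
  proof (rule pairwise_imageI)
    fix z z' assume z: "z \<in> \<Phi>" "z' \<in> \<Phi>" "z \<noteq> z'"
    have "False" if "x \<in> ball z s" "x \<in> ball z' s" for x
      using that s(4)[OF z(1,2)] z(3) dist_triangle2[of z z' x] by (auto simp: dist_commute)
    then show "disjnt (S z) (S z')" unfolding disjnt_def S_def by blast
  qed
  have homeo: "\<exists>g. homeomorphism (S z) T F g" if z: "z \<in> \<Phi>" for z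
  proof -
    have SV: "S z \<subseteq> V" using s(2)[OF z] unfolding S_def by blast
    have c: "continuous_on (S z) F" using cF SV continuous_on_subset by blast
    have im: "F ` S z = T"
    proof (intro subset_antisym subsetI)
      fix y assume "y \<in> T"
      then have "y \<in> F ` ball z s" using t(2) z unfolding T_def by blast
      then show "y \<in> F ` S z" using \<open>y \<in> T\<close> unfolding S_def by blast
    qed (auto simp: S_def)
    have inj: "inj_on F (S z)" using s(3)[OF z] unfolding S_def by (rule inj_on_subset) blast
    have "openin (top_of_set T) (F ` U)" if "openin (top_of_set (S z)) U" for U
    proof -
      have "open U" "U \<subseteq> S z" using that oS[OF z] openin_open_eq by auto
      then show ?thesis using oF[of U] SV im by (intro open_subset) auto
    qed
    then show ?thesis using homeomorphism_injective_open_map[OF c im inj] by blast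
  qed
  have "T \<subseteq> F ` V" using t(2) e(2) ball_subset_cball[of w e] unfolding T_def by blast
  then have "openin (top_of_set (F ` V)) T" unfolding T_def by (intro open_subset) auto
  moreover have "w \<in> T" using t(1) unfolding T_def by simp
  moreover have "\<forall>u\<in>S ` \<Phi>. openin (top_of_set V) u"
    using oS s(2) unfolding S_def by (auto intro!: open_subset)
  ultimately show "\<exists>T. w \<in> T \<and> openin (top_of_set (F ` V)) T \<and>
      (\<exists>v. \<Union>v = V \<inter> F -` T \<and> (\<forall>u\<in>v. openin (top_of_set V) u) \<and> pairwise disjnt v \<and>
        (\<forall>u\<in>v. \<exists>q. homeomorphism u T F q))"
    using union disj homeo by (intro exI[of _ T] conjI exI[of _ "S ` \<Phi>"]) auto
qed (use cF in auto)

text \<open>The identity of \<open>W\<close> lifts to a section \<open>g\<close>. Following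
  \<open>F\<close> by \<open>g\<close> gives a lift of \<open>F\<close> that agrees with the
  identity at \<open>a\<close>, hence on the connected set \<open>V\<close>.\<close>

lemma covering_space_simply_connected_inj:
  fixes F :: "complex \<Rightarrow> complex"
  assumes cov: "covering_space V F W" and V: "connected V" and W: "simply_connected W" "open W"
  shows "inj_on F V"
proof -
  have "locally path_connected W" using W(2) by (rule open_imp_locally_path_connected)
  then obtain g where g: "continuous_on W g" "g \<in> W \<rightarrow> V" "\<And>y. y \<in> W \<Longrightarrow> F (g y) = y"
    using covering_space_lift[OF cov W(1), of "\<lambda>x. x"] by auto
  have FV: "F ` V = W" "continuous_on V F"
    using cov covering_space_imp_surjective covering_space_imp_continuous by auto
  show ?thesis
  proof (cases "V = {}")
    case False
    then obtain v where v: "v \<in> V" by blast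
    define a where "a = g (F v)"
    have a: "a \<in> V" "F a \<in> W" "g (F a) = a" using g FV v unfolding a_def by auto
    have "g (F x) = x" if "x \<in> V" for x
    proof (rule covering_space_lift_unique[OF cov, of "\<lambda>x. g (F x)" a "\<lambda>x. x" V F])
      show "continuous_on V (\<lambda>x. g (F x))"
        by (rule continuous_on_compose2[OF g(1) FV(2)]) (use FV in auto)
      show "F x = F (g (F x))" if "x \<in> V" for x using g(3)[of "F x"] FV(1) that by auto
    qed (use a V FV g(2) that in auto)
    then show ?thesis by (metis inj_onI)
  qed simp
qed

section \<open>Charts omitting a given point\<close>

lemma sphere_chart_Fin: "sphere_chart Fin Infty"
  by standard (auto simp: continuous_on_Fin open_image_Fin inj_def Compl_Infty)

lemma sphere_chart_exists: "\<exists>\<phi>. sphere_chart \<phi> c"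
proof (cases c)
  case Infty
  then show ?thesis using sphere_chart_Fin by blast
next
  case (Fin c0)
  \<comment> \<open>The Moebius map \<open>1 / z + c0\<close>, which sends 0 to infinity and misses
    only \<open>c0\<close>.\<close>
  let ?p = "[:1, c0:]" and ?q = "[:0, 1:]"
  have nz: "poly ?p z \<noteq> 0 \<or> poly ?q z \<noteq> 0" for z by auto
  have val: "ratio ?p ?q z = (if z = 0 then Infty else Fin (1 / z + c0))" for z
    by (auto simp: ratio_def add_divide_distrib)
  have "sphere_chart (ratio ?p ?q) c"
  proof
    show "continuous_on A (ratio ?p ?q)" for A using nz by (rule continuous_on_ratio)
    show "open (ratio ?p ?q ` U)" if "open U" for U
      using that by (intro open_image_ratio nz) auto
    show "inj (ratio ?p ?q)" by (rule injI) (auto simp: val split: if_splits)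
    show "range (ratio ?p ?q) = - {c}"
    proof (intro subset_antisym subsetI)
      fix x assume "x \<in> - {c}"
      show "x \<in> range (ratio ?p ?q)"
      proof (cases x)
        case (Fin w)
        then have "w - c0 \<noteq> 0" using \<open>x \<in> - {c}\<close> \<open>c = Fin c0\<close> by auto
        then have "ratio ?p ?q (1 / (w - c0)) = x" using Fin by (simp add: val)
        then show ?thesis by (metis rangeI)
      next
        case Infty
        then have "ratio ?p ?q 0 = x" by (simp add: val)
        then show ?thesis by (metis rangeI)
      qed
    qed (auto simp: val Fin split: if_splits)
  qed
  then show ?thesis by blast
qed

context rational
begin

text \<open>The numerator of the derivative of \<open>p / q\<close>; off the poles its zeros are the
  finite critical points.\<close>

definition "wronskian = pderiv p * q - p * pderiv q"

text \<open>At a root of \<open>q\<close>, which is not a root of \<open>p\<close>, the product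
  \<open>p * pderiv q\<close> has smaller order than \<open>pderiv p * q\<close>. So equality leaves
  only constant \<open>q\<close>, and then constant \<open>p\<close>.\<close>

lemma wronskian_nonzero: "wronskian \<noteq> 0"
proof
  assume "wronskian = 0"
  then have eq: "pderiv p * q = p * pderiv q" by (simp add: wronskian_def)
  have "degree q = 0"
  proof (rule ccontr)
    assume dq: "degree q \<noteq> 0"
    then have "\<not> constant (poly q)" by (subst constant_degree)
    then obtain z where z: "poly q z = 0" using fundamental_theorem_of_algebra by blast
    then have pz: "poly p z \<noteq> 0" using no_common_root by blast
    have q': "pderiv q \<noteq> 0" using dq by (subst pderiv_eq_0_iff)
    have p0: "p \<noteq> 0" using pz by auto
    then have ne: "p * pderiv q \<noteq> 0" using q' by simp
    have "order z q = Suc (order z (pderiv q))" using q0 z by (rule order_pderiv)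
    moreover have "order z (pderiv p * q) = order z (p * pderiv q)" by (simp only: eq)
    moreover have "order z (pderiv p * q) = order z (pderiv p) + order z q"
      using ne eq by (intro order_mult) simp
    moreover have "order z (p * pderiv q) = order z p + order z (pderiv q)" using ne by (rule order_mult)
    moreover have "order z p = 0" using pz by (simp add: order_root)
    ultimately show False by simp
  qed
  then have "pderiv q = 0" by (simp add: pderiv_eq_0_iff)
  then have "pderiv p = 0" using eq q0 by simp
  then have "degree p = 0" by (simp add: pderiv_eq_0_iff)
  then show False using deg \<open>degree q = 0\<close> by simp
qed

text \<open>A component that avoids the finite set \<open>bad\<close> is mapped as a covering onto a
  simply connected component, hence injectively. Poles and infinity count as bad so that both
  components lie in the plane.\<close>

lemma finite_noninjective_components:
  assumes J: "closed J" "connected J" "\<And>x. f x \<in> J \<longleftrightarrow> x \<in> J"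
    and im: "\<And>U. U \<in> components (- J) \<Longrightarrow> f ` U \<in> components (- J)"
  shows "finite {U \<in> components (- J). \<not> inj_on f U}"
proof -
  define bad where "bad = insert Infty (Fin ` ({z. poly wronskian z = 0} \<union> {z. poly q z = 0}))"
  have "finite bad" unfolding bad_def using poly_roots_finite wronskian_nonzero q0 by blast
  have inj: "inj_on f U" if U: "U \<in> components (- J)" and b: "U \<inter> bad = {}" for U
  proof -
    define V where "V = Fin -` U"
    define F where "F z = poly p z / poly q z" for z
    define W where "W = Fin -` (f ` U)"
    have UJ: "U \<subseteq> - J" "connected U" "open U"
      using in_components_subset[OF U] in_components_connected[OF U] open_components_csphere[OF _ U] J(1) by auto
    have nI: "Infty \<notin> U" using b unfolding bad_def by blast
    have UV: "U = Fin ` V"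
    proof -
      have "U \<subseteq> range Fin" using nI unfolding Compl_Infty[symmetric] by blast
      then show ?thesis unfolding V_def by blast
    qed
    have zV: "poly q z \<noteq> 0" "poly wronskian z \<noteq> 0" if "z \<in> V" for z
      using that b unfolding V_def bad_def by auto
    have fF: "f (Fin z) = Fin (F z)" if "z \<in> V" for z
      using zV(1)[OF that] by (simp add: f_Fin ratio_def F_def)
    have W: "W = F ` V"
    proof -
      have "f ` U = Fin ` F ` V" unfolding UV image_image using fF by (intro image_cong) auto
      then show ?thesis unfolding W_def by auto
    qed
    have fUW: "f ` U = Fin ` W" unfolding UV W image_image using fF by (intro image_cong) auto
    have oV: "open V" unfolding V_def by (rule open_vimage_Fin[OF UJ(3)])
    interpret sphere_chart Fin Infty by (rule sphere_chart_Fin)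
    have cV: "connected V" unfolding V_def using UJ(2) nI by (intro connected_vimage) auto
    have fU: "f ` U \<in> components (- J)" by (rule im[OF U])
    have fUc: "open (f ` U)" "connected (f ` U)"
      using open_components_csphere[OF _ fU] in_components_connected[OF fU] J(1) by auto
    have oW: "open W" unfolding W_def by (rule open_vimage_Fin[OF fUc(1)])
    have cW: "connected W" unfolding W_def using fUc(2) fUW by (intro connected_vimage) auto
    have "connected (UNIV - f ` U)"
      using component_diff_connected[OF J(2) connected_UNIV_csphere] fU by (simp add: Compl_eq_Diff_UNIV)
    then have scW: "simply_connected W"
      using fUW by (intro simply_connected_chart oW cW) (simp add: Compl_eq_Diff_UNIV)
    have hol: "F holomorphic_on V" unfolding F_def using zV(1) by (intro holomorphic_intros) auto
    have dF: "deriv F z \<noteq> 0" if z: "z \<in> V" for z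
    proof -
      have "(F has_field_derivative (poly (pderiv p) z * poly q z - poly p z * poly (pderiv q) z) / (poly q z * poly q z)) (at z)"
        unfolding F_def using zV(1)[OF z] by (intro DERIV_divide poly_DERIV) 
      then have "deriv F z = poly wronskian z / (poly q z * poly q z)"
        by (simp add: DERIV_imp_deriv wronskian_def)
      then show ?thesis using zV[OF z] by simp
    qed
    have "covering_space V F (F ` V)"
    proof (rule covering_space_proper_local_homeomorphism[OF oV holomorphic_on_imp_continuous_on[OF hol]])
      fix A assume A: "open A" "A \<subseteq> V"
      have "open (Fin -` (f ` (Fin ` A)))" by (intro open_vimage_Fin open_image_f open_image_Fin A)
      moreover have "f ` (Fin ` A) = Fin ` F ` A" unfolding image_image using A(2) fF by (intro image_cong) auto
      ultimately show "open (F ` A)" by (simp add: inj_vimage_image_eq inj_def)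
    next
      fix z assume "z \<in> V"
      then show "\<exists>s>0. ball z s \<subseteq> V \<and> inj_on F (ball z s)"
        using has_complex_derivative_locally_injective[OF hol _ oV dF] by metis
    next
      fix w
      have "V \<inter> F -` {w} \<subseteq> fin_part ` (f -` {Fin w})"
      proof
        fix z assume "z \<in> V \<inter> F -` {w}"
        then have "Fin z \<in> f -` {Fin w}" using fF by auto
        then show "z \<in> fin_part ` (f -` {Fin w})" by (metis fin_part_Fin imageI)
      qed
      then show "finite (V \<inter> F -` {w})" using finite_fibre finite_subset by blast
    next
      fix K assume K: "compact K" "K \<subseteq> F ` V"
      \<comment> \<open>Properness: \<open>U\<close> is relatively closed in the Fatou set, which
        contains the full preimage of the compact subset \<open>K\<close>.\<close>
      have "closedin (top_of_set (- J)) U" using U by (rule closedin_component)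
      then obtain S where S: "closed S" "U = - J \<inter> S" unfolding closedin_closed by blast
      have "Fin ` K \<subseteq> Fin ` W" unfolding W using K(2) by (rule image_mono)
      also have "\<dots> \<subseteq> - J" unfolding fUW[symmetric] by (rule in_components_subset[OF fU])
      finally have FK: "Fin ` K \<subseteq> - J" .
      have "closed (Fin ` K)" by (intro compact_imp_closed compact_continuous_image continuous_on_Fin K(1))
      then have "closed (S \<inter> f -` (Fin ` K))" by (intro closed_Int S(1) closed_vimage continuous_f)
      moreover have eq: "S \<inter> f -` (Fin ` K) = U \<inter> f -` (Fin ` K)" using S(2) FK J(3) by blast
      ultimately have "compact (U \<inter> f -` (Fin ` K))" by (simp add: compact_csphere_iff)
      moreover have "continuous_on (U \<inter> f -` (Fin ` K)) fin_part"
        using continuous_on_fin_part by (rule continuous_on_subset) (use nI in blast)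
      ultimately have "compact (fin_part ` (U \<inter> f -` (Fin ` K)))" by (rule compact_continuous_image[rotated])
      moreover have "fin_part ` (U \<inter> f -` (Fin ` K)) = V \<inter> F -` K"
      proof (intro subset_antisym subsetI)
        fix z assume "z \<in> fin_part ` (U \<inter> f -` (Fin ` K))"
        then obtain x where x: "x \<in> U" "f x \<in> Fin ` K" "z = fin_part x" by blast
        then obtain v where v: "v \<in> V" "x = Fin v" using UV by blast
        then show "z \<in> V \<inter> F -` K" using x fF[OF v(1)] by auto
      next
        fix z assume z: "z \<in> V \<inter> F -` K"
        then have "Fin z \<in> U \<inter> f -` (Fin ` K)" using fF UV by auto
        then show "z \<in> fin_part ` (U \<inter> f -` (Fin ` K))" by (metis fin_part_Fin imageI)
      qed
      ultimately show "compact (V \<inter> F -` K)" by simp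
    qed
    then have "inj_on F V"
      using covering_space_simply_connected_inj[OF _ cV] scW oW W by simp
    then show "inj_on f U" unfolding UV using fF by (auto simp: inj_on_def)
  qed
  have "{U \<in> components (- J). \<not> inj_on f U} \<subseteq> connected_component_set (- J) ` bad"
  proof
    fix U assume "U \<in> {U \<in> components (- J). \<not> inj_on f U}"
    then have U: "U \<in> components (- J)" "U \<inter> bad \<noteq> {}" using inj by blast+
    then obtain x where x: "x \<in> U" "x \<in> bad" by blast
    have "U = connected_component_set (- J) x" using U(1) x(1) by (metis components_iff connected_component_eq)
    then show "U \<in> connected_component_set (- J) ` bad" using x(2) by blast
  qed
  then show ?thesis using \<open>finite bad\<close> finite_subset by blast
qed

end

section \<open>Local connectedness\<close>

text \<open>A small disc about the fixed point is mapped into itself, so it lies in a single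
  component of every pullback, and the diameters stay bounded below. The chart \<psi> covers finite
  points and infinity alike.\<close>

lemma superattracting_not_sum_shrink:
  fixes f :: "csphere \<Rightarrow> csphere" and \<psi> :: "complex \<Rightarrow> csphere"
  assumes cont: "continuous_on UNIV \<psi>" and inj: "inj \<psi>" and J: "\<psi> c \<in> julia_set f" and e: "e > 0"
    and g: "\<And>z. z \<in> ball c e \<Longrightarrow> f (\<psi> z) = \<psi> (g z) \<and> cmod (g z - c) \<le> B * (cmod (z - c))\<^sup>2"
  shows "\<not> sum_shrink f"
proof
  assume "sum_shrink f"
  then obtain r \<omega> where r: "r > 0" and \<omega>: "summable (\<lambda>n. \<omega> (Suc n))"
    and W: "\<forall>z\<in>julia_set f. \<forall>n>0. \<forall>W\<in>components ((f ^^ n) -` ball z r). diameter W < \<omega> n"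
    unfolding sum_shrink_def by (elim exE conjE) (rule that)
  have "open (\<psi> -` ball (\<psi> c) r)" by (intro open_vimage cont) auto
  moreover have "c \<in> \<psi> -` ball (\<psi> c) r" using r by simp
  ultimately obtain e1 where e1: "e1 > 0" "ball c e1 \<subseteq> \<psi> -` ball (\<psi> c) r" by (rule openE)
  define B' where "B' = max B 1"
  \<comment> \<open>With \<open>s \<le> 1 / B'\<close> the quadratic bound does not increase the
    distance to \<open>c\<close>; the maximum in \<open>B'\<close> only makes it positive.\<close>
  define s where "s = min (min e e1) (1 / B')"
  have s: "s > 0" "s \<le> e" "s \<le> e1" "B' * s \<le> 1"
  proof -
    show "s > 0" using e e1(1) by (simp add: s_def B'_def)
    show "s \<le> e" "s \<le> e1" by (simp_all add: s_def)
    have "B' > 0" by (simp add: B'_def)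
    moreover have "s \<le> 1 / B'" by (simp add: s_def)
    ultimately show "B' * s \<le> 1" by (simp add: field_simps)
  qed
  have inv: "f (\<psi> z) \<in> \<psi> ` ball c s" if z: "z \<in> ball c s" for z
  proof -
    have zs: "cmod (z - c) < s" using z by (simp add: dist_norm norm_minus_commute)
    have ze: "z \<in> ball c e" using z s(2) by auto
    have "cmod (g z - c) \<le> B * (cmod (z - c))\<^sup>2" using g[OF ze] by simp
    also have "\<dots> \<le> B' * (cmod (z - c))\<^sup>2" by (intro mult_right_mono) (auto simp: B'_def)
    also have "\<dots> = (B' * cmod (z - c)) * cmod (z - c)" by (simp add: power2_eq_square)
    also have "\<dots> \<le> 1 * cmod (z - c)"
    proof (rule mult_right_mono)
      have "B' * cmod (z - c) \<le> B' * s" using zs by (intro mult_left_mono) (auto simp: B'_def)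
      then show "B' * cmod (z - c) \<le> 1" using s(4) by linarith
    qed simp
    finally have "g z \<in> ball c s" using zs by (simp add: dist_norm norm_minus_commute)
    then show ?thesis using g[OF ze] by simp
  qed
  let ?C = "\<psi> ` ball c s"
  have invn: "(f ^^ n) x \<in> ?C" if "x \<in> ?C" for n x
    using that by (induction n) (auto dest: inv)
  have "ball c s \<subseteq> ball c e1" using s(3) by auto
  then have Cr: "?C \<subseteq> ball (\<psi> c) r" using e1(2) by blast
  define w where "w = c + of_real (s / 2)"
  have w: "w \<in> ball c s" "w \<noteq> c" using s(1) by (auto simp: w_def dist_norm)
  have c: "c \<in> ball c s" using s(1) by simp
  define \<eta> where "\<eta> = dist (\<psi> c) (\<psi> w)"
  have \<eta>: "\<eta> > 0" unfolding \<eta>_def using w(2) inj by (auto dest: injD)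
  have "\<eta> < \<omega> n" if n: "n > 0" for n
  proof -
    have sub: "?C \<subseteq> (f ^^ n) -` ball (\<psi> c) r" using invn Cr by blast
    have "\<psi> c \<in> (f ^^ n) -` ball (\<psi> c) r" using sub c by blast
    then obtain V where V: "V \<in> components ((f ^^ n) -` ball (\<psi> c) r)" "\<psi> c \<in> V" by (rule component_obtains)
    have "continuous_on (ball c s) \<psi>" using cont by (rule continuous_on_subset) simp
    then have "connected ?C" by (rule connected_continuous_image[OF _ connected_ball])
    then have "\<psi> w \<in> V" using connected_subset_component_eq[OF _ sub _ _ V] c w(1) by blast
    then have "\<eta> \<le> diameter V" unfolding \<eta>_def
      by (intro diameter_bounded_bound bounded_csphere V(2))
    also have "\<dots> < \<omega> n" using W J n V(1) by blast
    finally show ?thesis .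
  qed
  then have "\<eta> \<le> \<omega> (Suc n)" for n by (simp add: less_imp_le)
  moreover have "(\<lambda>n. \<omega> (Suc n)) \<longlonglongrightarrow> 0" using \<omega> by (rule summable_LIMSEQ_zero)
  ultimately have "\<eta> \<le> 0" by (intro LIMSEQ_le_const) auto
  then show False using \<eta> by simp
qed

lemma square_factor_bound:
  fixes R Q :: "complex poly"
  assumes "R = [:- c, 1:] ^ 2 * S" "poly Q c \<noteq> 0"
  obtains e B where "e > 0" "\<And>z. z \<in> ball c e \<Longrightarrow> poly Q z \<noteq> 0"
    "\<And>z. z \<in> ball c e \<Longrightarrow> cmod (poly R z / poly Q z) \<le> B * (cmod (z - c))\<^sup>2"
proof -
  define B where "B = cmod (poly S c / poly Q c) + 1"
  have "isCont (\<lambda>z. poly S z / poly Q z) c" using assms(2) by (intro continuous_intros) auto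
  then have lim: "((\<lambda>z. cmod (poly S z / poly Q z)) \<longlongrightarrow> cmod (poly S c / poly Q c)) (nhds c)"
    unfolding continuous_at_imp_continuous_at_within tendsto_nhds_iff by (intro conjI tendsto_norm) (auto simp: isCont_def)
  have "\<forall>\<^sub>F z in nhds c. cmod (poly S z / poly Q z) < B"
    using order_tendstoD(2)[OF lim] by (simp add: B_def)
  moreover have "\<forall>\<^sub>F z in nhds c. poly Q z \<noteq> 0"
    using assms(2) open_poly_nonzero[of Q] unfolding eventually_nhds by (intro exI[of _ "{z. poly Q z \<noteq> 0}"]) auto
  ultimately have "\<forall>\<^sub>F z in nhds c. cmod (poly S z / poly Q z) < B \<and> poly Q z \<noteq> 0" by eventually_elim simp
  then obtain e where e: "e > 0" "\<And>z. dist z c < e \<Longrightarrow> cmod (poly S z / poly Q z) < B \<and> poly Q z \<noteq> 0"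
    unfolding eventually_nhds_metric by blast
  have "cmod (poly R z / poly Q z) \<le> B * (cmod (z - c))\<^sup>2" if "z \<in> ball c e" for z
  proof -
    have eq: "poly R z / poly Q z = (z - c)\<^sup>2 * (poly S z / poly Q z)"
      by (simp add: assms(1))
    have "cmod (poly R z / poly Q z) = (cmod (z - c))\<^sup>2 * cmod (poly S z / poly Q z)"
      unfolding eq by (simp only: norm_mult norm_power)
    also have "\<dots> \<le> (cmod (z - c))\<^sup>2 * B"
      using e(2)[of z] that by (intro mult_left_mono) (auto simp: dist_commute)
    finally show ?thesis by (simp add: mult.commute)
  qed
  then show ?thesis using e by (intro that[of e B]) (auto simp: dist_commute)
qed

text \<open>Once all factors at \<open>c\<close> are split off, the cofactor has no root and is
  constant, so the multiplicity of \<open>c\<close> is the degree.\<close>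

lemma single_root_factor:
  fixes R :: "complex poly"
  assumes "degree R \<ge> 2" "\<And>z. poly R z = 0 \<Longrightarrow> z = c"
  obtains S where "R = [:- c, 1:] ^ 2 * S"
proof -
  have R0: "R \<noteq> 0" using assms(1) by auto
  obtain S where S: "R = [:- c, 1:] ^ order c R * S" "\<not> [:- c, 1:] dvd S"
    using order_decomp[OF R0] by blast
  have "S \<noteq> 0" using S(1) R0 by auto
  have "poly S z \<noteq> 0" for z
  proof
    assume "poly S z = 0"
    then have "poly R z = 0" by (subst S(1)) simp
    then have "z = c" by (rule assms(2))
    then show False using S(2) \<open>poly S z = 0\<close> by (simp add: poly_eq_0_iff_dvd)
  qed
  then have "constant (poly S)" using fundamental_theorem_of_algebra by blast
  then have "degree S = 0" by (simp only: constant_degree)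
  moreover have "degree R = degree ([:- c, 1:] ^ order c R) + degree S"
    by (subst S(1), rule degree_mult_eq) (use \<open>S \<noteq> 0\<close> in auto)
  moreover have "degree ([:- c, 1:] ^ order c R) = order c R" by (rule degree_linear_power)
  ultimately have "order c R \<ge> 2" using assms(1) by simp
  then obtain k where "order c R = 2 + k" using le_Suc_ex by blast
  then have "R = [:- c, 1:] ^ 2 * ([:- c, 1:] ^ k * S)"
    using S(1) by (simp only: power_add mult.assoc)
  then show ?thesis by (rule that)
qed

context rational
begin

text \<open>Local connectedness would fail for a singleton, as continua are nondegenerate. A one-point
  Julia set would be a superattracting fixed point, near which pullbacks do not shrink.\<close>

lemma julia_set_not_singleton:
  assumes d: "max (degree p) (degree q) \<ge> 2" and ss: "sum_shrink f"
  shows "julia_set f \<noteq> {a}"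
proof
  assume J: "julia_set f = {a}"
  have "f x \<in> julia_set f \<longleftrightarrow> x \<in> julia_set f" for x
    unfolding julia_set_def using fatou_set_invariant[OF continuous_f open_image_f] by simp
  then have fa: "f x = a \<longleftrightarrow> x = a" for x using J by simp
  show False
  proof (cases a)
    case (Fin c)
    \<comment> \<open>Its roots are the finite preimages of \<open>Fin c\<close>, and by invariance
      the only such preimage is \<open>Fin c\<close> itself.\<close>
    define R where "R = p - smult c q"
    have root: "z = c" if "poly R z = 0" for z
    proof -
      have "poly p z = c * poly q z" using that by (simp add: R_def)
      moreover from this have "poly q z \<noteq> 0" using no_common_root[of z] by auto
      ultimately have "f (Fin z) = a" by (simp add: f_Fin ratio_def Fin)
      then show "z = c" using fa Fin by simp
    qed
    have fI: "f Infty \<noteq> Fin c" using fa[of Infty] Fin by simp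
    \<comment> \<open>Infinity is not a preimage of \<open>Fin c\<close>, so no degree is lost in
      \<open>R\<close>.\<close>
    have "degree R \<ge> 2"
    proof (cases "degree q < degree p")
      case True
      then have "degree R = degree p"
        unfolding R_def using degree_add_eq_left[of "- smult c q" p] degree_smult_le[of c q] by (simp add: le_less_trans)
      then show ?thesis using d True by simp
    next
      case False
      then have "coeff p (degree q) / lead_coeff q \<noteq> c" using fI by (simp add: f_def rat_map_def)
      then have "coeff R (degree q) \<noteq> 0" using q0 by (auto simp: R_def divide_eq_eq)
      then have "degree q \<le> degree R" by (rule le_degree)
      then show ?thesis using d False by simp
    qed
    then obtain S where S: "R = [:- c, 1:] ^ 2 * S" using root by (rule single_root_factor)
    have "poly R c = 0" by (simp add: S)
    then have "poly p c = c * poly q c" by (simp add: R_def)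
    then have qc: "poly q c \<noteq> 0" using no_common_root[of c] by auto
    obtain e B where e: "e > 0" "\<And>z. z \<in> ball c e \<Longrightarrow> poly q z \<noteq> 0"
      "\<And>z. z \<in> ball c e \<Longrightarrow> cmod (poly R z / poly q z) \<le> B * (cmod (z - c))\<^sup>2"
      using square_factor_bound[OF S qc] by blast
    have "\<not> sum_shrink f"
    proof (rule superattracting_not_sum_shrink[where \<psi> = Fin and c = c and e = e and B = B])
      fix z assume z: "z \<in> ball c e"
      have "poly R z / poly q z = poly p z / poly q z - c"
        using e(2)[OF z] by (simp add: R_def diff_divide_distrib)
      then show "f (Fin z) = Fin (poly p z / poly q z) \<and> cmod (poly p z / poly q z - c) \<le> B * (cmod (z - c))\<^sup>2"
        using e(2,3)[OF z] by (simp add: f_Fin ratio_def)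
    qed (use e(1) J Fin in \<open>auto simp: continuous_on_Fin inj_def\<close>)
    then show False using ss by blast
  next
    case Infty
    have "poly q z \<noteq> 0" for z
    proof
      assume "poly q z = 0"
      then have "f (Fin z) = a" by (simp add: f_Fin ratio_def Infty)
      then show False using fa[of "Fin z"] Infty by simp
    qed
    then have "constant (poly q)" using fundamental_theorem_of_algebra by blast
    then have dq: "degree q = 0" by (simp only: constant_degree)
    then have dg: "dg = degree p" "degree p \<ge> 2" using d by (simp_all add: dg_def)
    \<comment> \<open>The map is a polynomial, as infinity has no finite preimage. In the coordinate
      1/z it becomes \<open>Q / P\<close>, whose numerator vanishes at 0 to order
      \<open>dg\<close>.\<close>
    define P where "P = reverse_poly dg p"
    define Q where "Q = reverse_poly dg q"
    have "Q = monom 1 dg * reflect_poly q" by (simp add: Q_def reverse_poly_def dq)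
    also have "monom (1 :: complex) dg = [:- 0, 1:] ^ dg" by (simp add: monom_altdef)
    finally have Q': "Q = [:- 0, 1:] ^ dg * reflect_poly q" .
    obtain k where "dg = 2 + k" using dg le_Suc_ex by metis
    then have Q: "Q = [:- 0, 1:] ^ 2 * ([:- 0, 1:] ^ k * reflect_poly q)"
      unfolding Q' by (simp only: power_add mult.assoc)
    have "poly P 0 = lead_coeff p" using poly_reverse_poly_0[of p dg] dg by (simp add: P_def)
    then have P: "poly P 0 \<noteq> 0" using dg(2) by auto
    obtain e B where e: "e > 0" "\<And>z. z \<in> ball 0 e \<Longrightarrow> poly P z \<noteq> 0"
      "\<And>z. z \<in> ball 0 e \<Longrightarrow> cmod (poly Q z / poly P z) \<le> B * (cmod (z - 0))\<^sup>2"
      using square_factor_bound[OF Q P] by blast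
    have "\<not> sum_shrink f"
    proof (rule superattracting_not_sum_shrink[where \<psi> = "\<lambda>z. inv_sphere (Fin z)" and c = 0 and e = e and B = B])
      show "continuous_on UNIV (\<lambda>z. inv_sphere (Fin z))"
        by (intro continuous_on_compose2[OF continuous_on_inv_sphere[of UNIV]] continuous_on_Fin) auto
      show "inj (\<lambda>z. inv_sphere (Fin z))"
      proof (rule injI)
        fix x y assume "inv_sphere (Fin x) = inv_sphere (Fin y)"
        then show "x = y" by (metis csphere.inject inv_sphere_inv_sphere)
      qed
      show "inv_sphere (Fin 0) \<in> julia_set f" using J Infty by (simp add: inv_sphere_def)
      fix z :: complex assume z: "z \<in> ball 0 e"
      have "ratio P Q z = inv_sphere (ratio Q P z)"
        using e(2)[OF z] by (subst inv_sphere_ratio) auto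
      also have "ratio Q P z = Fin (poly Q z / poly P z)" using e(2)[OF z] by (simp add: ratio_def)
      finally have "f (inv_sphere (Fin z)) = inv_sphere (Fin (poly Q z / poly P z))"
        unfolding f_inv_sphere P_def Q_def .
      then show "f (inv_sphere (Fin z)) = inv_sphere (Fin (poly Q z / poly P z)) \<and>
          cmod (poly Q z / poly P z - 0) \<le> B * (cmod (z - 0))\<^sup>2"
        using e(3)[OF z] by simp
    qed (rule e(1))
    then show False using ss by blast
  qed
qed

end

section \<open>From charts back to the sphere\<close>

lemma (in sphere_chart) small_continuum:
  assumes J: "closed J" "connected J" "c \<in> J" "a \<in> J" "a \<noteq> c"
    and near: "\<And>\<epsilon>. \<epsilon> > 0 \<Longrightarrow> \<exists>\<delta>>0. \<forall>U\<in>components (- J). \<forall>x\<in>U. \<forall>y\<in>U. \<exists>C. connected C \<and> C \<subseteq> - J \<and> x \<in> C \<and> y \<in> C \<and>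
      (\<forall>w\<in>C. infdist w J \<ge> \<delta> \<or> dist x w < \<epsilon> \<or> dist y w < \<epsilon>)"
    and \<tau>: "\<tau> > 0"
  shows "\<exists>e>0. \<forall>x\<in>J \<inter> ball a e. \<forall>y\<in>J \<inter> ball a e.
    \<exists>K. compact K \<and> connected K \<and> K \<subseteq> J \<and> x \<in> K \<and> y \<in> K \<and> diameter K < \<tau>"
proof -
  obtain \<alpha> where \<alpha>: "a = \<phi> \<alpha>" using J(5) rangep by blast
  \<comment> \<open>Radius \<open>\<tau> / 4\<close> bounds the diameter by
    \<open>\<tau> / 2\<close>, which keeps the inequality strict.\<close>
  have "open (\<phi> -` ball a (\<tau> / 4))" by (intro open_vimage contp) auto
  moreover have "\<alpha> \<in> \<phi> -` ball a (\<tau> / 4)" using \<tau> \<alpha> by simp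
  ultimately obtain \<rho> where \<rho>: "\<rho> > 0" "cball \<alpha> \<rho> \<subseteq> \<phi> -` ball a (\<tau> / 4)"
    using open_contains_cball by blast
  have "\<phi> \<alpha> \<in> J" using J(4) \<alpha> by simp
  then obtain \<delta> where \<delta>: "\<delta> > 0" "\<forall>a\<in>ball \<alpha> \<delta>. \<forall>b\<in>ball \<alpha> \<delta>. \<phi> a \<in> J \<longrightarrow> \<phi> b \<in> J \<longrightarrow>
      connected_component (\<phi> -` J \<inter> cball \<alpha> \<rho>) a b"
    using locally_connected_in_chart[OF J(1-3) near _ \<rho>(1)] by blast
  have "open (\<phi> ` ball \<alpha> \<delta>)" by (intro openp) simp
  moreover have "a \<in> \<phi> ` ball \<alpha> \<delta>" using \<alpha> \<delta>(1) by simp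
  ultimately obtain e where e: "e > 0" "ball a e \<subseteq> \<phi> ` ball \<alpha> \<delta>" by (rule openE)
  have "\<exists>K. compact K \<and> connected K \<and> K \<subseteq> J \<and> x \<in> K \<and> y \<in> K \<and> diameter K < \<tau>"
    if xy: "x \<in> J \<inter> ball a e" "y \<in> J \<inter> ball a e" for x y
  proof -
    obtain x' where x': "x' \<in> ball \<alpha> \<delta>" "x = \<phi> x'" using xy(1) e(2) by blast
    obtain y' where y': "y' \<in> ball \<alpha> \<delta>" "y = \<phi> y'" using xy(2) e(2) by blast
    let ?G = "\<phi> -` J \<inter> cball \<alpha> \<rho>"
    have cc: "connected_component ?G x' y'" using \<delta>(2) x' y' xy by blast
    define K where "K = \<phi> ` connected_component_set ?G x'"
    have "closed (\<phi> -` J)" by (intro closed_vimage J(1) contp)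
    then have cG: "compact ?G" by (simp add: closed_Int_compact)
    have xG: "x' \<in> ?G" using connected_component_in[OF cc] by blast
    have "connected_component_set ?G x' \<in> components ?G" using xG by (rule componentsI)
    then have "compact (connected_component_set ?G x')" by (rule compact_components[OF cG])
    then have "compact K" unfolding K_def by (intro compact_continuous_image contp)
    moreover have "connected K" unfolding K_def by (intro connected_continuous_image contp) simp
    moreover have sub: "connected_component_set ?G x' \<subseteq> ?G" by (rule connected_component_subset)
    then have "K \<subseteq> J" unfolding K_def by blast
    moreover have "x \<in> K" unfolding K_def x'(2) using xG by simp
    moreover have "y \<in> K" unfolding K_def y'(2) using cc by simp
    moreover have "diameter K < \<tau>"
    proof -
      have "diameter K \<le> \<tau> / 2"
      proof (rule diameter_le_csphere)
        fix u v assume "u \<in> K" "v \<in> K"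
        then have "u \<in> ball a (\<tau> / 4)" "v \<in> ball a (\<tau> / 4)" unfolding K_def using sub \<rho>(2) by blast+
        then show "dist u v \<le> \<tau> / 2" using dist_triangle3[of u v a] by simp
      qed (use \<tau> in simp)
      then show ?thesis using \<tau> by simp
    qed
    ultimately show ?thesis by blast
  qed
  then show ?thesis using e(1) by blast
qed

theorem theorem2:
  fixes f :: "csphere \<Rightarrow> csphere" and d :: nat
  assumes "rational_map_of_degree f d" and "d \<ge> 2"
    and "sum_shrink f"
    and "connected (julia_set f)"
  shows "loc_connected (julia_set f)"
proof (cases "julia_set f = {}")
  case True
  then show ?thesis by (auto simp: loc_connected_def intro: exI[of _ 1])
next
  case False
  let ?J = "julia_set f"
  obtain p q where pq: "q \<noteq> 0" "coprime p q" "f = rat_map p q" "d = max (degree p) (degree q)"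
    using assms(1) unfolding rational_map_of_degree_def by blast
  interpret rational p q f using pq assms(2) by unfold_locales auto
  have cJ: "closed ?J" by (rule closed_julia_set)
  have invJ: "f x \<in> ?J \<longleftrightarrow> x \<in> ?J" for x
    unfolding julia_set_def using fatou_set_invariant[OF continuous_f open_image_f] by simp
  from assms(3) obtain r \<omega> where r: "r > 0" and \<omega>: "\<forall>n\<ge>1. \<omega> n > 0" "summable (\<lambda>n. \<omega> (Suc n))"
    and W: "\<forall>z\<in>?J. \<forall>n>0. \<forall>W\<in>components ((f ^^ n) -` ball z r). diameter W < \<omega> n"
    unfolding sum_shrink_def by (elim exE conjE) (rule that)
  interpret shrinking f ?J r \<omega>
  proof
    show "\<omega> n > 0" if "n > 0" for n using \<omega>(1) that by simp
    show "diameter W < \<omega> n" if "z \<in> ?J" "n > 0" "W \<in> components ((f ^^ n) -` ball z r)" for z n W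
      using W that by blast
  qed (fact continuous_f open_image_f finite_fibre cJ invJ False r \<omega>(2))+
  have "f ` U \<in> components (- ?J)" if "U \<in> components (- ?J)" for U
    using image_component[OF that, of 1] by simp
  then have inj: "finite {U \<in> components (- ?J). \<not> inj_on f U}"
    by (rule finite_noninjective_components[OF cJ assms(4) invJ])
  have near: "\<exists>\<delta>>0. \<forall>U\<in>components (- ?J). \<forall>x\<in>U. \<forall>y\<in>U. \<exists>C. connected C \<and> C \<subseteq> - ?J \<and> x \<in> C \<and> y \<in> C \<and>
      (\<forall>w\<in>C. infdist w ?J \<ge> \<delta> \<or> dist x w < \<epsilon> \<or> dist y w < \<epsilon>)" if "\<epsilon> > 0" for \<epsilon>
    using deep_or_near_connection[OF inj that] unfolding depth_def .
  have nonsing: "?J \<noteq> {a}" for a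
    by (rule julia_set_not_singleton) (use pq(4) assms(2,3) in simp_all)
  show ?thesis unfolding loc_connected_def
  proof (intro conjI allI impI cJ)
    fix \<tau> :: real assume \<tau>: "\<tau> > 0"
    have "\<exists>e>0. \<forall>x\<in>?J \<inter> ball a e. \<forall>y\<in>?J \<inter> ball a e.
        \<exists>K. compact K \<and> connected K \<and> K \<subseteq> ?J \<and> x \<in> K \<and> y \<in> K \<and> diameter K < \<tau>" if a: "a \<in> ?J" for a
    proof -
      \<comment> \<open>A second point of \<open>J\<close> is omitted, so that \<open>a\<close>
        itself lies in the range of the chart.\<close>
      obtain c where c: "c \<in> ?J" "a \<noteq> c" using nonsing[of a] a by blast
      obtain \<phi> where "sphere_chart \<phi> c" using sphere_chart_exists by blast
      then show ?thesis by (rule sphere_chart.small_continuum[OF _ cJ assms(4) c(1) a c(2) near \<tau>])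
    qed
    then obtain e where e: "\<And>a. a \<in> ?J \<Longrightarrow> e a > 0" "\<And>a x y. a \<in> ?J \<Longrightarrow> x \<in> ?J \<inter> ball a (e a) \<Longrightarrow> y \<in> ?J \<inter> ball a (e a) \<Longrightarrow>
        \<exists>K. compact K \<and> connected K \<and> K \<subseteq> ?J \<and> x \<in> K \<and> y \<in> K \<and> diameter K < \<tau>" by metis
    \<comment> \<open>A Lebesgue number replaces the radii \<open>e a\<close> by one uniform
      radius.\<close>
    have "compact ?J" using cJ compact_csphere_iff by blast
    moreover have "?J \<subseteq> \<Union>((\<lambda>a. ball a (e a)) ` ?J)" using e(1) by force
    moreover have "open B" if "B \<in> (\<lambda>a. ball a (e a)) ` ?J" for B using that by auto
    ultimately obtain \<theta> where \<theta>: "\<theta> > 0" "\<And>x. x \<in> ?J \<Longrightarrow> \<exists>B\<in>(\<lambda>a. ball a (e a)) ` ?J. ball x \<theta> \<subseteq> B"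
      using Heine_Borel_lemma[of ?J "(\<lambda>a. ball a (e a)) ` ?J"] by metis
    have K: "\<exists>K. compact K \<and> connected K \<and> K \<subseteq> ?J \<and> x \<in> K \<and> y \<in> K \<and> diameter K < \<tau>"
      if xy: "x \<in> ?J" "y \<in> ?J" "dist x y < \<theta>" for x y
    proof -
      obtain a where a: "a \<in> ?J" "ball x \<theta> \<subseteq> ball a (e a)" using \<theta>(2)[OF xy(1)] by blast
      have "x \<in> ball x \<theta>" "y \<in> ball x \<theta>" using xy(3) \<theta>(1) by simp_all
      then show ?thesis using e(2)[OF a(1)] a(2) xy(1,2) by blast
    qed
    have "\<exists>B. continuum B \<and> B \<subseteq> ?J \<and> a \<in> B \<and> b \<in> B \<and> diameter B < \<tau>"
      if ab: "a \<in> ?J" "b \<in> ?J" "dist a b < \<theta>" for a b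
    proof (cases "a = b")
      case False
      obtain K where "compact K" "connected K" "K \<subseteq> ?J" "a \<in> K" "b \<in> K" "diameter K < \<tau>"
        using K[OF ab] by blast
      then show ?thesis unfolding continuum_def using False by blast
    next
      case True
      \<comment> \<open>A continuum needs two points, so a nearby second point of the perfect set
        \<open>J\<close> takes the place of \<open>b\<close>.\<close>
      have "a islimpt ?J" using assms(4) ab(1) nonsing by (rule connected_imp_perfect)
      then obtain b' where b': "b' \<in> ?J" "b' \<noteq> a" "dist b' a < \<theta>"
        using \<theta>(1) unfolding islimpt_approachable by blast
      then have "dist a b' < \<theta>" by (simp add: dist_commute)
      then obtain K where "compact K" "connected K" "K \<subseteq> ?J" "a \<in> K" "b' \<in> K" "diameter K < \<tau>"
        using K[OF ab(1) b'(1)] by blast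
      then show ?thesis unfolding continuum_def using b'(2) True by blast
    qed
    then show "\<exists>\<theta>>0. \<forall>a\<in>?J. \<forall>b\<in>?J. dist a b < \<theta> \<longrightarrow>
        (\<exists>B. continuum B \<and> B \<subseteq> ?J \<and> a \<in> B \<and> b \<in> B \<and> diameter B < \<tau>)"
      using \<theta>(1) by blast
  qed
qed

end
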